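(* Let $\sigma$ be a multiplier of $\mathbb{Z}^d$, with $d\in\mathbb{N}\setminus\{0,1\}$. Let $\ell$ be a continuous length function on $\mathbb{T}^d=\{(z_1,\ldots,z_d)\in\mathbb{C}^d : \forall j\in\{1,\ldots,d\}\ |z_j|=1\}$. Denote by $\alpha$ the dual action of $\mathbb{T}^d$ on the quantum torus $\mathfrak{A}_\sigma=C^\ast(\mathbb{Z}^d,\sigma)$. For any closed subgroup $G$ of $\mathbb{T}^d$, denote by $\mathfrak{A}_\sigma^G$ the fixed point C*-subalgebra of $\mathfrak{A}_\sigma$ for $\alpha$ restricted to $G$. For all $a\in\mathfrak{A}_\sigma$, set $$\mathsf{L}(a)=\sup\left\{\frac{\|a-\alpha^z(a)\|_{\mathfrak{A}_\sigma}}{\ell(z)} : z\in\mathbb{T}^d\setminus\{(1,\ldots,1)\}\right\}.$$ If $(G_n)_{n\in\mathbb{N}}$ is a sequence of closed subgroups of $\mathbb{T}^d$ converging to some closed subgroup $G_\infty$ of $\mathbb{T}^d$ for the Hausdorff distance $\mathsf{Haus}_\ell$ induced by the invariant metric defined by $\ell$ on $\mathbb{T}^d$, then $$\lim_{n\to\infty}\mathsf{\Lambda}_{1,0}\left((\mathfrak{A}_\sigma^{G_n},\mathsf{L}),(\mathfrak{A}_\sigma^{G_\infty},\mathsf{L})\right)=0,$$ where $\mathsf{L}$ also denotes its restrictions to $\mathfrak{A}_\sigma^{G_n}$ and $\mathfrak{A}_\sigma^{G_\infty}$.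
   Context: The conclusion implicitly includes that the pairs $(\mathfrak{A}_\sigma^{G_n},\mathsf{L})$ and $(\mathfrak{A}_\sigma^{G_\infty},\mathsf{L})$ are Leibniz, i.e. $(1,0)$-quasi-Leibniz, quantum compact metric spaces in the sense below, so that $\mathsf{\Lambda}_{1,0}$ applies. A multiplier of $\mathbb{Z}^d$ is a normalized circle-valued 2-cocycle $\sigma:\mathbb{Z}^d\times\mathbb{Z}^d\to\mathbb{T}$. $C^\ast(\mathbb{Z}^d,\sigma)$ is the twisted group C*-algebra, i.e. the universal unital C*-algebra generated by unitaries $(U_p)_{p\in\mathbb{Z}^d}$ with $U_pU_q=\sigma(p,q)U_{p+q}$. The dual action is determined by $\alpha^z(U_p)=z_1^{p_1}\cdots z_d^{p_d}U_p$. A length function on a group $G$ with identity $e$ is $\ell:G\to[0,\infty)$ with $\ell(g)=0\iff g=e$, $\ell(g^{-1})=\ell(g)$ and $\ell(gh)\leq\ell(g)+\ell(h)$. The associated invariant metric is $(g,h)\mapsto\ell(g^{-1}h)$, and $\mathsf{Haus}_\ell$ is its Hausdorff distance on closed subsets. For a unital C*-algebra $\mathfrak{A}$: $1_{\mathfrak{A}}$ is the unit, $\|\cdot\|_{\mathfrak{A}}$ the norm, $\mathfrak{sa}(\mathfrak{A})$ the space of self-adjoint elements, $\mathscr{S}(\mathfrak{A})$ the state space. Quasi-Leibniz quantum compact metric spaces. Let $F:[0,\infty)^4\to[0,\infty)$ be weakly increasing for the product order. An $F$-quasi-Leibniz quantum compact metric space $(\mathfrak{A},\mathsf{L})$ is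 a unital C*-algebra $\mathfrak{A}$ with a seminorm $\mathsf{L}$ defined on a dense Jordan-Lie subalgebra $\mathrm{dom}(\mathsf{L})$ of $\mathfrak{sa}(\mathfrak{A})$ (convention: $\mathsf{L}=\infty$ on $\mathfrak{sa}(\mathfrak{A})\setminus\mathrm{dom}(\mathsf{L})$) such that: (i) $\{a\in\mathrm{dom}(\mathsf{L}) : \mathsf{L}(a)=0\} = \mathbb{R}1_{\mathfrak{A}}$; (ii) $\mathsf{mk}_{\mathsf{L}}(\varphi,\psi) = \sup\{|\varphi(a)-\psi(a)| : a\in\mathrm{dom}(\mathsf{L}), \mathsf{L}(a)\leq 1\}$ defines a metric on $\mathscr{S}(\mathfrak{A})$ which metrizes the weak* topology; (iii) $\mathsf{L}$ is lower semicontinuous for $\|\cdot\|_{\mathfrak{A}}$; (iv) for all $a,b\in\mathrm{dom}(\mathsf{L})$, $\max\{\mathsf{L}(\frac{ab+ba}{2}),\mathsf{L}(\frac{ab-ba}{2i})\}\leq F(\|a\|_{\mathfrak{A}},\|b\|_{\mathfrak{A}},\mathsf{L}(a),\mathsf{L}(b))$. It is called $(C,D)$-quasi-Leibniz ($C\geq 1$, $D\geq 0$) when $F(x,y,l_x,l_y)=C(x l_y+y l_x)+D l_x l_y$. When $\mathsf{L}$ is given by a formula on all of $\mathfrak{A}$, it is understood as restricted to the self-adjoint elements where it is finite. Bridges. A bridge $\gamma=(\mathfrak{D},\pi_{\mathfrak{A}},\pi_{\mathfrak{B}},x)$ from a unital C*-algebra $\mathfrak{A}$ to a unital C*-algebra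 $\mathfrak{B}$ consists of a unital C*-algebra $\mathfrak{D}$, unital *-monomorphisms $\pi_{\mathfrak{A}}:\mathfrak{A}\hookrightarrow\mathfrak{D}$, $\pi_{\mathfrak{B}}:\mathfrak{B}\hookrightarrow\mathfrak{D}$, and $x\in\mathfrak{D}$ such that $\mathscr{S}(\mathfrak{D}|x)=\{\varphi\in\mathscr{S}(\mathfrak{D}) : \forall d\in\mathfrak{D},\ \varphi(xd)=\varphi(dx)=\varphi(d)\}\neq\emptyset$. Given quantum compact metric spaces $(\mathfrak{A},\mathsf{L}_{\mathfrak{A}})$, $(\mathfrak{B},\mathsf{L}_{\mathfrak{B}})$, the length $\lambda(\gamma|\mathsf{L}_{\mathfrak{A}},\mathsf{L}_{\mathfrak{B}})$ is the maximum of the height, i.e. the maximum over $\mathfrak{C}\in\{\mathfrak{A},\mathfrak{B}\}$ of the Hausdorff distance, for $\mathsf{mk}_{\mathsf{L}_{\mathfrak{C}}}$, between $\mathscr{S}(\mathfrak{C})$ and $\{\varphi\circ\pi_{\mathfrak{C}} : \varphi\in\mathscr{S}(\mathfrak{D}|x)\}$, and the reach, i.e. the maximum of $\sup_{a}\inf_{b}\|\pi_{\mathfrak{A}}(a)x-x\pi_{\mathfrak{B}}(b)\|_{\mathfrak{D}}$ and $\sup_b\inf_a\|\pi_{\mathfrak{A}}(a)x-x\pi_{\mathfrak{B}}(b)\|_{\mathfrak{D}}$, where $a$ ranges over $\{a\in\mathfrak{sa}(\mathfrak{A}):\mathsf{L}_{\mathfrak{A}}(a)\leq 1\}$ and $b$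 over $\{b\in\mathfrak{sa}(\mathfrak{B}):\mathsf{L}_{\mathfrak{B}}(b)\leq 1\}$. Quantum propinquity. $\mathsf{\Lambda}_F$ is the largest class function on pairs of $F$-quasi-Leibniz quantum compact metric spaces which: (1) is nonnegative, symmetric, and bounded above by the maximum of the diameters of the two state spaces for their metrics $\mathsf{mk}$; (2) satisfies the triangle inequality; (3) satisfies $\mathsf{\Lambda}_F((\mathfrak{A},\mathsf{L}_{\mathfrak{A}}),(\mathfrak{B},\mathsf{L}_{\mathfrak{B}}))\leq\lambda(\gamma|\mathsf{L}_{\mathfrak{A}},\mathsf{L}_{\mathfrak{B}})$ for every bridge $\gamma$ from $\mathfrak{A}$ to $\mathfrak{B}$; (4) vanishes if and only if there is a *-isomorphism $\theta:\mathfrak{A}\to\mathfrak{B}$ with $\mathsf{L}_{\mathfrak{B}}\circ\theta=\mathsf{L}_{\mathfrak{A}}$. (Equivalently, it is the infimum, over finite chains of $F$-quasi-Leibniz quantum compact metric spaces joining the two spaces with a bridge between consecutive ones, of the sum of the lengths of the bridges.) For $F(x,y,l_x,l_y)=C(x l_y+y l_x)+D l_x l_y$ one writes $\mathsf{\Lambda}_{C,D}$. *)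

theory Defs
  imports "HOL-Analysis.Analysis" "HOL-Algebra.Module"
begin

section \<open>Unital C*-algebras\<close>

definition complex_ring :: "complex ring"
  where "complex_ring = \<lparr>carrier = UNIV, mult = (*), one = 1, zero = 0, add = (+)\<rparr>"

record 'a cstar = "(complex, 'a) module" +
  star :: "'a \<Rightarrow> 'a"
  cnorm :: "'a \<Rightarrow> real"

text \<open>
  A C*-algebra is a carrier set with operations, not a type: the quantum propinquity is an
  infimum over chains of varying C*-algebras, so these have to be values.
  The zero algebra, which has no state, is excluded.
\<close>

locale cstar_algebra = module complex_ring A + ring A for A :: "'a cstar" (structure) +
  assumes one_not_zero: "\<one> \<noteq> \<zero>"
    and smult_mult_left: "\<lbrakk>a \<in> carrier A; b \<in> carrier A\<rbrakk> \<Longrightarrow> (c \<odot> a) \<otimes> b = c \<odot> (a \<otimes> b)"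
    and smult_mult_right: "\<lbrakk>a \<in> carrier A; b \<in> carrier A\<rbrakk> \<Longrightarrow> a \<otimes> (c \<odot> b) = c \<odot> (a \<otimes> b)"
    and star_closed: "a \<in> carrier A \<Longrightarrow> star A a \<in> carrier A"
    and star_star: "a \<in> carrier A \<Longrightarrow> star A (star A a) = a"
    and star_add: "\<lbrakk>a \<in> carrier A; b \<in> carrier A\<rbrakk> \<Longrightarrow> star A (a \<oplus> b) = star A a \<oplus> star A b"
    and star_smult: "a \<in> carrier A \<Longrightarrow> star A (c \<odot> a) = cnj c \<odot> star A a"
    and star_mult: "\<lbrakk>a \<in> carrier A; b \<in> carrier A\<rbrakk> \<Longrightarrow> star A (a \<otimes> b) = star A b \<otimes> star A a"
    and cnorm_nonneg: "a \<in> carrier A \<Longrightarrow> 0 \<le> cnorm A a"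
    and cnorm_eq_0: "a \<in> carrier A \<Longrightarrow> cnorm A a = 0 \<longleftrightarrow> a = \<zero>"
    and cnorm_add: "\<lbrakk>a \<in> carrier A; b \<in> carrier A\<rbrakk> \<Longrightarrow> cnorm A (a \<oplus> b) \<le> cnorm A a + cnorm A b"
    and cnorm_smult: "a \<in> carrier A \<Longrightarrow> cnorm A (c \<odot> a) = cmod c * cnorm A a"
    and cnorm_mult: "\<lbrakk>a \<in> carrier A; b \<in> carrier A\<rbrakk> \<Longrightarrow> cnorm A (a \<otimes> b) \<le> cnorm A a * cnorm A b"
    and cnorm_star_mult: "a \<in> carrier A \<Longrightarrow> cnorm A (star A a \<otimes> a) = (cnorm A a)\<^sup>2"
    and complete: "\<lbrakk>\<And>n. X n \<in> carrier A;
        \<And>e. e > 0 \<Longrightarrow> \<exists>N. \<forall>m\<ge>N. \<forall>n\<ge>N. cnorm A (X m \<ominus> X n) < e\<rbrakk>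
        \<Longrightarrow> \<exists>x\<in>carrier A. (\<lambda>n. cnorm A (X n \<ominus> x)) \<longlonglongrightarrow> 0"

text \<open>
  The value off the carrier is irrelevant, but the library's locale of metric spaces asks for
  nonnegativity and symmetry on the whole type.
\<close>

definition cdist :: "'a cstar \<Rightarrow> 'a \<Rightarrow> 'a \<Rightarrow> real"
  where "cdist A a b = (if a \<in> carrier A \<and> b \<in> carrier A then cnorm A (a \<ominus>\<^bsub>A\<^esub> b) else 0)"

definition norm_topology :: "'a cstar \<Rightarrow> 'a topology"
  where "norm_topology A = Metric_space.mtopology (carrier A) (cdist A)"

lemma (in cstar_algebra) Metric_space_cdist: "Metric_space (carrier A) (cdist A)"
proof
  have neg: "cnorm A (\<ominus> a) = cnorm A a" if "a \<in> carrier A" for a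
  proof -
    have "(- 1) \<odot> a \<oplus> 1 \<odot> a = \<zero>"
      using smult_l_distr[of "- 1" 1 a] smult_l_distr[of 0 0 a] that
        smult_closed[of _ a]
      by (simp add: complex_ring_def)
    moreover have "1 \<odot> a = a"
      using smult_one[OF that] by (simp add: complex_ring_def)
    ultimately have "\<ominus> a = (- 1) \<odot> a"
      using that smult_closed[of "- 1" a]
      by (simp add: complex_ring_def minus_equality)
    then show ?thesis
      by (simp add: cnorm_smult that)
  qed
  fix x y z
  show "0 \<le> cdist A x y"
    by (simp add: cdist_def cnorm_nonneg)
  have "cnorm A (x \<ominus> y) = cnorm A (y \<ominus> x)" if "x \<in> carrier A" "y \<in> carrier A"
    using neg[of "x \<ominus> y"] that by (simp add: minus_eq minus_add r_neg a_comm)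
  then show "cdist A x y = cdist A y x"
    by (auto simp: cdist_def)
  assume x: "x \<in> carrier A" and y: "y \<in> carrier A"
  show "cdist A x y = 0 \<longleftrightarrow> x = y"
  proof
    assume "cdist A x y = 0"
    then have "x \<ominus> y = \<zero>"
      using x y by (simp add: cdist_def cnorm_eq_0)
    moreover have "x = (x \<ominus> y) \<oplus> y"
      using x y by (simp add: minus_eq a_assoc l_neg)
    ultimately show "x = y"
      using y by simp
  next
    assume "x = y"
    then show "cdist A x y = 0"
      using y cnorm_eq_0[of \<zero>] by (simp add: cdist_def minus_eq r_neg)
  qed
  assume z: "z \<in> carrier A"
  have "x \<ominus> z = (x \<ominus> y) \<oplus> (y \<ominus> z)"
    using x y z by (simp add: minus_eq a_assoc r_neg1)
  then show "cdist A x z \<le> cdist A x y + cdist A y z"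
    using cnorm_add[of "x \<ominus> y" "y \<ominus> z"] x y z by (simp add: cdist_def)
qed

definition sa :: "'a cstar \<Rightarrow> 'a set"
  where "sa A = {a \<in> carrier A. star A a = a}"

definition star_hom :: "'a cstar \<Rightarrow> 'b cstar \<Rightarrow> ('a \<Rightarrow> 'b) set"
  where "star_hom A B = {f \<in> ring_hom A B.
    (\<forall>c. \<forall>a\<in>carrier A. f (c \<odot>\<^bsub>A\<^esub> a) = c \<odot>\<^bsub>B\<^esub> f a) \<and>
    (\<forall>a\<in>carrier A. f (star A a) = star B (f a))}"

definition cstar_subalgebra :: "'a set \<Rightarrow> 'a cstar \<Rightarrow> bool"
  where "cstar_subalgebra B A \<longleftrightarrow>
    B \<subseteq> carrier A \<and> \<one>\<^bsub>A\<^esub> \<in> B \<and>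
    (\<forall>a\<in>B. \<forall>b\<in>B. a \<oplus>\<^bsub>A\<^esub> b \<in> B \<and> a \<otimes>\<^bsub>A\<^esub> b \<in> B) \<and>
    (\<forall>c. \<forall>a\<in>B. c \<odot>\<^bsub>A\<^esub> a \<in> B) \<and> (\<forall>a\<in>B. star A a \<in> B) \<and>
    closedin (norm_topology A) B"

text \<open>
  Functionals are extensional (undefined off the carrier), so that states which agree on the
  algebra are equal.
\<close>

definition states :: "'a cstar \<Rightarrow> ('a \<Rightarrow> complex) set"
  where "states A = {\<phi> \<in> extensional (carrier A).
    (\<forall>a\<in>carrier A. \<forall>b\<in>carrier A. \<phi> (a \<oplus>\<^bsub>A\<^esub> b) = \<phi> a + \<phi> b) \<and>
    (\<forall>c. \<forall>a\<in>carrier A. \<phi> (c \<odot>\<^bsub>A\<^esub> a) = c * \<phi> a) \<and>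
    (\<forall>a\<in>carrier A. \<phi> (star A a \<otimes>\<^bsub>A\<^esub> a) \<in> \<real>\<^sub>\<ge>\<^sub>0) \<and>
    \<phi> \<one>\<^bsub>A\<^esub> = 1}"

definition weak_star_topology :: "'a cstar \<Rightarrow> ('a \<Rightarrow> complex) topology"
  where "weak_star_topology A =
    subtopology (product_topology (\<lambda>_. euclidean) (carrier A)) (states A)"


section \<open>Quasi-Leibniz quantum compact metric spaces\<close>

definition hausdorff_distance :: "('a \<Rightarrow> 'a \<Rightarrow> ennreal) \<Rightarrow> 'a set \<Rightarrow> 'a set \<Rightarrow> ennreal"
  where "hausdorff_distance d X Y =
    max (SUP x\<in>X. INF y\<in>Y. d x y) (SUP y\<in>Y. INF x\<in>X. d x y)"

text \<open>
  Only the values of \<open>L\<close> on \<^term>\<open>sa A\<close> matter below; the value \<open>\<infinity>\<close> encodes being outside of the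
  domain of the seminorm.
\<close>

definition lip_dom :: "'a cstar \<Rightarrow> ('a \<Rightarrow> ennreal) \<Rightarrow> 'a set"
  where "lip_dom A L = {a \<in> sa A. L a < \<infinity>}"

definition lip_ball :: "'a cstar \<Rightarrow> ('a \<Rightarrow> ennreal) \<Rightarrow> 'a set"
  where "lip_ball A L = {a \<in> sa A. L a \<le> 1}"

definition mk :: "'a cstar \<Rightarrow> ('a \<Rightarrow> ennreal) \<Rightarrow> ('a \<Rightarrow> complex) \<Rightarrow> ('a \<Rightarrow> complex) \<Rightarrow> ennreal"
  where "mk A L \<phi> \<psi> = (SUP a\<in>lip_ball A L. ennreal (cmod (\<phi> a - \<psi> a)))"

definition jordan_product :: "'a cstar \<Rightarrow> 'a \<Rightarrow> 'a \<Rightarrow> 'a"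
  where "jordan_product A a b = (1 / 2) \<odot>\<^bsub>A\<^esub> (a \<otimes>\<^bsub>A\<^esub> b \<oplus>\<^bsub>A\<^esub> b \<otimes>\<^bsub>A\<^esub> a)"

definition lie_product :: "'a cstar \<Rightarrow> 'a \<Rightarrow> 'a \<Rightarrow> 'a"
  where "lie_product A a b = (1 / (2 * \<i>)) \<odot>\<^bsub>A\<^esub> (a \<otimes>\<^bsub>A\<^esub> b \<ominus>\<^bsub>A\<^esub> b \<otimes>\<^bsub>A\<^esub> a)"

definition weakly_increasing :: "(real \<Rightarrow> real \<Rightarrow> real \<Rightarrow> real \<Rightarrow> real) \<Rightarrow> bool"
  where "weakly_increasing F \<longleftrightarrow>
    (\<forall>x y s t. 0 \<le> x \<and> 0 \<le> y \<and> 0 \<le> s \<and> 0 \<le> t \<longrightarrow> 0 \<le> F x y s t) \<and>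
    (\<forall>x x' y y' s s' t t'. 0 \<le> x \<and> x \<le> x' \<and> 0 \<le> y \<and> y \<le> y' \<and> 0 \<le> s \<and> s \<le> s' \<and> 0 \<le> t \<and> t \<le> t'
      \<longrightarrow> F x y s t \<le> F x' y' s' t')"

definition quasi_leibniz_qcms ::
  "(real \<Rightarrow> real \<Rightarrow> real \<Rightarrow> real \<Rightarrow> real) \<Rightarrow> 'a cstar \<Rightarrow> ('a \<Rightarrow> ennreal) \<Rightarrow> bool"
  where "quasi_leibniz_qcms F A L \<longleftrightarrow>
    weakly_increasing F \<and> cstar_algebra A \<and>
    \<comment> \<open>seminorm on a dense Jordan-Lie subalgebra\<close>
    \<zero>\<^bsub>A\<^esub> \<in> lip_dom A L \<and>
    (\<forall>a\<in>lip_dom A L. \<forall>b\<in>lip_dom A L.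
      a \<oplus>\<^bsub>A\<^esub> b \<in> lip_dom A L \<and> L (a \<oplus>\<^bsub>A\<^esub> b) \<le> L a + L b) \<and>
    (\<forall>t::real. \<forall>a\<in>lip_dom A L.
      complex_of_real t \<odot>\<^bsub>A\<^esub> a \<in> lip_dom A L \<and> L (complex_of_real t \<odot>\<^bsub>A\<^esub> a) = ennreal \<bar>t\<bar> * L a) \<and>
    (\<forall>a\<in>lip_dom A L. \<forall>b\<in>lip_dom A L.
      jordan_product A a b \<in> lip_dom A L \<and> lie_product A a b \<in> lip_dom A L) \<and>
    sa A \<subseteq> norm_topology A closure_of lip_dom A L \<and>
    \<comment> \<open>the kernel consists of the scalars\<close>
    {a \<in> lip_dom A L. L a = 0} = range (\<lambda>t::real. complex_of_real t \<odot>\<^bsub>A\<^esub> \<one>\<^bsub>A\<^esub>) \<and>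
    \<comment> \<open>the Monge-Kantorovich metric metrizes the weak* topology\<close>
    (\<forall>\<phi>\<in>states A. \<forall>\<psi>\<in>states A. mk A L \<phi> \<psi> < \<infinity>) \<and>
    Metric_space (states A) (\<lambda>\<phi> \<psi>. enn2real (mk A L \<phi> \<psi>)) \<and>
    Metric_space.mtopology (states A) (\<lambda>\<phi> \<psi>. enn2real (mk A L \<phi> \<psi>)) = weak_star_topology A \<and>
    \<comment> \<open>lower semicontinuity, as closedness of sublevel sets\<close>
    (\<forall>r\<ge>0. closedin (norm_topology A) {a \<in> sa A. L a \<le> ennreal r}) \<and>
    \<comment> \<open>quasi-Leibniz inequality\<close>
    (\<forall>a\<in>lip_dom A L. \<forall>b\<in>lip_dom A L.
      max (L (jordan_product A a b)) (L (lie_product A a b))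
        \<le> ennreal (F (cnorm A a) (cnorm A b) (enn2real (L a)) (enn2real (L b))))"

definition leibniz_fun :: "real \<Rightarrow> real \<Rightarrow> real \<Rightarrow> real \<Rightarrow> real \<Rightarrow> real \<Rightarrow> real"
  where "leibniz_fun C D x y lx ly = C * (x * ly + y * lx) + D * lx * ly"


section \<open>Bridges and the quantum propinquity\<close>

record 'a bridge =
  bridge_alg :: "'a cstar"
  left_map :: "'a \<Rightarrow> 'a"
  right_map :: "'a \<Rightarrow> 'a"
  pivot :: 'a

definition level_states :: "'a cstar \<Rightarrow> 'a \<Rightarrow> ('a \<Rightarrow> complex) set"
  where "level_states D x = {\<phi> \<in> states D. \<forall>d\<in>carrier D.
    \<phi> (x \<otimes>\<^bsub>D\<^esub> d) = \<phi> d \<and> \<phi> (d \<otimes>\<^bsub>D\<^esub> x) = \<phi> d}"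

definition is_bridge :: "'a cstar \<Rightarrow> 'a cstar \<Rightarrow> 'a bridge \<Rightarrow> bool"
  where "is_bridge A B \<gamma> \<longleftrightarrow>
    cstar_algebra (bridge_alg \<gamma>) \<and>
    left_map \<gamma> \<in> star_hom A (bridge_alg \<gamma>) \<and> inj_on (left_map \<gamma>) (carrier A) \<and>
    right_map \<gamma> \<in> star_hom B (bridge_alg \<gamma>) \<and> inj_on (right_map \<gamma>) (carrier B) \<and>
    pivot \<gamma> \<in> carrier (bridge_alg \<gamma>) \<and>
    level_states (bridge_alg \<gamma>) (pivot \<gamma>) \<noteq> {}"

definition pulled_back_states :: "'a cstar \<Rightarrow> ('a \<Rightarrow> 'a) \<Rightarrow> 'a bridge \<Rightarrow> ('a \<Rightarrow> complex) set"
  where "pulled_back_states C \<pi> \<gamma> =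
    (\<lambda>\<phi>. restrict (\<phi> \<circ> \<pi>) (carrier C)) ` level_states (bridge_alg \<gamma>) (pivot \<gamma>)"

definition bridge_height ::
  "'a bridge \<Rightarrow> 'a cstar \<Rightarrow> ('a \<Rightarrow> ennreal) \<Rightarrow> 'a cstar \<Rightarrow> ('a \<Rightarrow> ennreal) \<Rightarrow> ennreal"
  where "bridge_height \<gamma> A L\<^sub>A B L\<^sub>B =
    max (hausdorff_distance (mk A L\<^sub>A) (states A) (pulled_back_states A (left_map \<gamma>) \<gamma>))
        (hausdorff_distance (mk B L\<^sub>B) (states B) (pulled_back_states B (right_map \<gamma>) \<gamma>))"

definition bridge_seminorm :: "'a bridge \<Rightarrow> 'a \<Rightarrow> 'a \<Rightarrow> real"
  where "bridge_seminorm \<gamma> a b = (let D = bridge_alg \<gamma> in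
    cnorm D (left_map \<gamma> a \<otimes>\<^bsub>D\<^esub> pivot \<gamma> \<ominus>\<^bsub>D\<^esub> pivot \<gamma> \<otimes>\<^bsub>D\<^esub> right_map \<gamma> b))"

definition bridge_reach ::
  "'a bridge \<Rightarrow> 'a cstar \<Rightarrow> ('a \<Rightarrow> ennreal) \<Rightarrow> 'a cstar \<Rightarrow> ('a \<Rightarrow> ennreal) \<Rightarrow> ennreal"
  where "bridge_reach \<gamma> A L\<^sub>A B L\<^sub>B =
    max (SUP a\<in>lip_ball A L\<^sub>A. INF b\<in>lip_ball B L\<^sub>B. ennreal (bridge_seminorm \<gamma> a b))
        (SUP b\<in>lip_ball B L\<^sub>B. INF a\<in>lip_ball A L\<^sub>A. ennreal (bridge_seminorm \<gamma> a b))"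

definition bridge_length ::
  "'a bridge \<Rightarrow> 'a cstar \<times> ('a \<Rightarrow> ennreal) \<Rightarrow> 'a cstar \<times> ('a \<Rightarrow> ennreal) \<Rightarrow> ennreal"
  where "bridge_length \<gamma> X Y =
    max (bridge_height \<gamma> (fst X) (snd X) (fst Y) (snd Y))
        (bridge_reach \<gamma> (fst X) (snd X) (fst Y) (snd Y))"

text \<open>
  The propinquity is the infimum of the total lengths of finite chains of bridges; the \<open>i\<close>-th bridge goes from the \<open>i\<close>-th to the
  next space. All C*-algebras involved have their carriers in the type \<open>'a\<close>, and this does not
  affect the infimum below. Indeed, as soon as \<open>'a\<close>
  carries a nonzero complex algebra it has at least the cardinality of the continuum; a quantum compact metric space is separable,
  since the weak* topology of its state space is metrizable; and the algebra of a bridge may be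
  replaced by its C*-subalgebra generated by the two images and the pivot \<open>x\<close>, because the condition
  defining \<^const>\<open>level_states\<close> says that \<open>(1 - x)* (1 - x)\<close> and \<open>(1 - x) (1 - x)*\<close> have value 0,
  so it passes to extensions of states. Separable C*-algebras have at most the cardinality of the
  continuum, so every chain has an isomorphic copy in \<open>'a\<close>.
\<close>

definition is_trek ::
  "(real \<Rightarrow> real \<Rightarrow> real \<Rightarrow> real \<Rightarrow> real) \<Rightarrow> 'a cstar \<times> ('a \<Rightarrow> ennreal) \<Rightarrow> 'a cstar \<times> ('a \<Rightarrow> ennreal) \<Rightarrow>
   ('a cstar \<times> ('a \<Rightarrow> ennreal)) list \<Rightarrow> 'a bridge list \<Rightarrow> bool"
  where "is_trek F X Y Xs \<gamma>s \<longleftrightarrow>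
    \<gamma>s \<noteq> [] \<and> length Xs = Suc (length \<gamma>s) \<and> hd Xs = X \<and> last Xs = Y \<and>
    (\<forall>(A, L)\<in>set Xs. quasi_leibniz_qcms F A L) \<and>
    (\<forall>i<length \<gamma>s. is_bridge (fst (Xs ! i)) (fst (Xs ! Suc i)) (\<gamma>s ! i))"

definition propinquity ::
  "(real \<Rightarrow> real \<Rightarrow> real \<Rightarrow> real \<Rightarrow> real) \<Rightarrow> 'a cstar \<times> ('a \<Rightarrow> ennreal) \<Rightarrow> 'a cstar \<times> ('a \<Rightarrow> ennreal) \<Rightarrow>
   ennreal"
  where "propinquity F X Y = (INF (Xs, \<gamma>s) \<in> {(Xs, \<gamma>s). is_trek F X Y Xs \<gamma>s}.
    \<Sum>i<length \<gamma>s. bridge_length (\<gamma>s ! i) (Xs ! i) (Xs ! Suc i))"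


section \<open>The torus and length functions\<close>

text \<open>Multiplication and unit of \<^typ>\<open>complex ^ 'd\<close> are componentwise.\<close>

definition torus :: "(complex ^ 'd) monoid"
  where "torus = \<lparr>carrier = {z. \<forall>j. cmod (z $ j) = 1}, mult = (*), one = 1\<rparr>"

definition length_function :: "('g, 'm) monoid_scheme \<Rightarrow> ('g \<Rightarrow> real) \<Rightarrow> bool"
  where "length_function \<Gamma> len \<longleftrightarrow>
    (\<forall>g\<in>carrier \<Gamma>. 0 \<le> len g) \<and>
    (\<forall>g\<in>carrier \<Gamma>. len g = 0 \<longleftrightarrow> g = \<one>\<^bsub>\<Gamma>\<^esub>) \<and>
    (\<forall>g\<in>carrier \<Gamma>. len (inv\<^bsub>\<Gamma>\<^esub> g) = len g) \<and>
    (\<forall>g\<in>carrier \<Gamma>. \<forall>h\<in>carrier \<Gamma>. len (g \<otimes>\<^bsub>\<Gamma>\<^esub> h) \<le> len g + len h)"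

definition length_metric :: "('g, 'm) monoid_scheme \<Rightarrow> ('g \<Rightarrow> real) \<Rightarrow> 'g \<Rightarrow> 'g \<Rightarrow> ennreal"
  where "length_metric \<Gamma> len g h = ennreal (len (inv\<^bsub>\<Gamma>\<^esub> g \<otimes>\<^bsub>\<Gamma>\<^esub> h))"


section \<open>Quantum tori\<close>

definition multiplier :: "(int ^ 'd \<Rightarrow> int ^ 'd \<Rightarrow> complex) \<Rightarrow> bool"
  where "multiplier \<sigma> \<longleftrightarrow>
    (\<forall>p q. cmod (\<sigma> p q) = 1) \<and>
    (\<forall>p q r. \<sigma> p q * \<sigma> (p + q) r = \<sigma> p (q + r) * \<sigma> q r) \<and>
    (\<forall>p. \<sigma> p 0 = 1 \<and> \<sigma> 0 p = 1)"

definition twisted_unitaries ::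
  "(int ^ 'd \<Rightarrow> int ^ 'd \<Rightarrow> complex) \<Rightarrow> 'a cstar \<Rightarrow> (int ^ 'd \<Rightarrow> 'a) \<Rightarrow> bool"
  where "twisted_unitaries \<sigma> A U \<longleftrightarrow>
    (\<forall>p. U p \<in> carrier A \<and> star A (U p) \<otimes>\<^bsub>A\<^esub> U p = \<one>\<^bsub>A\<^esub> \<and> U p \<otimes>\<^bsub>A\<^esub> star A (U p) = \<one>\<^bsub>A\<^esub>) \<and>
    (\<forall>p q. U p \<otimes>\<^bsub>A\<^esub> U q = \<sigma> p q \<odot>\<^bsub>A\<^esub> U (p + q))"

text \<open>
  \<open>A\<close> with the unitaries \<open>U p\<close> is the twisted group C*-algebra of \<open>\<int>\<^sup>d\<close> for \<open>\<sigma>\<close>. Quantifying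
  over C*-algebras with carrier in the same type \<open>'a\<close> loses nothing: since \<open>A\<close> is nonzero, \<open>'a\<close> has
  at least the cardinality of the continuum, and the C*-algebra generated by countably many
  elements has at most that cardinality. The morphism in the universal property is unique
  because the \<open>U p\<close> generate \<open>A\<close>.
\<close>

definition twisted_group_cstar_algebra ::
  "(int ^ 'd \<Rightarrow> int ^ 'd \<Rightarrow> complex) \<Rightarrow> 'a cstar \<Rightarrow> (int ^ 'd \<Rightarrow> 'a) \<Rightarrow> bool"
  where "twisted_group_cstar_algebra \<sigma> A U \<longleftrightarrow>
    cstar_algebra A \<and> twisted_unitaries \<sigma> A U \<and>
    (\<forall>B. cstar_subalgebra B A \<and> range U \<subseteq> B \<longrightarrow> B = carrier A) \<and>
    (\<forall>(B :: 'a cstar) V. cstar_algebra B \<and> twisted_unitaries \<sigma> B V \<longrightarrow>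
      (\<exists>f\<in>star_hom A B. \<forall>p. f (U p) = V p))"

definition dual_action :: "'a cstar \<Rightarrow> (int ^ 'd \<Rightarrow> 'a) \<Rightarrow> complex ^ 'd \<Rightarrow> 'a \<Rightarrow> 'a"
  where "dual_action A U z = (THE f. f \<in> extensional (carrier A) \<and> f \<in> star_hom A A \<and>
    (\<forall>p. f (U p) = (\<Prod>j\<in>UNIV. (z $ j) powi (p $ j)) \<odot>\<^bsub>A\<^esub> U p))"

definition fixed_point_algebra ::
  "'a cstar \<Rightarrow> (int ^ 'd \<Rightarrow> 'a) \<Rightarrow> (complex ^ 'd) set \<Rightarrow> 'a cstar"
  where "fixed_point_algebra A U G =
    A\<lparr>carrier := {a \<in> carrier A. \<forall>z\<in>G. dual_action A U z a = a}\<rparr>"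

definition lip_seminorm ::
  "'a cstar \<Rightarrow> (int ^ 'd \<Rightarrow> 'a) \<Rightarrow> (complex ^ 'd \<Rightarrow> real) \<Rightarrow> 'a \<Rightarrow> ennreal"
  where "lip_seminorm A U len a =
    (SUP z\<in>carrier torus - {1}. ennreal (cnorm A (a \<ominus>\<^bsub>A\<^esub> dual_action A U z a) / len z))"

end

theory Submission
  imports Defs
begin

text \<open>
  All fixed point algebras lie in \<open>A\<close>, so \<open>A\<close> itself, with its unit as pivot, is a bridge between any two
  of them. Write \<open>E\<^sub>G\<close> for the conditional expectation onto the fixed point algebra of \<open>G\<close>, the average of
  the dual action over \<open>G\<close>. Every state of \<open>A\<close> is a level state, and a state \<open>\<phi>\<close> of the fixed point algebra
  of \<open>G\<close> extends to the state \<open>\<phi> \<circ> E\<^sub>G\<close> of \<open>A\<close> (\<open>state_extension\<close>); hence the height of the bridge is 0.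
  For the reach, let \<open>a\<close> be fixed by \<open>G\<close> with \<open>L a \<le> 1\<close>, and approximate it by \<open>E\<^sub>H a\<close>. Averaging does not increase
  \<open>L\<close>, and the distance from \<open>a\<close> to \<open>E\<^sub>H a\<close> is at most the largest displacement of \<open>a\<close> by an element \<open>y\<close> of \<open>H\<close>. As
  \<open>a\<close> is fixed by \<open>G\<close>, this displacement is at most the length of \<open>x\<^sup>-\<^sup>1 y\<close> for any \<open>x\<close> in \<open>G\<close>. So the propinquity
  is bounded by the Hausdorff distance of \<open>G\<close> and \<open>H\<close> (\<open>propinquity_le\<close>).

  It remains to see that the fixed point algebras are Leibniz quantum compact metric spaces. The algebraic
  properties of \<open>L\<close> and its lower semicontinuity hold because the dual action is by isometric automorphisms.
  Its domain is dense because every \<open>U p\<close> is Lipschitz: some power of \<open>z\<close> with controlled exponent leaves a neighbourhood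
  of the kernel of the character \<open>p\<close>, so the length of \<open>z\<close> dominates a multiple of \<open>|1 - z\<^sup>p|\<close> (\<open>character_le_len\<close>). The metric of
  the states gives the weak* topology because Fejer means converge uniformly on the Lipschitz ball:
  up to any given error, a unital functional of norm 1 is determined on this ball by its values at finitely
  many of the unitaries (\<open>functional_difference_bound\<close>).

  Integration over a group is replaced by a sequence of finite averages, compositions of the operators
  \<open>(1 + \<alpha> g) / 2\<close>. They multiply each \<open>U p\<close> by a scalar that tends to 1 or 0, and they are
  contractions, so they converge on all of \<open>A\<close> (\<open>expectation_conv\<close>). The general facts on
  C*-algebras that are used, contractivity of *-homomorphisms and of states, follow from the existence of a square root of \<open>1 - h\<close>
  for self-adjoint \<open>h\<close> of norm less than 1 (\<open>sqrt_one_minus\<close>).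
\<close>

lemma complex_ring_simps [simp]:
  "carrier complex_ring = UNIV" "\<one>\<^bsub>complex_ring\<^esub> = 1" "\<zero>\<^bsub>complex_ring\<^esub> = 0"
  "x \<oplus>\<^bsub>complex_ring\<^esub> y = x + y" "x \<otimes>\<^bsub>complex_ring\<^esub> y = x * y"
  by (simp_all add: complex_ring_def)

section \<open>Norms and limits in a C*-algebra\<close>

context cstar_algebra
begin

lemma scale_closed [simp]: "a \<in> carrier A \<Longrightarrow> c \<odot> a \<in> carrier A"
  by (rule smult_closed) simp_all

lemma scale_add_left: "a \<in> carrier A \<Longrightarrow> (c + d) \<odot> a = c \<odot> a \<oplus> d \<odot> a"
  using smult_l_distr[of c d a] by simp

lemma scale_add_right: "a \<in> carrier A \<Longrightarrow> b \<in> carrier A \<Longrightarrow> c \<odot> (a \<oplus> b) = c \<odot> a \<oplus> c \<odot> b"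
  using smult_r_distr[of c a b] by simp

lemma scale_scale [simp]: "a \<in> carrier A \<Longrightarrow> c \<odot> (d \<odot> a) = (c * d) \<odot> a"
  using smult_assoc1[of c d a] by simp

lemma scale_one [simp]: "a \<in> carrier A \<Longrightarrow> 1 \<odot> a = a"
  using smult_one[of a] by simp

lemma scale_zero [simp]: "a \<in> carrier A \<Longrightarrow> 0 \<odot> a = \<zero>"
  using smult_l_null[of a] by simp

lemma scale_zero_right [simp]: "c \<odot> \<zero> = \<zero>"
  using smult_r_null[of c] by simp

lemma neg_eq: "a \<in> carrier A \<Longrightarrow> \<ominus> a = (- 1) \<odot> a"
  using scale_add_left[of a "- 1" 1] by (simp add: minus_equality)

lemma minus_conv: "a \<in> carrier A \<Longrightarrow> b \<in> carrier A \<Longrightarrow> a \<ominus> b = a \<oplus> (- 1) \<odot> b"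
  by (simp add: minus_eq neg_eq)

lemma diff_closed [simp]: "a \<in> carrier A \<Longrightarrow> b \<in> carrier A \<Longrightarrow> a \<ominus> b \<in> carrier A"
  by (simp add: minus_conv)

declare star_closed [simp] star_star [simp] cnorm_nonneg [simp]

lemma norm_zero [simp]: "cnorm A \<zero> = 0"
  by (simp add: cnorm_eq_0)

lemma diff_self [simp]: "a \<in> carrier A \<Longrightarrow> a \<ominus> a = \<zero>"
  by (simp add: minus_eq r_neg)

lemma eq_diff_iff: "a \<in> carrier A \<Longrightarrow> b \<in> carrier A \<Longrightarrow> cnorm A (a \<ominus> b) = 0 \<longleftrightarrow> a = b"
  using Metric_space.zero[OF Metric_space_cdist, of a b] by (simp add: cdist_def)

lemma norm_diff_commute: "a \<in> carrier A \<Longrightarrow> b \<in> carrier A \<Longrightarrow> cnorm A (a \<ominus> b) = cnorm A (b \<ominus> a)"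
  using Metric_space.commute[OF Metric_space_cdist, of a b] by (simp add: cdist_def)

lemma norm_diff_triangle:
  "a \<in> carrier A \<Longrightarrow> b \<in> carrier A \<Longrightarrow> c \<in> carrier A \<Longrightarrow>
   cnorm A (a \<ominus> c) \<le> cnorm A (a \<ominus> b) + cnorm A (b \<ominus> c)"
  using Metric_space.triangle[OF Metric_space_cdist, of a b c] by (simp add: cdist_def)

lemma add_diff_add:
  "a \<in> carrier A \<Longrightarrow> b \<in> carrier A \<Longrightarrow> c \<in> carrier A \<Longrightarrow> d \<in> carrier A \<Longrightarrow>
   (a \<oplus> b) \<ominus> (c \<oplus> d) = (a \<ominus> c) \<oplus> (b \<ominus> d)"
  by (simp add: minus_conv scale_add_right a_ac)

lemma scale_diff:
  "a \<in> carrier A \<Longrightarrow> b \<in> carrier A \<Longrightarrow> c \<odot> (a \<ominus> b) = c \<odot> a \<ominus> c \<odot> b"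
  by (simp add: minus_conv scale_add_right)

lemma norm_add_diff_add:
  "a \<in> carrier A \<Longrightarrow> b \<in> carrier A \<Longrightarrow> c \<in> carrier A \<Longrightarrow> d \<in> carrier A \<Longrightarrow>
   cnorm A ((a \<oplus> b) \<ominus> (c \<oplus> d)) \<le> cnorm A (a \<ominus> c) + cnorm A (b \<ominus> d)"
  by (simp add: add_diff_add cnorm_add)

lemma diff_add_cancel: "a \<in> carrier A \<Longrightarrow> b \<in> carrier A \<Longrightarrow> (a \<ominus> b) \<oplus> b = a"
  by (simp add: minus_eq a_assoc l_neg)

lemma norm_le_diff: "a \<in> carrier A \<Longrightarrow> b \<in> carrier A \<Longrightarrow> cnorm A a \<le> cnorm A (a \<ominus> b) + cnorm A b"
  using cnorm_add[of "a \<ominus> b" b] by (simp add: diff_add_cancel)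

lemma mult_diff_right:
  "a \<in> carrier A \<Longrightarrow> b \<in> carrier A \<Longrightarrow> c \<in> carrier A \<Longrightarrow> a \<otimes> (b \<ominus> c) = a \<otimes> b \<ominus> a \<otimes> c"
  by (simp add: minus_conv r_distr smult_mult_right)

lemma mult_diff_left:
  "a \<in> carrier A \<Longrightarrow> b \<in> carrier A \<Longrightarrow> c \<in> carrier A \<Longrightarrow> (b \<ominus> c) \<otimes> a = b \<otimes> a \<ominus> c \<otimes> a"
  by (simp add: minus_conv l_distr smult_mult_left)

lemma mult_diff_mult:
  assumes "a \<in> carrier A" "b \<in> carrier A" "c \<in> carrier A" "d \<in> carrier A"
  shows "a \<otimes> b \<ominus> c \<otimes> d = a \<otimes> (b \<ominus> d) \<oplus> (a \<ominus> c) \<otimes> d"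
proof -
  have "a \<otimes> (b \<ominus> d) \<oplus> (a \<ominus> c) \<otimes> d = (a \<otimes> b \<ominus> a \<otimes> d) \<oplus> (a \<otimes> d \<ominus> c \<otimes> d)"
    using assms by (simp add: mult_diff_left mult_diff_right)
  also have "\<dots> = a \<otimes> b \<ominus> c \<otimes> d"
    using assms by (simp add: minus_eq a_assoc r_neg1)
  finally show ?thesis by simp
qed

lemma norm_mult_diff_mult:
  assumes "a \<in> carrier A" "b \<in> carrier A" "c \<in> carrier A" "d \<in> carrier A"
  shows "cnorm A (a \<otimes> b \<ominus> c \<otimes> d) \<le> cnorm A a * cnorm A (b \<ominus> d) + cnorm A (a \<ominus> c) * cnorm A d"
  unfolding mult_diff_mult[OF assms]
  by (rule order_trans[OF cnorm_add] add_mono cnorm_mult | use assms in simp)+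

lemma star_diff: "a \<in> carrier A \<Longrightarrow> b \<in> carrier A \<Longrightarrow> star A (a \<ominus> b) = star A a \<ominus> star A b"
  by (simp add: minus_conv star_add star_smult)

lemma star_one [simp]: "star A \<one> = \<one>"
  using star_mult[of "star A \<one>" \<one>] by simp

lemma star_zero [simp]: "star A \<zero> = \<zero>"
  using star_smult[of \<zero> 0] by simp

lemma norm_star [simp]: 
  assumes a: "a \<in> carrier A" shows "cnorm A (star A a) = cnorm A a"
proof -
  have le: "cnorm A b \<le> cnorm A (star A b)" if b: "b \<in> carrier A" for b
  proof (cases "cnorm A b = 0")
    case False
    have "(cnorm A b)\<^sup>2 \<le> cnorm A (star A b) * cnorm A b"
      using cnorm_star_mult[OF b] cnorm_mult[of "star A b" b] b by simp
    with False cnorm_nonneg[OF b] show ?thesis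
      by (simp add: power2_eq_square)
  qed (use b in simp)
  from le[OF a] le[of "star A a"] a show ?thesis by simp
qed

lemma norm_one [simp]: "cnorm A \<one> = 1"
proof -
  have "cnorm A \<one> = (cnorm A \<one>)\<^sup>2"
    using cnorm_star_mult[of \<one>] by simp
  moreover have "cnorm A \<one> \<noteq> 0"
    using one_not_zero by (simp add: cnorm_eq_0)
  ultimately show ?thesis by (simp add: power2_eq_square)
qed

lemma half_scale_double: "a \<in> carrier A \<Longrightarrow> (1 / 2) \<odot> (a \<oplus> a) = a"
  using scale_add_left[of a "1 / 2" "1 / 2"] by (simp add: scale_add_right)

lemma norm_half_scale_le:
  assumes "a \<in> carrier A" "b \<in> carrier A" "cnorm A a \<le> c" "cnorm A b \<le> c"
  shows "cnorm A ((1 / 2) \<odot> (a \<oplus> b)) \<le> c"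
  using cnorm_add[of a b] assms by (simp add: cnorm_smult)

lemma scale_one_inject: "c \<odot> \<one> = d \<odot> \<one> \<Longrightarrow> c = d"
proof -
  assume "c \<odot> \<one> = d \<odot> \<one>"
  then have "(c - d) \<odot> \<one> = \<zero>"
    using scale_add_left[of \<one> c "- d"] scale_add_left[of \<one> d "- d"] by simp
  then show "c = d"
    using cnorm_smult[of \<one> "c - d"] by simp
qed

definition conv :: "(nat \<Rightarrow> 'a) \<Rightarrow> 'a \<Rightarrow> bool"
  where "conv X x \<longleftrightarrow> range X \<subseteq> carrier A \<and> x \<in> carrier A \<and> (\<lambda>n. cnorm A (X n \<ominus> x)) \<longlonglongrightarrow> 0"

lemma conv_closed: "conv X x \<Longrightarrow> x \<in> carrier A" "conv X x \<Longrightarrow> X n \<in> carrier A"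
  by (auto simp: conv_def)

lemma convI:
  assumes "\<And>n. X n \<in> carrier A" "x \<in> carrier A" "\<And>n. cnorm A (X n \<ominus> x) \<le> f n" "f \<longlonglongrightarrow> 0"
  shows "conv X x"
proof -
  have "(\<lambda>n. cnorm A (X n \<ominus> x)) \<longlonglongrightarrow> 0"
    by (rule tendsto_sandwich[OF _ _ tendsto_const assms(4)]) (auto simp: assms)
  then show ?thesis using assms by (auto simp: conv_def)
qed

lemma conv_const: "x \<in> carrier A \<Longrightarrow> conv (\<lambda>_. x) x"
  by (auto simp: conv_def)

lemma conv_add: 
  assumes "conv X x" "conv Y y" shows "conv (\<lambda>n. X n \<oplus> Y n) (x \<oplus> y)"
proof (rule convI)
  show "(\<lambda>n. cnorm A (X n \<ominus> x) + cnorm A (Y n \<ominus> y)) \<longlonglongrightarrow> 0"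
    using assms tendsto_add[of _ 0 _ _ 0] by (auto simp: conv_def)
qed (use assms conv_closed norm_add_diff_add in auto)

lemma conv_scale:
  assumes "conv X x" shows "conv (\<lambda>n. c \<odot> X n) (c \<odot> x)"
proof (rule convI)
  show "(\<lambda>n. cmod c * cnorm A (X n \<ominus> x)) \<longlonglongrightarrow> 0"
    using assms tendsto_mult_right_zero by (auto simp: conv_def)
qed (use assms conv_closed in \<open>auto simp flip: scale_diff simp: cnorm_smult\<close>)

lemma conv_star:
  assumes "conv X x" shows "conv (\<lambda>n. star A (X n)) (star A x)"
proof (rule convI)
  show "(\<lambda>n. cnorm A (X n \<ominus> x)) \<longlonglongrightarrow> 0"
    using assms by (auto simp: conv_def)
qed (use assms conv_closed in \<open>auto simp flip: star_diff\<close>)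

lemma conv_norm:
  assumes "conv X x" shows "(\<lambda>n. cnorm A (X n)) \<longlonglongrightarrow> cnorm A x"
proof (rule LIM_zero_cancel, rule Lim_null_comparison)
  show "(\<lambda>n. cnorm A (X n \<ominus> x)) \<longlonglongrightarrow> 0"
    using assms by (auto simp: conv_def)
  have "\<bar>cnorm A (X n) - cnorm A x\<bar> \<le> cnorm A (X n \<ominus> x)" for n
    using conv_closed[OF assms] norm_le_diff[of "X n" x] norm_le_diff[of x "X n"]
      norm_diff_commute[of x "X n"] by (smt (verit))
  then show "\<forall>\<^sub>F n in sequentially. norm (cnorm A (X n) - cnorm A x) \<le> cnorm A (X n \<ominus> x)"
    by simp
qed

lemma conv_diff: 
  assumes "conv X x" "conv Y y" shows "conv (\<lambda>n. X n \<ominus> Y n) (x \<ominus> y)"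
  using conv_add[OF assms(1) conv_scale[OF assms(2), of "-1"]] conv_closed[OF assms(1)]
    conv_closed[OF assms(2)]
  by (simp add: minus_conv)

lemma conv_mult:
  assumes "conv X x" "conv Y y" shows "conv (\<lambda>n. X n \<otimes> Y n) (x \<otimes> y)"
proof (rule convI)
  have "(\<lambda>n. cnorm A (X n) * cnorm A (Y n \<ominus> y) + cnorm A (X n \<ominus> x) * cnorm A y)
      \<longlonglongrightarrow> cnorm A x * 0 + 0 * cnorm A y"
    by (intro tendsto_intros conv_norm assms) (use assms in \<open>auto simp: conv_def\<close>)
  then show "(\<lambda>n. cnorm A (X n) * cnorm A (Y n \<ominus> y) + cnorm A (X n \<ominus> x) * cnorm A y)
      \<longlonglongrightarrow> 0" by simp
qed (use assms conv_closed norm_mult_diff_mult in auto)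

lemma conv_unique: 
  assumes "conv X x" "conv X y" shows "x = y"
proof -
  have "(\<lambda>n. cnorm A (X n \<ominus> X n)) \<longlonglongrightarrow> cnorm A (x \<ominus> y)"
    by (rule conv_norm[OF conv_diff[OF assms]])
  then have "cnorm A (x \<ominus> y) = 0"
    using conv_closed[OF assms(1)] by (simp add: LIMSEQ_const_iff)
  then show ?thesis
    using assms conv_closed by (simp add: eq_diff_iff)
qed

lemma conv_Suc: "conv X x \<Longrightarrow> conv (\<lambda>n. X (Suc n)) x"
  using LIMSEQ_Suc[of "\<lambda>n. cnorm A (X n \<ominus> x)" 0] by (auto simp: conv_def)

lemma Cauchy_conv:
  assumes "\<And>n. X n \<in> carrier A" 
    "\<And>e. e > 0 \<Longrightarrow> \<exists>N. \<forall>m\<ge>N. \<forall>n\<ge>N. cnorm A (X m \<ominus> X n) < e"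
  shows "\<exists>x. conv X x"
  using complete[OF assms] assms(1) by (auto simp: conv_def)

lemma geometric_conv:
  assumes X: "\<And>n. X n \<in> carrier A" and r: "0 \<le> r" "r < 1"
    and step: "\<And>n. cnorm A (X (Suc n) \<ominus> X n) \<le> C * r ^ n"
  shows "\<exists>x. conv X x"
proof (rule Cauchy_conv[OF X])
  have C: "0 \<le> C"
    using order_trans[OF cnorm_nonneg step[of 0]] X by simp
  have bound: "cnorm A (X (n + k) \<ominus> X n) \<le> C * r ^ n / (1 - r)" for n k
  proof -
    have "cnorm A (X (n + k) \<ominus> X n) \<le> C * r ^ n * (1 - r ^ k) / (1 - r)"
    proof (induction k)
      case (Suc k)
      have "cnorm A (X (n + Suc k) \<ominus> X n) \<le> C * r ^ (n + k) + C * r ^ n * (1 - r ^ k) / (1 - r)"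
        using norm_diff_triangle[of "X (n + Suc k)" "X (n + k)" "X n"] X Suc step[of "n + k"] by simp
      also have "\<dots> = C * r ^ n * (1 - r ^ Suc k) / (1 - r)"
        using r by (simp add: field_simps power_add)
      finally show ?case .
    qed (simp add: X)
    also have "\<dots> \<le> C * r ^ n / (1 - r)"
      using r C by (intro divide_right_mono) (simp_all add: mult_left_le)
    finally show ?thesis .
  qed
  fix e :: real assume "e > 0"
  have "(\<lambda>n. C * r ^ n / (1 - r)) \<longlonglongrightarrow> C * 0 / (1 - r)"
    by (intro tendsto_intros LIMSEQ_realpow_zero) (use r in auto)
  then have "\<forall>\<^sub>F n in sequentially. C * r ^ n / (1 - r) < e / 2"
    using \<open>e > 0\<close> by (intro order_tendstoD) auto
  then obtain N where N: "C * r ^ N / (1 - r) < e / 2"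
    by (auto simp: eventually_sequentially)
  have "cnorm A (X m \<ominus> X n) < e" if "m \<ge> N" "n \<ge> N" for m n
  proof -
    have "cnorm A (X m \<ominus> X N) < e / 2" "cnorm A (X N \<ominus> X n) < e / 2"
      using le_less_trans[OF bound[of N "m - N"] N] le_less_trans[OF bound[of N "n - N"] N]
        that norm_diff_commute[of "X N" "X n"] X by simp_all
    then show ?thesis
      using norm_diff_triangle[of "X m" "X N" "X n"] X by simp
  qed
  then show "\<exists>N. \<forall>m\<ge>N. \<forall>n\<ge>N. cnorm A (X m \<ominus> X n) < e" by blast
qed

lemma conv_Cauchy:
  assumes "conv X x" "e > 0"
  shows "\<exists>N. \<forall>m\<ge>N. \<forall>n\<ge>N. cnorm A (X m \<ominus> X n) < e"
proof -
  have "\<forall>\<^sub>F n in sequentially. cnorm A (X n \<ominus> x) < e / 2"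
    using assms by (intro order_tendstoD[of _ 0]) (auto simp: conv_def)
  then obtain N where N: "\<And>n. n \<ge> N \<Longrightarrow> cnorm A (X n \<ominus> x) < e / 2"
    by (auto simp: eventually_sequentially)
  have "cnorm A (X m \<ominus> X n) < e" if "m \<ge> N" "n \<ge> N" for m n
    using norm_diff_triangle[of "X m" x "X n"] N[OF that(1)] N[OF that(2)] conv_closed[OF assms(1)]
      norm_diff_commute[of "X n" x] by simp
  then show ?thesis by blast
qed

lemma conv_norm_le:
  assumes "conv X x" "\<And>n. cnorm A (X n) \<le> c" shows "cnorm A x \<le> c"
  using conv_norm[OF assms(1)] assms(2) by (intro LIMSEQ_le_const2) auto

lemma limitin_conv:
  "limitin (norm_topology A) X x sequentially \<longleftrightarrow>
    x \<in> carrier A \<and> (\<forall>\<^sub>F n in sequentially. X n \<in> carrier A) \<and> (\<lambda>n. cdist A (X n) x) \<longlonglongrightarrow> 0"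
  unfolding norm_topology_def
  by (rule Metric_space.limitin_metric_dist_null[OF Metric_space_cdist])

lemma closedin_conv:
  "closedin (norm_topology A) S \<longleftrightarrow>
    S \<subseteq> carrier A \<and> (\<forall>X x. range X \<subseteq> S \<and> conv X x \<longrightarrow> x \<in> S)"
proof -
  have "conv X x \<longleftrightarrow> limitin (norm_topology A) X x sequentially" if "range X \<subseteq> carrier A" for X x
  proof (cases "x \<in> carrier A")
    case True
    have "cdist A (X n) x = cnorm A (X n \<ominus> x)" for n
      using that True by (auto simp: cdist_def)
    then show ?thesis using that True by (auto simp: limitin_conv conv_def intro!: always_eventually)
  qed (auto simp: limitin_conv conv_def)
  then show ?thesis
    unfolding norm_topology_def Metric_space.metric_closedin_iff_sequentially_closed[OF Metric_space_cdist]
    by (meson subset_trans)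
qed

lemma in_closure_iff:
  assumes "S \<subseteq> carrier A"
  shows "x \<in> norm_topology A closure_of S \<longleftrightarrow> x \<in> carrier A \<and> (\<forall>e>0. \<exists>y\<in>S. cnorm A (x \<ominus> y) < e)"
  unfolding norm_topology_def Metric_space.metric_closure_of[OF Metric_space_cdist]
    Metric_space.in_mball[OF Metric_space_cdist]
  using assms by (auto simp: cdist_def subset_iff) 

lemma conv_of_approx:
  assumes "x \<in> carrier A" "S \<subseteq> carrier A" "\<forall>e>0. \<exists>y\<in>S. cnorm A (x \<ominus> y) < e"
  shows "\<exists>X. range X \<subseteq> S \<and> conv X x"
proof -
  have "\<exists>y\<in>S. cnorm A (x \<ominus> y) < 1 / Suc n" for n
    using assms(3) by simp
  then obtain X where X: "\<And>n. X n \<in> S" "\<And>n. cnorm A (x \<ominus> X n) < 1 / Suc n" by metis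
  have "conv X x"
  proof (rule convI)
    show "(\<lambda>n. 1 / Suc n) \<longlonglongrightarrow> 0" using LIMSEQ_inverse_real_of_nat by (simp add: inverse_eq_divide)
    show "cnorm A (X n \<ominus> x) \<le> 1 / Suc n" for n
      using X[of n] assms norm_diff_commute[of x "X n"] by auto
  qed (use X assms in auto)
  with X show ?thesis by auto
qed

section \<open>Square roots, homomorphisms and states\<close>

lemma saD: "a \<in> sa A \<Longrightarrow> a \<in> carrier A" "a \<in> sa A \<Longrightarrow> star A a = a"
  by (simp_all add: sa_def)

lemma sa_add: "a \<in> sa A \<Longrightarrow> b \<in> sa A \<Longrightarrow> a \<oplus> b \<in> sa A"
  by (simp add: sa_def star_add)

lemma sa_scale: "a \<in> sa A \<Longrightarrow> complex_of_real t \<odot> a \<in> sa A"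
  by (simp add: sa_def star_smult)

lemma sa_diff: "a \<in> sa A \<Longrightarrow> b \<in> sa A \<Longrightarrow> a \<ominus> b \<in> sa A"
  by (simp add: sa_def star_diff)

lemma sa_square: "a \<in> sa A \<Longrightarrow> a \<otimes> a \<in> sa A"
  by (simp add: sa_def star_mult)

lemma sa_one: "\<one> \<in> sa A"
  by (simp add: sa_def)

lemma sa_zero: "\<zero> \<in> sa A"
  by (simp add: sa_def)

lemma sa_star_mult: "a \<in> carrier A \<Longrightarrow> star A a \<otimes> a \<in> sa A"
  by (simp add: sa_def star_mult)

lemma sa_conv: "range X \<subseteq> sa A \<Longrightarrow> conv X x \<Longrightarrow> x \<in> sa A"
  using conv_unique[of X x "star A x"] conv_star[of X x] conv_closed[of X x]
  by (auto simp: sa_def image_subset_iff)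

text \<open>
  The map \<open>y \<mapsto> (h + y\<^sup>2) / 2\<close> contracts a ball of radius \<open>r < 1\<close> by the factor \<open>r\<close>, and its fixed point
  satisfies \<open>(1 - y)\<^sup>2 = 1 - h\<close>. The iterates of 0 commute with everything that commutes with \<open>h\<close>, and so
  does their limit.
\<close>

lemma sqrt_one_minus:
  assumes h: "h \<in> sa A" and norm_h: "cnorm A h < 1"
  shows "\<exists>c\<in>sa A. c \<otimes> c = \<one> \<ominus> h \<and> (\<forall>x\<in>carrier A. x \<otimes> h = h \<otimes> x \<longrightarrow> x \<otimes> c = c \<otimes> x)"
proof -
  define y where "y = rec_nat \<zero> (\<lambda>_ y. (1 / 2) \<odot> (h \<oplus> y \<otimes> y))"
  have y_0: "y 0 = \<zero>" and y_Suc: "y (Suc n) = (1 / 2) \<odot> (h \<oplus> y n \<otimes> y n)" for n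
    by (simp_all add: y_def)
  \<comment> \<open>Solution of \<open>(\<parallel>h\<parallel> + r\<^sup>2) / 2 = r\<close>, so the ball of radius \<open>r\<close> is mapped into itself.\<close>
  define r where "r = 1 - sqrt (1 - cnorm A h)"
  have hA: "h \<in> carrier A" using h by (rule saD)
  have r: "0 \<le> r" "r < 1" and r_eq: "(cnorm A h + r * r) / 2 = r"
    using norm_h cnorm_nonneg[OF hA] by (auto simp: r_def field_simps)
  have y_sa: "y n \<in> sa A" for n
    using sa_scale[of "h \<oplus> y n' \<otimes> y n'" "1 / 2" for n'] h
    by (induction n) (auto simp: y_0 y_Suc sa_zero sa_add sa_square)
  then have yA: "y n \<in> carrier A" for n by (rule saD)
  have norm_y: "cnorm A (y n) \<le> r" for n
  proof (induction n)
    case (Suc n)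
    have "cnorm A (h \<oplus> y n \<otimes> y n) \<le> cnorm A h + r * r"
      by (intro order_trans[OF cnorm_add] add_mono order_trans[OF cnorm_mult] mult_mono Suc)
        (simp_all add: hA yA r)
    then show ?case
      using r_eq by (simp add: y_Suc cnorm_smult hA yA)
  qed (simp add: y_0 r)
  have step: "cnorm A (y (Suc n) \<ominus> y n) \<le> cnorm A (y 1 \<ominus> y 0) * r ^ n" for n
  proof (induction n)
    case (Suc n)
    let ?d = "cnorm A (y (Suc n) \<ominus> y n)"
    have "y (Suc (Suc n)) \<ominus> y (Suc n)
        = (1 / 2) \<odot> (y (Suc n) \<otimes> y (Suc n) \<ominus> y n \<otimes> y n)"
      unfolding y_Suc[of "Suc n"] y_Suc[of n]
      using hA yA[of n] yA[of "Suc n", unfolded y_Suc[of n]]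
      by (simp add: add_diff_add flip: scale_diff)
    moreover have "cnorm A (y (Suc n) \<otimes> y (Suc n) \<ominus> y n \<otimes> y n) \<le> r * ?d + ?d * r"
      by (intro order_trans[OF norm_mult_diff_mult] add_mono mult_mono norm_y) (simp_all add: yA r)
    ultimately have "cnorm A (y (Suc (Suc n)) \<ominus> y (Suc n)) \<le> ?d * r"
      by (simp add: cnorm_smult yA mult.commute)
    also have "\<dots> \<le> cnorm A (y 1 \<ominus> y 0) * r ^ Suc n"
      using mult_right_mono[OF Suc r(1)] by (simp add: ac_simps)
    finally show ?case .
  qed simp
  obtain l where l: "conv y l"
    using geometric_conv[OF yA r step] by blast
  then have lA: "l \<in> carrier A" and l_sa: "l \<in> sa A"
    using conv_closed sa_conv y_sa by blast+
  have "conv (\<lambda>n. y (Suc n)) ((1 / 2) \<odot> (h \<oplus> l \<otimes> l))"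
    unfolding y_Suc by (intro conv_scale conv_add conv_const conv_mult l hA)
  then have l_eq: "l = (1 / 2) \<odot> (h \<oplus> l \<otimes> l)"
    using conv_unique conv_Suc[OF l] by blast
  have "l \<oplus> l = 2 \<odot> l"
    using scale_add_left[of l 1 1] lA by simp
  also have "\<dots> = h \<oplus> l \<otimes> l"
    using lA hA by (subst l_eq) simp
  finally have two_l: "l \<oplus> l = h \<oplus> l \<otimes> l" .
  have "(\<one> \<ominus> l) \<otimes> (\<one> \<ominus> l) = (\<one> \<ominus> l) \<ominus> (l \<ominus> l \<otimes> l)"
    using lA by (simp add: mult_diff_left mult_diff_right)
  also have "\<dots> = \<one> \<ominus> ((l \<oplus> l) \<ominus> l \<otimes> l)"
    using lA by (simp add: minus_conv scale_add_right a_ac)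
  also have "\<dots> = \<one> \<ominus> h"
    unfolding two_l using lA hA by (simp add: minus_eq a_assoc r_neg)
  finally have sq: "(\<one> \<ominus> l) \<otimes> (\<one> \<ominus> l) = \<one> \<ominus> h" .
  have "x \<otimes> (\<one> \<ominus> l) = (\<one> \<ominus> l) \<otimes> x" if x: "x \<in> carrier A" and xh: "x \<otimes> h = h \<otimes> x" for x
  proof -
    have "x \<otimes> y n = y n \<otimes> x" for n
    proof (induction n)
      case (Suc n)
      have "x \<otimes> (y n \<otimes> y n) = (y n \<otimes> y n) \<otimes> x"
        by (metis Suc m_assoc x yA)
      then show ?case
        using x xh hA yA by (simp add: y_Suc smult_mult_left smult_mult_right l_distr r_distr)
    qed (simp add: y_0 x)
    then have "conv (\<lambda>n. x \<otimes> y n) (l \<otimes> x)"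
      using conv_mult[OF l conv_const[OF x]] by simp
    then have "x \<otimes> l = l \<otimes> x"
      using conv_unique conv_mult[OF conv_const[OF x] l] by blast
    then show ?thesis
      using x lA by (simp add: mult_diff_left mult_diff_right)
  qed
  then show ?thesis
    using sq sa_diff[OF sa_one l_sa] by blast
qed

text \<open>
  The element \<open>x + \<i> y\<close> is unitary, and \<open>x\<close> is the mean of it and its adjoint.
\<close>

lemma norm_le_one_if_squares_sum_one:
  assumes x: "x \<in> sa A" and y: "y \<in> sa A" and xy: "x \<otimes> y = y \<otimes> x"
    and sum: "x \<otimes> x \<oplus> y \<otimes> y = \<one>"
  shows "cnorm A x \<le> 1"
proof -
  note carr = saD(1)[OF x] saD(1)[OF y]
  define u where "u = x \<oplus> \<i> \<odot> y"
  have u: "u \<in> carrier A" using carr by (simp add: u_def)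
  have su: "star A u = x \<oplus> (- \<i>) \<odot> y"
    using x y by (simp add: u_def star_add star_smult saD)
  have "star A u \<otimes> u = (x \<otimes> x \<oplus> y \<otimes> y) \<oplus> (\<i> \<odot> (x \<otimes> y) \<oplus> (- \<i>) \<odot> (x \<otimes> y))"
    unfolding su unfolding u_def using carr xy
    by (simp add: l_distr r_distr smult_mult_left smult_mult_right scale_add_right a_ac)
  also have "\<dots> = \<one>"
    using carr by (simp add: sum flip: scale_add_left)
  finally have "(cnorm A u)\<^sup>2 = 1"
    using cnorm_star_mult[OF u] by simp
  then have "cnorm A u = 1"
    using u by (simp add: power2_eq_1_iff) (smt (verit) cnorm_nonneg)
  moreover have "x \<oplus> x = u \<oplus> star A u"
    unfolding su unfolding u_def using carr
    by (simp add: a_ac) (simp add: a_assoc[symmetric] flip: scale_add_left)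
  then have "2 * cnorm A x = cnorm A (u \<oplus> star A u)"
    using cnorm_smult[of x 2] scale_add_left[of x 1 1] carr by simp
  ultimately show ?thesis
    using cnorm_add[of u "star A u"] u by simp
qed

end

lemma star_homD:
  assumes "f \<in> star_hom A B"
  shows "a \<in> carrier A \<Longrightarrow> f a \<in> carrier B"
    and "a \<in> carrier A \<Longrightarrow> b \<in> carrier A \<Longrightarrow> f (a \<oplus>\<^bsub>A\<^esub> b) = f a \<oplus>\<^bsub>B\<^esub> f b"
    and "a \<in> carrier A \<Longrightarrow> b \<in> carrier A \<Longrightarrow> f (a \<otimes>\<^bsub>A\<^esub> b) = f a \<otimes>\<^bsub>B\<^esub> f b"
    and "f \<one>\<^bsub>A\<^esub> = \<one>\<^bsub>B\<^esub>"
    and "a \<in> carrier A \<Longrightarrow> f (c \<odot>\<^bsub>A\<^esub> a) = c \<odot>\<^bsub>B\<^esub> f a"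
    and "a \<in> carrier A \<Longrightarrow> f (star A a) = star B (f a)"
  using assms by (auto simp: star_hom_def ring_hom_def)

lemma star_hom_diff:
  assumes "cstar_algebra A" "cstar_algebra B" "f \<in> star_hom A B" "a \<in> carrier A" "b \<in> carrier A"
  shows "f (a \<ominus>\<^bsub>A\<^esub> b) = f a \<ominus>\<^bsub>B\<^esub> f b"
proof -
  interpret A: cstar_algebra A by fact
  interpret B: cstar_algebra B by fact
  show ?thesis
    using assms(4,5) star_homD[OF assms(3)] by (simp add: A.minus_conv B.minus_conv)
qed

lemma star_hom_sa: "f \<in> star_hom A B \<Longrightarrow> a \<in> sa A \<Longrightarrow> f a \<in> sa B"
  using star_homD(1,6)[of f A B a] by (auto simp: sa_def)

text \<open>
  Complete \<open>a\<^sup>2\<close> to \<open>a\<^sup>2 + c\<^sup>2 = 1\<close> with \<open>c\<close> self-adjoint and commuting with \<open>a\<close>. This equation persists under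
  \<open>f\<close>, where it bounds the norm of \<open>f a\<close>.
\<close>

lemma star_hom_norm_le_one:
  assumes A: "cstar_algebra A" and B: "cstar_algebra B" and f: "f \<in> star_hom A B"
    and a: "a \<in> sa A" and norm_a: "cnorm A a < 1"
  shows "cnorm B (f a) \<le> 1"
proof -
  interpret A: cstar_algebra A by fact
  interpret B: cstar_algebra B by fact
  note aA = A.saD(1)[OF a]
  have "cnorm A (a \<otimes>\<^bsub>A\<^esub> a) < 1"
    using A.cnorm_star_mult[OF aA] A.saD(2)[OF a] norm_a A.cnorm_nonneg[OF aA]
    by (simp add: power_less_one_iff)
  then obtain c where c: "c \<in> sa A" "c \<otimes>\<^bsub>A\<^esub> c = \<one>\<^bsub>A\<^esub> \<ominus>\<^bsub>A\<^esub> a \<otimes>\<^bsub>A\<^esub> a" "a \<otimes>\<^bsub>A\<^esub> c = c \<otimes>\<^bsub>A\<^esub> a"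
    using A.sqrt_one_minus[OF A.sa_square[OF a]] aA by (metis A.m_assoc)
  note cA = A.saD(1)[OF c(1)]
  have "c \<otimes>\<^bsub>A\<^esub> c \<oplus>\<^bsub>A\<^esub> a \<otimes>\<^bsub>A\<^esub> a = \<one>\<^bsub>A\<^esub>"
    unfolding c(2) using aA by (simp add: A.diff_add_cancel)
  then have "f a \<otimes>\<^bsub>B\<^esub> f a \<oplus>\<^bsub>B\<^esub> f c \<otimes>\<^bsub>B\<^esub> f c = \<one>\<^bsub>B\<^esub>"
    using star_homD[OF f] aA cA by (metis A.m_closed B.a_comm)
  moreover have "f a \<otimes>\<^bsub>B\<^esub> f c = f c \<otimes>\<^bsub>B\<^esub> f a"
    using star_homD(3)[OF f] aA cA c(3) by metis
  ultimately show ?thesis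
    using B.norm_le_one_if_squares_sum_one star_hom_sa[OF f] a c(1) by blast
qed

text \<open>
  The C*-identity reduces the claim to the self-adjoint element \<open>a* a\<close>; if it failed there, a multiple of \<open>a* a\<close> with norm
  less than 1 would have an image of norm greater than 1.
\<close>

lemma star_hom_contractive:
  assumes A: "cstar_algebra A" and B: "cstar_algebra B" and f: "f \<in> star_hom A B"
    and a: "a \<in> carrier A"
  shows "cnorm B (f a) \<le> cnorm A a"
proof (rule ccontr)
  interpret A: cstar_algebra A by fact
  interpret B: cstar_algebra B by fact
  assume less: "\<not> cnorm B (f a) \<le> cnorm A a"
  define b where "b = star A a \<otimes>\<^bsub>A\<^esub> a"
  have b: "b \<in> sa A" unfolding b_def using a by (rule A.sa_star_mult)
  note bA = A.saD(1)[OF b]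
  have "f b = star B (f a) \<otimes>\<^bsub>B\<^esub> f a"
    using a star_homD[OF f] by (simp add: b_def)
  then have "cnorm B (f b) = (cnorm B (f a))\<^sup>2"
    using B.cnorm_star_mult star_homD(1)[OF f a] by simp
  moreover have "cnorm A b = (cnorm A a)\<^sup>2"
    using A.cnorm_star_mult[OF a] by (simp add: b_def)
  ultimately have "cnorm A b < cnorm B (f b)"
    using less a by (simp add: power_strict_mono)
  then obtain t where t: "cnorm A b < t" "t < cnorm B (f b)"
    using dense by blast
  have "0 < t" using t(1) A.cnorm_nonneg[OF bA] by linarith
  have "cnorm B (f (complex_of_real (1 / t) \<odot>\<^bsub>A\<^esub> b)) \<le> 1"
    using t \<open>0 < t\<close> bA
    by (intro star_hom_norm_le_one[OF A B f A.sa_scale[OF b]])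
      (simp add: A.cnorm_smult norm_divide del: of_real_divide of_real_1)
  then show False
    using t \<open>0 < t\<close> bA star_homD[OF f]
    by (simp add: B.cnorm_smult norm_divide divide_simps split: if_splits del: of_real_divide of_real_1)
qed

text \<open>
  States are contractive functionals, and so are the translates \<open>y \<mapsto> \<phi> (U* y)\<close> of a state by
  a unitary, which are in general not positive but occur in the computation of Fourier coefficients.
\<close>

definition contractive_functional :: "'a cstar \<Rightarrow> ('a \<Rightarrow> complex) \<Rightarrow> bool"
  where "contractive_functional A \<phi> \<longleftrightarrow>
    (\<forall>a\<in>carrier A. \<forall>b\<in>carrier A. \<phi> (a \<oplus>\<^bsub>A\<^esub> b) = \<phi> a + \<phi> b) \<and>
    (\<forall>c. \<forall>a\<in>carrier A. \<phi> (c \<odot>\<^bsub>A\<^esub> a) = c * \<phi> a) \<and>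
    (\<forall>a\<in>carrier A. cmod (\<phi> a) \<le> cnorm A a)"

lemma contractive_functionalD:
  assumes "contractive_functional A \<phi>"
  shows "a \<in> carrier A \<Longrightarrow> b \<in> carrier A \<Longrightarrow> \<phi> (a \<oplus>\<^bsub>A\<^esub> b) = \<phi> a + \<phi> b"
    and "a \<in> carrier A \<Longrightarrow> \<phi> (c \<odot>\<^bsub>A\<^esub> a) = c * \<phi> a"
    and "a \<in> carrier A \<Longrightarrow> cmod (\<phi> a) \<le> cnorm A a"
  using assms by (auto simp: contractive_functional_def)

context cstar_algebra
begin

lemma functional_diff:
  assumes "contractive_functional A \<phi>" "a \<in> carrier A" "b \<in> carrier A"
  shows "\<phi> (a \<ominus> b) = \<phi> a - \<phi> b"
  using assms by (simp add: minus_conv contractive_functionalD)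

lemma functional_conv:
  assumes \<phi>: "contractive_functional A \<phi>" and X: "conv X x"
  shows "(\<lambda>n. \<phi> (X n)) \<longlonglongrightarrow> \<phi> x"
proof (rule LIM_zero_cancel, rule Lim_null_comparison)
  show "(\<lambda>n. cnorm A (X n \<ominus> x)) \<longlonglongrightarrow> 0"
    using X by (simp add: conv_def)
  show "\<forall>\<^sub>F n in sequentially. norm (\<phi> (X n) - \<phi> x) \<le> cnorm A (X n \<ominus> x)"
    using contractive_functionalD(3)[OF \<phi>] functional_diff[OF \<phi>] conv_closed[OF X]
    by (metis (no_types, lifting) always_eventually diff_closed)
qed

text \<open>
  The value of \<open>\<phi>\<close> at \<open>(a + c)* (a + c)\<close>. Varying the scalar \<open>c\<close> gives both that \<open>\<phi>\<close> is hermitian and the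
  Cauchy-Schwarz inequality.
\<close>

lemma states_shift:
  assumes \<phi>: "\<phi> \<in> states A" and a: "a \<in> carrier A"
  shows "\<phi> (star A a \<otimes> a) + c * \<phi> (star A a) + cnj c * \<phi> a + c * cnj c \<in> \<real>\<^sub>\<ge>\<^sub>0"
proof -
  have "star A (a \<oplus> c \<odot> \<one>) \<otimes> (a \<oplus> c \<odot> \<one>) =
      star A a \<otimes> a \<oplus> c \<odot> star A a \<oplus> cnj c \<odot> a \<oplus> (c * cnj c) \<odot> \<one>"
    using a by (simp add: star_add star_smult l_distr r_distr smult_mult_left smult_mult_right
        scale_add_right a_ac mult.commute)
  moreover have "\<phi> (star A (a \<oplus> c \<odot> \<one>) \<otimes> (a \<oplus> c \<odot> \<one>)) \<in> \<real>\<^sub>\<ge>\<^sub>0"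
    using \<phi> a by (simp add: states_def)
  ultimately show ?thesis
    using \<phi> a by (simp add: states_def)
qed

lemma states_star:
  assumes \<phi>: "\<phi> \<in> states A" and a: "a \<in> carrier A"
  shows "\<phi> (star A a) = cnj (\<phi> a)"
proof -
  have "\<phi> (star A a \<otimes> a) \<in> \<real>\<^sub>\<ge>\<^sub>0"
    using \<phi> a by (simp add: states_def)
  then show ?thesis
    using states_shift[OF \<phi> a, of 1] states_shift[OF \<phi> a, of \<i>]
    by (auto simp: complex_nonneg_Reals_iff complex_eq_iff)
qed

text \<open>
  By Cauchy-Schwarz \<open>|\<phi> b|\<^sup>2 \<le> \<phi> (b* b)\<close>. If \<open>b\<close> has norm less than 1, then \<open>1 - b* b\<close> is the square of a
  self-adjoint element, so that \<open>\<phi> (b* b) \<le> 1\<close>.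
\<close>

lemma states_norm_le:
  assumes \<phi>: "\<phi> \<in> states A" and a: "a \<in> carrier A"
  shows "cmod (\<phi> a) \<le> cnorm A a"
proof -
  have le_one: "cmod (\<phi> b) \<le> 1" if b: "b \<in> carrier A" and norm_b: "cnorm A b < 1" for b
  proof -
    have "cnorm A (star A b \<otimes> b) < 1"
      using cnorm_star_mult[OF b] norm_b b by (simp add: power_less_one_iff)
    then obtain c where c: "c \<in> sa A" "c \<otimes> c = \<one> \<ominus> star A b \<otimes> b"
      using sqrt_one_minus[OF sa_star_mult[OF b]] by blast
    have "\<phi> (star A c \<otimes> c) \<in> \<real>\<^sub>\<ge>\<^sub>0"
      using \<phi> saD[OF c(1)] unfolding states_def by blast
    then have "1 - \<phi> (star A b \<otimes> b) \<in> \<real>\<^sub>\<ge>\<^sub>0"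
      using \<phi> b saD[OF c(1)] c(2) by (simp add: minus_conv states_def)
    then have 1: "Re (\<phi> (star A b \<otimes> b)) \<le> 1"
      by (simp add: complex_nonneg_Reals_iff)
    have "\<phi> (star A b \<otimes> b) - \<phi> b * cnj (\<phi> b) \<in> \<real>\<^sub>\<ge>\<^sub>0"
      using states_shift[OF \<phi> b, of "- \<phi> b"] states_star[OF \<phi> b] by (simp add: algebra_simps)
    then have "(cmod (\<phi> b))\<^sup>2 \<le> Re (\<phi> (star A b \<otimes> b))"
      by (simp add: complex_nonneg_Reals_iff cmod_power2) (simp add: power2_eq_square)
    with 1 have "(cmod (\<phi> b))\<^sup>2 \<le> 1\<^sup>2" by simp
    then show ?thesis by (rule power2_le_imp_le) simp
  qed
  show ?thesis
  proof (rule dense_ge)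
    fix t assume t: "cnorm A a < t"
    then have "0 < t" using cnorm_nonneg[OF a] by linarith
    have "\<phi> (complex_of_real (1 / t) \<odot> a) = complex_of_real (1 / t) * \<phi> a"
      using \<phi> a by (simp add: states_def)
    then show "cmod (\<phi> a) \<le> t"
      using le_one[of "complex_of_real (1 / t) \<odot> a"] t \<open>0 < t\<close> a
      by (simp add: cnorm_smult norm_mult norm_divide divide_simps del: of_real_divide)
  qed
qed

lemma states_contractive: "\<phi> \<in> states A \<Longrightarrow> contractive_functional A \<phi>"
  using states_norm_le[of \<phi>] by (auto simp: contractive_functional_def states_def)

end

section \<open>C*-subalgebras\<close>

context cstar_algebra
begin

text \<open>
  The definition of the additive inverse refers to the carrier, so subtraction is not literally
  the same operation in the subalgebra.
\<close>

lemma subalgebra_diff: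
  assumes S: "cstar_subalgebra S A" and ab: "a \<in> S" "b \<in> S"
    and group: "abelian_group (A\<lparr>carrier := S\<rparr>)"
  shows "a \<ominus>\<^bsub>A\<lparr>carrier := S\<rparr>\<^esub> b = a \<ominus> b"
proof -
  interpret B: abelian_group "A\<lparr>carrier := S\<rparr>" by (rule group)
  have S': "b \<in> carrier A" "a \<in> carrier A" "(- 1) \<odot> b \<in> S"
    using S ab by (auto simp: cstar_subalgebra_def)
  have "\<ominus>\<^bsub>A\<lparr>carrier := S\<rparr>\<^esub> b = (- 1) \<odot> b"
    using S' ab scale_add_left[of b "- 1" 1] by (intro B.minus_equality) simp_all
  then show ?thesis
    using S' by (simp add: a_minus_def[of "A\<lparr>carrier := S\<rparr>"] minus_conv)
qed

lemma subalgebra_cstar_algebra: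
  assumes S: "cstar_subalgebra S A"
  shows "cstar_algebra (A\<lparr>carrier := S\<rparr>)" (is "cstar_algebra ?B")
proof -
  have sub: "a \<in> carrier A" if "a \<in> S" for a
    using S that by (auto simp: cstar_subalgebra_def)
  have cl: "\<one> \<in> S" "\<And>a b. a \<in> S \<Longrightarrow> b \<in> S \<Longrightarrow> a \<oplus> b \<in> S" "\<And>a b. a \<in> S \<Longrightarrow> b \<in> S \<Longrightarrow> a \<otimes> b \<in> S"
    "\<And>c a. a \<in> S \<Longrightarrow> c \<odot> a \<in> S" "\<And>a. a \<in> S \<Longrightarrow> star A a \<in> S"
    using S by (auto simp: cstar_subalgebra_def)
  have zero: "\<zero> \<in> S"
    using cl(4)[OF cl(1), of 0] by simp
  have group: "abelian_group ?B"
  proof (rule abelian_groupI)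
    fix a assume "a \<in> carrier ?B"
    then show "\<exists>b\<in>carrier ?B. b \<oplus>\<^bsub>?B\<^esub> a = \<zero>\<^bsub>?B\<^esub>"
      using cl(4)[of a "- 1"] scale_add_left[of a "- 1" 1] sub[of a] by auto
  qed (auto simp: cl sub zero a_ac)
  have ring: "ring ?B"
    by (rule ringI[OF group], rule monoidI) (auto simp: cl sub m_assoc l_distr r_distr)
  have module: "module complex_ring ?B"
    by (rule moduleI[OF _ group]) (auto simp: cl sub scale_add_left scale_add_right R.is_cring)
  show ?thesis
  proof (intro cstar_algebra.intro module ring cstar_algebra_axioms.intro)
    fix X :: "nat \<Rightarrow> 'a" assume X: "\<And>n. X n \<in> carrier ?B"
      and Cauchy: "\<And>e. 0 < e \<Longrightarrow> \<exists>N. \<forall>m\<ge>N. \<forall>n\<ge>N. cnorm ?B (X m \<ominus>\<^bsub>?B\<^esub> X n) < e"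
    have diff: "a \<ominus>\<^bsub>?B\<^esub> b = a \<ominus> b" if "a \<in> S" "b \<in> S" for a b
      by (rule subalgebra_diff[OF S that group])
    obtain x where x: "conv X x"
      using Cauchy_conv[of X] X Cauchy sub diff by auto
    have "range X \<subseteq> S" using X by auto
    then have "x \<in> S"
      using S x unfolding cstar_subalgebra_def closedin_conv by blast
    then show "\<exists>x\<in>carrier ?B. (\<lambda>n. cnorm ?B (X n \<ominus>\<^bsub>?B\<^esub> x)) \<longlonglongrightarrow> 0"
      using x X diff by (auto simp: conv_def)
  qed (auto simp: cl sub one_not_zero smult_mult_left smult_mult_right star_add star_smult star_mult
      cnorm_eq_0 cnorm_add cnorm_smult cnorm_mult cnorm_star_mult)
qed

end

section \<open>The torus and its characters\<close>

lemma unit_mult_cnj: 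
  assumes "cmod z = 1" shows "z * cnj z = 1" "cnj z * z = 1"
proof -
  show "z * cnj z = 1" using complex_norm_square[of z] assms by simp
  then show "cnj z * z = 1" by (simp only: mult.commute)
qed

lemma in_torus: "z \<in> carrier torus \<longleftrightarrow> (\<forall>j. cmod (z $ j) = 1)"
  by (simp add: torus_def)

lemma torus_simps [simp]: "z \<otimes>\<^bsub>torus\<^esub> w = z * w" "\<one>\<^bsub>torus\<^esub> = 1"
  by (simp_all add: torus_def)

lemma comm_group_torus: "comm_group (torus :: (complex ^ 'd) monoid)"
proof (rule comm_groupI)
  fix z :: "complex ^ 'd" assume "z \<in> carrier torus"
  then have "(\<chi> j. cnj (z $ j)) * z = 1"
    by (simp add: vec_eq_iff unit_mult_cnj in_torus)
  then show "\<exists>w\<in>carrier torus. w \<otimes>\<^bsub>torus\<^esub> z = \<one>\<^bsub>torus\<^esub>"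
    using \<open>z \<in> carrier torus\<close> by (intro bexI[of _ "\<chi> j. cnj (z $ j)"]) (simp_all add: in_torus)
qed (simp_all add: norm_mult mult_ac in_torus)

lemma subgroup_torusD:
  assumes "subgroup G torus"
  shows "G \<subseteq> carrier torus" "1 \<in> G" "z \<in> G \<Longrightarrow> w \<in> G \<Longrightarrow> z * w \<in> G"
    and "z \<in> G \<Longrightarrow> inv\<^bsub>torus\<^esub> z \<in> G" "z \<in> G \<Longrightarrow> inv\<^bsub>torus\<^esub> z * z = 1" "z \<in> G \<Longrightarrow> z * inv\<^bsub>torus\<^esub> z = 1"
proof -
  interpret comm_group "torus :: (complex ^ 'd) monoid" by (rule comm_group_torus)
  show "G \<subseteq> carrier torus" "1 \<in> G" "z \<in> G \<Longrightarrow> w \<in> G \<Longrightarrow> z * w \<in> G"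
    "z \<in> G \<Longrightarrow> inv\<^bsub>torus\<^esub> z \<in> G"
    using assms subgroup.subset subgroup.one_closed[OF assms] subgroup.m_closed[OF assms, of z w]
      subgroup.m_inv_closed[OF assms, of z] by auto
  show "z \<in> G \<Longrightarrow> inv\<^bsub>torus\<^esub> z * z = 1" "z \<in> G \<Longrightarrow> z * inv\<^bsub>torus\<^esub> z = 1"
    using l_inv[of z] r_inv[of z] subgroup.subset[OF assms] by auto
qed

lemma torus_mult_closed [simp]: "z \<in> carrier torus \<Longrightarrow> w \<in> carrier torus \<Longrightarrow> z * w \<in> carrier torus"
  by (simp add: in_torus norm_mult)

lemma torus_one_closed [simp]: "1 \<in> carrier torus"
  by (simp add: in_torus)

lemma subgroup_carrier_torus: "subgroup (carrier torus) (torus :: (complex ^ 'd) monoid)"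
proof -
  interpret comm_group "torus :: (complex ^ 'd) monoid" by (rule comm_group_torus)
  show ?thesis by (rule subgroup_self)
qed

definition character :: "complex ^ 'd \<Rightarrow> int ^ 'd \<Rightarrow> complex"
  where "character z p = (\<Prod>j\<in>UNIV. (z $ j) powi (p $ j))"

lemma norm_character [simp]: "z \<in> carrier torus \<Longrightarrow> cmod (character z p) = 1"
  by (simp add: character_def prod_norm[symmetric] norm_power_int in_torus)

lemma character_add: "z \<in> carrier torus \<Longrightarrow> character z (p + q) = character z p * character z q"
  unfolding character_def in_torus
  by (simp flip: prod.distrib) (metis norm_zero power_int_add zero_neq_one)

lemma character_zero [simp]: "character z 0 = 1"
  by (simp add: character_def)

lemma character_mult: "character (z * w) p = character z p * character w p"
  by (simp add: character_def power_int_mult_distrib prod.distrib)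

lemma character_one [simp]: "character 1 p = 1"
  by (simp add: character_def)

lemma character_minus: 
  assumes "z \<in> carrier torus" shows "character z (- p) = cnj (character z p)"
proof -
  have "character z (- p) * character z p = cnj (character z p) * character z p"
    using character_add[OF assms, of "- p" p] unit_mult_cnj(2)[OF norm_character[OF assms, of p]]
    by simp
  moreover have "character z p \<noteq> 0"
    using norm_character[OF assms, of p] by fastforce
  ultimately show ?thesis by simp
qed

section \<open>The dual action\<close>

locale quantum_torus = cstar_algebra A for A :: "'a cstar" (structure) +
  fixes \<sigma> :: "int ^ 'd \<Rightarrow> int ^ 'd \<Rightarrow> complex" and U :: "int ^ 'd \<Rightarrow> 'a"
  assumes multiplier: "multiplier \<sigma>"
    and twisted: "twisted_group_cstar_algebra \<sigma> A U"
begin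

lemma U_closed [simp]: "U p \<in> carrier A"
  and U_unitary: "star A (U p) \<otimes> U p = \<one>" "U p \<otimes> star A (U p) = \<one>"
  and U_mult: "U p \<otimes> U q = \<sigma> p q \<odot> U (p + q)"
  using twisted by (auto simp: twisted_group_cstar_algebra_def twisted_unitaries_def)

lemma norm_cocycle [simp]: "cmod (\<sigma> p q) = 1"
  using multiplier by (simp add: multiplier_def)

lemma cocycle_cnj [simp]: "\<sigma> p q * cnj (\<sigma> p q) = 1" "cnj (\<sigma> p q) * \<sigma> p q = 1"
  by (simp_all add: unit_mult_cnj)

lemma U_zero: "U 0 = \<one>"
proof -
  have "U 0 \<otimes> U 0 = U 0"
    using U_mult[of 0 0] multiplier by (simp add: multiplier_def)
  then have "star A (U 0) \<otimes> (U 0 \<otimes> U 0) = \<one>"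
    by (simp add: U_unitary)
  then show ?thesis
    by (simp add: m_assoc[symmetric] U_unitary)
qed

lemma star_U: "star A (U p) = cnj (\<sigma> p (- p)) \<odot> U (- p)"
proof -
  have "star A (U p) \<otimes> (U p \<otimes> U (- p)) = U (- p)"
    by (simp add: m_assoc[symmetric] U_unitary)
  then have "\<sigma> p (- p) \<odot> star A (U p) = U (- p)"
    by (simp add: U_mult U_zero smult_mult_right)
  then have "cnj (\<sigma> p (- p)) \<odot> (\<sigma> p (- p) \<odot> star A (U p)) = cnj (\<sigma> p (- p)) \<odot> U (- p)"
    by simp
  then show ?thesis by simp
qed

lemma norm_U [simp]: "cnorm A (U p) = 1"
proof -
  have "cnorm A (U p) \<noteq> - 1"
    using cnorm_nonneg[OF U_closed[of p]] by linarith
  then show ?thesis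
    using cnorm_star_mult[of "U p"] by (simp add: U_unitary power2_eq_1_iff)
qed

text \<open>
  As \<open>U p U q\<close> is a multiple of \<open>U (p + q)\<close>, the linear span of the unitaries is already a *-algebra.
\<close>

inductive_set polynomials :: "'a set" where
  polynomials_zero: "\<zero> \<in> polynomials"
| polynomials_term: "a \<in> polynomials \<Longrightarrow> c \<odot> U p \<oplus> a \<in> polynomials"

lemma polynomials_closed: "a \<in> polynomials \<Longrightarrow> a \<in> carrier A"
  by (induction rule: polynomials.induct) auto

lemma polynomials_add: "a \<in> polynomials \<Longrightarrow> b \<in> polynomials \<Longrightarrow> a \<oplus> b \<in> polynomials"
  by (induction rule: polynomials.induct)
    (auto simp: polynomials_closed a_assoc intro: polynomials.intros)

lemma polynomials_scale: "a \<in> polynomials \<Longrightarrow> c \<odot> a \<in> polynomials"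
  by (induction rule: polynomials.induct)
    (auto simp: polynomials_closed scale_add_right intro: polynomials.intros)

lemma U_polynomials: "U p \<in> polynomials"
  using polynomials_term[OF polynomials_zero, of 1 p] by simp

lemma polynomials_mult: "a \<in> polynomials \<Longrightarrow> b \<in> polynomials \<Longrightarrow> a \<otimes> b \<in> polynomials"
proof (induction rule: polynomials.induct)
  case (polynomials_term a c p)
  have "U p \<otimes> b \<in> polynomials"
    using polynomials_term.prems
    by (induction rule: polynomials.induct)
      (auto simp: polynomials_closed r_distr smult_mult_right U_mult intro: polynomials.intros)
  then show ?case
    using polynomials_term
    by (simp add: l_distr smult_mult_left polynomials_closed polynomials_add polynomials_scale)
qed (simp add: polynomials_closed polynomials_zero)

lemma polynomials_star: "a \<in> polynomials \<Longrightarrow> star A a \<in> polynomials"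
  by (induction rule: polynomials.induct)
    (auto simp: polynomials_closed star_add star_smult star_U intro: polynomials.intros)

text \<open>
  The closure of the polynomials is a C*-subalgebra that contains every \<open>U p\<close>, hence it is \<open>A\<close>.
\<close>

lemma polynomials_dense:
  assumes "a \<in> carrier A" shows "\<exists>X. range X \<subseteq> polynomials \<and> conv X a"
proof -
  define S where "S = {a. \<exists>X. range X \<subseteq> polynomials \<and> conv X a}"
  have S: "a \<in> S" if "\<And>n. X n \<in> polynomials" "conv X a" for X a
    using that by (auto simp: S_def)
  have SE: "\<exists>X. (\<forall>n. X n \<in> polynomials) \<and> conv X a" if "a \<in> S" for a
    using that by (auto simp: S_def)
  have poly_S: "a \<in> S" if "a \<in> polynomials" for a
    using S[of "\<lambda>_. a"] that by (simp add: conv_const polynomials_closed)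
  have S_closed: "S \<subseteq> carrier A"
    using conv_closed by (auto simp: S_def)
  have "x \<in> S" if X: "range X \<subseteq> S" "conv X x" for X x
  proof -
    have "\<exists>b\<in>polynomials. cnorm A (x \<ominus> b) < e" if "e > 0" for e
    proof -
      have "\<forall>\<^sub>F n in sequentially. cnorm A (X n \<ominus> x) < e / 2"
        using X(2) \<open>e > 0\<close> by (intro order_tendstoD[of _ 0]) (auto simp: conv_def)
      then obtain n where n: "cnorm A (X n \<ominus> x) < e / 2"
        by (auto simp: eventually_sequentially)
      obtain Y where Y: "\<And>m. Y m \<in> polynomials" "conv Y (X n)"
        using SE X(1) by (meson rangeI subsetD)
      have "\<forall>\<^sub>F m in sequentially. cnorm A (Y m \<ominus> X n) < e / 2"
        using Y(2) \<open>e > 0\<close> by (intro order_tendstoD[of _ 0]) (auto simp: conv_def)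
      then obtain m where m: "cnorm A (Y m \<ominus> X n) < e / 2"
        by (auto simp: eventually_sequentially)
      have "cnorm A (Y m \<ominus> x) < e"
        using norm_diff_triangle[of "Y m" "X n" x] n m conv_closed[OF X(2)] conv_closed[OF Y(2)] by simp
      then show ?thesis
        using norm_diff_commute[of x "Y m"] conv_closed[OF X(2)] conv_closed[OF Y(2)]
        by (intro bexI[of _ "Y m"] Y(1)) simp
    qed
    then obtain Y where "range Y \<subseteq> polynomials" "conv Y x"
      using conv_of_approx[of x polynomials] conv_closed[OF X(2)] polynomials_closed by blast
    then show ?thesis by (auto simp: S_def)
  qed
  then have "closedin (norm_topology A) S"
    unfolding closedin_conv using S_closed by blast
  moreover have "a \<oplus> b \<in> S \<and> a \<otimes> b \<in> S" if ab: "a \<in> S" "b \<in> S" for a b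
  proof -
    obtain X Y where "\<forall>n. X n \<in> polynomials" "conv X a" "\<forall>n. Y n \<in> polynomials" "conv Y b"
      using SE[OF ab(1)] SE[OF ab(2)] by blast
    then show ?thesis
      using S[of "\<lambda>n. X n \<oplus> Y n"] S[of "\<lambda>n. X n \<otimes> Y n"]
      by (simp add: conv_add conv_mult polynomials_add polynomials_mult)
  qed
  moreover have "c \<odot> a \<in> S \<and> star A a \<in> S" if a: "a \<in> S" for a c
  proof -
    obtain X where "\<forall>n. X n \<in> polynomials" "conv X a"
      using SE[OF a] by blast
    then show ?thesis
      using S[of "\<lambda>n. c \<odot> X n"] S[of "\<lambda>n. star A (X n)"]
      by (simp add: conv_scale conv_star polynomials_scale polynomials_star)
  qed
  moreover have "\<one> \<in> S"
    using poly_S[OF U_polynomials[of 0]] by (simp add: U_zero)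
  ultimately have "cstar_subalgebra S A"
    using S_closed by (simp add: cstar_subalgebra_def)
  moreover have "range U \<subseteq> S"
    using poly_S U_polynomials by blast
  ultimately have "S = carrier A"
    using twisted by (simp add: twisted_group_cstar_algebra_def)
  with assms show ?thesis by (auto simp: S_def)
qed

text \<open>
  For properties of elements that are closed under limits, such as the equality of two bounded linear maps.
\<close>

lemma generated_induct [consumes 1, case_names zero add limit]:
  assumes a: "a \<in> carrier A" and zero: "P \<zero>"
    and add: "\<And>a c p. a \<in> carrier A \<Longrightarrow> P a \<Longrightarrow> P (c \<odot> U p \<oplus> a)"
    and limit: "\<And>X a. (\<And>n. X n \<in> carrier A) \<Longrightarrow> (\<And>n. P (X n)) \<Longrightarrow> conv X a \<Longrightarrow> P a"
  shows "P a"
proof -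
  have "P b" if "b \<in> polynomials" for b
    using that by (induction rule: polynomials.induct) (auto intro: zero add polynomials_closed)
  moreover obtain X where "range X \<subseteq> polynomials" "conv X a"
    using polynomials_dense[OF a] by blast
  ultimately show ?thesis
    using limit[of X a] conv_closed by blast
qed

lemma endomorphism_conv: 
  assumes f: "f \<in> star_hom A A" and X: "conv X x"
  shows "conv (\<lambda>n. f (X n)) (f x)"
proof (rule convI)
  show "(\<lambda>n. cnorm A (X n \<ominus> x)) \<longlonglongrightarrow> 0"
    using X by (simp add: conv_def)
  show "cnorm A (f (X n) \<ominus> f x) \<le> cnorm A (X n \<ominus> x)" for n
    using star_hom_contractive[OF _ _ f, of "X n \<ominus> x"] star_hom_diff[OF _ _ f, of "X n" x]
      conv_closed[OF X] cstar_algebra_axioms by simp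
qed (use star_homD(1)[OF f] conv_closed[OF X] in auto)

lemma endomorphism_zero: "f \<in> star_hom A A \<Longrightarrow> f \<zero> = \<zero>"
  using star_homD(5)[of f A A \<one> 0] star_homD(1)[of f A A \<one>] by simp

lemma endomorphism_eqI:
  assumes f: "f \<in> star_hom A A" and g: "g \<in> star_hom A A"
    and eq: "\<And>p. f (U p) = g (U p)" and a: "a \<in> carrier A"
  shows "f a = g a"
  using a
proof (induction rule: generated_induct)
  case (limit X a)
  then have "conv (\<lambda>n. f (X n)) (g a)"
    using endomorphism_conv[OF g] by simp
  then show ?case
    using conv_unique endomorphism_conv[OF f] limit by blast
qed (simp_all add: endomorphism_zero f g star_homD[OF f] star_homD[OF g] eq)

abbreviation \<alpha> where "\<alpha> \<equiv> dual_action A U"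

lemma restrict_endomorphism: "f \<in> star_hom A A \<Longrightarrow> restrict f (carrier A) \<in> star_hom A A"
  by (auto simp: star_hom_def ring_hom_def)

text \<open>
  The unitaries \<open>z\<^sup>p U p\<close> satisfy the same relations as the \<open>U p\<close>, so the universal property provides
  a *-endomorphism. Density of the polynomials makes it unique, as the definite description requires.
\<close>

lemma dual_action:
  assumes z: "z \<in> carrier torus"
  shows dual_action_hom: "\<alpha> z \<in> star_hom A A" and dual_action_U: "\<alpha> z (U p) = character z p \<odot> U p"
proof -
  let ?P = "\<lambda>f. f \<in> extensional (carrier A) \<and> f \<in> star_hom A A \<and> (\<forall>p. f (U p) = character z p \<odot> U p)"
  have cc: "cnj (character z p) * character z p = 1" for p
    using unit_mult_cnj(2)[OF norm_character[OF z, of p]] .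
  have "twisted_unitaries \<sigma> A (\<lambda>p. character z p \<odot> U p)"
    using cc by (simp add: twisted_unitaries_def star_smult smult_mult_left smult_mult_right U_unitary
      U_mult character_add[OF z] mult_ac)
  then obtain f where f: "f \<in> star_hom A A" "\<forall>p. f (U p) = character z p \<odot> U p"
    using twisted unfolding twisted_group_cstar_algebra_def by blast
  have "\<exists>!f. ?P f"
  proof (rule ex1I[of _ "restrict f (carrier A)"])
    show "?P (restrict f (carrier A))"
      using f restrict_endomorphism by simp
    fix g assume g: "?P g"
    show "g = restrict f (carrier A)"
    proof
      show "g a = restrict f (carrier A) a" for a
        using g f endomorphism_eqI[of g f a]
        by (cases "a \<in> carrier A") (simp_all add: extensional_def)
    qed
  qed
  from theI'[OF this] show "\<alpha> z \<in> star_hom A A" "\<alpha> z (U p) = character z p \<odot> U p"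
    by (simp_all add: dual_action_def character_def)
qed

lemmas dual_action_closed [simp] = star_homD(1)[OF dual_action_hom]
lemmas dual_action_add = star_homD(2)[OF dual_action_hom]
lemmas dual_action_mult = star_homD(3)[OF dual_action_hom]
lemmas dual_action_one = star_homD(4)[OF dual_action_hom]
lemmas dual_action_scale = star_homD(5)[OF dual_action_hom]
lemmas dual_action_star = star_homD(6)[OF dual_action_hom]
lemmas dual_action_diff = star_hom_diff[OF cstar_algebra_axioms cstar_algebra_axioms dual_action_hom]
lemmas dual_action_conv = endomorphism_conv[OF dual_action_hom]
lemmas dual_action_zero = endomorphism_zero[OF dual_action_hom]

lemma star_hom_compose: "f \<in> star_hom A A \<Longrightarrow> g \<in> star_hom A A \<Longrightarrow> (\<lambda>a. f (g a)) \<in> star_hom A A"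
  by (auto simp: star_hom_def ring_hom_def Pi_iff)

lemma dual_action_torus_mult:
  assumes z: "z \<in> carrier torus" and w: "w \<in> carrier torus" and a: "a \<in> carrier A"
  shows "\<alpha> (z * w) a = \<alpha> z (\<alpha> w a)"
proof (rule endomorphism_eqI[OF _ _ _ a])
  have zw: "z * w \<in> carrier torus"
    using z w by simp
  show "\<alpha> (z * w) \<in> star_hom A A" by (rule dual_action_hom[OF zw])
  show "(\<lambda>a. \<alpha> z (\<alpha> w a)) \<in> star_hom A A"
    by (rule star_hom_compose[OF dual_action_hom[OF z] dual_action_hom[OF w]])
  show "\<alpha> (z * w) (U p) = \<alpha> z (\<alpha> w (U p))" for p
    by (simp only: dual_action_U[OF zw] dual_action_U[OF z] dual_action_U[OF w]
        dual_action_scale[OF z] U_closed scale_scale character_mult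
        mult.commute[of "character z p" "character w p"])
qed

lemma dual_action_torus_one:
  assumes a: "a \<in> carrier A"
  shows "\<alpha> 1 a = a"
proof (rule endomorphism_eqI[OF _ _ _ a])
  show "(\<lambda>a. a) \<in> star_hom A A"
    by (simp add: star_hom_def ring_hom_def)
  show "\<alpha> 1 \<in> star_hom A A" "\<alpha> 1 (U p) = U p" for p
    by (simp_all add: dual_action_hom dual_action_U)
qed

text \<open>
  A contraction with a contractive inverse is isometric.
\<close>

lemma dual_action_norm [simp]:
  assumes z: "z \<in> carrier torus" and a: "a \<in> carrier A"
  shows "cnorm A (\<alpha> z a) = cnorm A a"
proof -
  let ?w = "inv\<^bsub>torus\<^esub> z"
  have w: "?w \<in> carrier torus" "?w * z = 1"
    using subgroup_torusD(4,5)[OF subgroup_carrier_torus z] by auto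
  have "cnorm A a = cnorm A (\<alpha> ?w (\<alpha> z a))"
    using dual_action_torus_mult[OF w(1) z a] w(2) dual_action_torus_one[OF a] by simp
  also have "\<dots> \<le> cnorm A (\<alpha> z a)"
    using w z a by (intro star_hom_contractive dual_action_hom cstar_algebra_axioms dual_action_closed)
  finally show ?thesis
    using star_hom_contractive[OF cstar_algebra_axioms cstar_algebra_axioms dual_action_hom[OF z] a]
    by simp
qed

end

section \<open>Averages over subgroups and conditional expectations\<close>

lemma norm_half_one_plus_less:
  assumes "cmod u = 1" "u \<noteq> 1" shows "cmod ((1 + u) / 2) < 1"
proof -
  have 1: "(Re u)\<^sup>2 + (Im u)\<^sup>2 = 1"
    using assms(1) cmod_power2[of u] by simp
  have "Re u < 1"
  proof (rule ccontr)
    assume "\<not> Re u < 1"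
    then have "Re u = 1" using complex_Re_le_cmod[of u] assms(1) by simp
    then have "u = 1" using 1 by (simp add: complex_eq_iff)
    with assms show False by simp
  qed
  have "(cmod (1 + u))\<^sup>2 = 2 + 2 * Re u"
    unfolding cmod_power2 using 1 by (simp add: power2_eq_square algebra_simps)
  then have "(cmod (1 + u))\<^sup>2 < 2\<^sup>2" using \<open>Re u < 1\<close> by simp
  then have "cmod (1 + u) < 2" by (rule power2_less_imp_less) simp
  then show ?thesis by (simp add: norm_divide)
qed

lemma norm_half_one_plus_le:
  assumes "cmod u = 1" shows "cmod ((1 + u) / 2) \<le> 1"
  using norm_half_one_plus_less[of u] assms by (cases "u = 1") auto

definition annihilator :: "(complex ^ 'd) set \<Rightarrow> (int ^ 'd) set"
  where "annihilator G = {p. \<forall>g\<in>G. character g p = 1}"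

text \<open>
  The scalar by which the composition of the operators \<open>(1 + \<alpha> g) / 2\<close> for \<open>g\<close> in \<open>gs\<close> multiplies \<open>U p\<close>.
\<close>

definition averaging_factor :: "(complex ^ 'd) list \<Rightarrow> int ^ 'd \<Rightarrow> complex"
  where "averaging_factor gs p = (\<Prod>g\<leftarrow>gs. (1 + character g p) / 2)"

lemma averaging_factor_simps [simp]:
  "averaging_factor [] p = 1"
  "averaging_factor (g # gs) p = (1 + character g p) / 2 * averaging_factor gs p"
  by (simp_all add: averaging_factor_def)

text \<open>
  For each \<open>p\<close> outside of the annihilator choose \<open>g\<close> in \<open>G\<close> with \<open>g\<^sup>p \<noteq> 1\<close>; then \<open>(1 + g\<^sup>p) / 2\<close> has modulus less than 1, as the disc is
  strictly convex. Let the \<open>n\<close>-th list consist of the first \<open>n\<close> of these choices, each repeated \<open>n\<close> times.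
  Its factor at such a \<open>p\<close> is eventually bounded by an \<open>n\<close>-th power of a number less than 1.
\<close>

lemma averaging_sequence_exists:
  assumes "subgroup G (torus :: (complex ^ 'd) monoid)"
  shows "\<exists>gs. (\<forall>n. set (gs n) \<subseteq> G) \<and>
    (\<forall>p. (\<lambda>n. averaging_factor (gs n) p) \<longlonglongrightarrow> (if p \<in> annihilator G then 1 else 0))"
proof -
  note G = subgroup_torusD[OF assms]
  have "\<exists>g\<in>G. p \<notin> annihilator G \<longrightarrow> character g p \<noteq> 1" for p
    using G(2) by (auto simp: annihilator_def)
  then obtain w where w: "\<And>p. w p \<in> G" "\<And>p. p \<notin> annihilator G \<Longrightarrow> character (w p) p \<noteq> 1"
    by metis
  define e :: "nat \<Rightarrow> int ^ 'd" where "e = from_nat"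
  define gs where "gs n = concat (map (\<lambda>i. replicate n (w (e i))) [0..<n])" for n
  define c where "c p i = (1 + character (w (e i)) p) / 2" for p i
  have norm_c: "cmod (c p i) \<le> 1" for p i
    unfolding c_def by (rule norm_half_one_plus_le) (use w(1) G(1) norm_character in blast)
  have gs_prod: "averaging_factor (gs n) p = (\<Prod>i<n. c p i ^ n)" for n p
  proof -
    have "averaging_factor (concat (map (\<lambda>i. replicate n (w (e i))) [0..<k])) p = (\<Prod>i<k. c p i ^ n)" for k
      by (induction k) (simp_all add: averaging_factor_def c_def prod_list_replicate)
    then show ?thesis by (simp add: gs_def)
  qed
  have "(\<lambda>n. averaging_factor (gs n) p) \<longlonglongrightarrow> (if p \<in> annihilator G then 1 else 0)" for p
  proof (cases "p \<in> annihilator G")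
    case True
    then have "c p i = 1" for i
      using w(1) by (simp add: c_def annihilator_def)
    then show ?thesis using True by (simp add: gs_prod)
  next
    case False
    define k where "k = to_nat p"
    have "e k = p" by (simp add: e_def k_def)
    then have less: "cmod (c p k) < 1"
      unfolding c_def using w False G(1) norm_character
      by (intro norm_half_one_plus_less) (auto simp: subset_iff)
    have "norm (averaging_factor (gs n) p) \<le> cmod (c p k) ^ n" if "n > k" for n
    proof -
      have "norm (\<Prod>i<n. c p i ^ n) = cmod (c p k) ^ n * (\<Prod>i\<in>{..<n} - {k}. cmod (c p i) ^ n)"
        using that by (subst prod.remove[of _ k]) (auto simp: norm_mult norm_power prod_norm[symmetric])
      also have "\<dots> \<le> cmod (c p k) ^ n * 1"
        by (intro mult_left_mono prod_le_1) (auto intro: power_le_one norm_c)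
      finally show ?thesis by (simp add: gs_prod)
    qed
    then have "\<forall>\<^sub>F n in sequentially. norm (averaging_factor (gs n) p) \<le> cmod (c p k) ^ n"
      using eventually_gt_at_top[of k] by (rule eventually_mono[rotated])
    moreover have "(\<lambda>n. cmod (c p k) ^ n) \<longlonglongrightarrow> 0"
      using less by (intro LIMSEQ_realpow_zero) auto
    ultimately show ?thesis
      using False by (auto intro: Lim_null_comparison)
  qed
  moreover have "set (gs n) \<subseteq> G" for n
    using w(1) by (auto simp: gs_def)
  ultimately show ?thesis by blast
qed

definition averaging_sequence :: "(complex ^ 'd) set \<Rightarrow> nat \<Rightarrow> (complex ^ 'd) list"
  where "averaging_sequence G = (SOME gs. (\<forall>n. set (gs n) \<subseteq> G) \<and>
    (\<forall>p. (\<lambda>n. averaging_factor (gs n) p) \<longlonglongrightarrow> (if p \<in> annihilator G then 1 else 0)))"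

lemma averaging_sequence:
  assumes "subgroup G torus"
  shows "set (averaging_sequence G n) \<subseteq> G"
    and "(\<lambda>n. averaging_factor (averaging_sequence G n) p) \<longlonglongrightarrow> (if p \<in> annihilator G then 1 else 0)"
  using someI_ex[OF averaging_sequence_exists[OF assms]] unfolding averaging_sequence_def by blast+

lemma annihilator_torus: "annihilator (carrier torus) = {0}"
proof -
  have "p = 0" if "p \<in> annihilator (carrier torus)" for p :: "int ^ 'd"
  proof (rule ccontr)
    assume "p \<noteq> 0"
    then obtain j where j: "p $ j \<noteq> 0" by (auto simp: vec_eq_iff)
    \<comment> \<open>A point at which the character takes the value \<open>-1\<close>.\<close>
    define z :: "complex ^ 'd" where "z = (\<chi> i. if i = j then cis (pi / p $ j) else 1)"
    have "character z p = (\<Prod>i\<in>UNIV. if i = j then - 1 else 1)"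
      unfolding character_def using j by (intro prod.cong) (auto simp: z_def cis_power_int)
    then have "character z p = - 1" by (simp add: prod.delta)
    moreover have "z \<in> carrier torus" by (simp add: z_def in_torus)
    ultimately show False using that by (auto simp: annihilator_def)
  qed
  then show ?thesis by (auto simp: annihilator_def)
qed

context quantum_torus
begin

text \<open>
  The composition of the commuting operators \<open>(1 + \<alpha> g) / 2\<close>. It is also the mean of \<open>\<alpha> z a\<close>, where \<open>z\<close>
  ranges over the products of the sublists of \<open>gs\<close>.
\<close>

primrec avg :: "(complex ^ 'd) list \<Rightarrow> 'a \<Rightarrow> 'a" where
  "avg [] a = a"
| "avg (g # gs) a = (1 / 2) \<odot> (avg gs a \<oplus> \<alpha> g (avg gs a))"

lemma avg_closed [simp]: "set gs \<subseteq> carrier torus \<Longrightarrow> a \<in> carrier A \<Longrightarrow> avg gs a \<in> carrier A"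
  by (induction gs) simp_all

lemma avg_add:
  "set gs \<subseteq> carrier torus \<Longrightarrow> a \<in> carrier A \<Longrightarrow> b \<in> carrier A \<Longrightarrow> avg gs (a \<oplus> b) = avg gs a \<oplus> avg gs b"
  by (induction gs) (simp_all add: dual_action_add scale_add_right a_ac)

lemma avg_scale: "set gs \<subseteq> carrier torus \<Longrightarrow> a \<in> carrier A \<Longrightarrow> avg gs (c \<odot> a) = c \<odot> avg gs a"
  by (induction gs) (simp_all add: dual_action_scale scale_add_right mult.commute)

lemma avg_diff:
  "set gs \<subseteq> carrier torus \<Longrightarrow> a \<in> carrier A \<Longrightarrow> b \<in> carrier A \<Longrightarrow> avg gs (a \<ominus> b) = avg gs a \<ominus> avg gs b"
  by (simp add: minus_conv avg_add avg_scale)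

lemma avg_star: "set gs \<subseteq> carrier torus \<Longrightarrow> a \<in> carrier A \<Longrightarrow> avg gs (star A a) = star A (avg gs a)"
  by (induction gs) (simp_all add: star_add star_smult dual_action_star)

lemma avg_norm_le: "set gs \<subseteq> carrier torus \<Longrightarrow> a \<in> carrier A \<Longrightarrow> cnorm A (avg gs a) \<le> cnorm A a"
  by (induction gs) (simp_all add: norm_half_scale_le)

lemma dual_action_torus_commute:
  "z \<in> carrier torus \<Longrightarrow> w \<in> carrier torus \<Longrightarrow> a \<in> carrier A \<Longrightarrow> \<alpha> z (\<alpha> w a) = \<alpha> w (\<alpha> z a)"
  by (simp flip: dual_action_torus_mult add: mult.commute)

lemma avg_dual_action:
  "set gs \<subseteq> carrier torus \<Longrightarrow> z \<in> carrier torus \<Longrightarrow> a \<in> carrier A \<Longrightarrow> avg gs (\<alpha> z a) = \<alpha> z (avg gs a)"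
  by (induction gs) (simp_all add: dual_action_scale dual_action_add dual_action_torus_commute)

lemma avg_U: "set gs \<subseteq> carrier torus \<Longrightarrow> avg gs (U p) = averaging_factor gs p \<odot> U p"
proof (induction gs)
  case (Cons g gs)
  then have "avg (g # gs) (U p) = (1 / 2) \<odot> (averaging_factor gs p \<odot> U p \<oplus> (averaging_factor gs p * character g p) \<odot> U p)"
    by (simp add: dual_action_scale dual_action_U)
  also have "\<dots> = averaging_factor (g # gs) p \<odot> U p"
    by (simp add: field_simps flip: scale_add_left)
  finally show ?case .
qed simp

lemma avg_fixed: "b \<in> carrier A \<Longrightarrow> \<forall>g\<in>set gs. \<alpha> g b = b \<Longrightarrow> avg gs b = b"
  by (induction gs) (simp_all add: half_scale_double)

lemma avg_mult_fixed:
  assumes "set gs \<subseteq> carrier torus" "a \<in> carrier A" "b \<in> carrier A" "\<forall>g\<in>set gs. \<alpha> g b = b"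
  shows avg_mult_fixed_right: "avg gs (a \<otimes> b) = avg gs a \<otimes> b"
    and avg_mult_fixed_left: "avg gs (b \<otimes> a) = b \<otimes> avg gs a"
  using assms
  by (induction gs) (simp_all add: dual_action_mult l_distr r_distr smult_mult_left smult_mult_right)

text \<open>
  The average is a convex combination of points \<open>\<alpha> g a\<close> with \<open>g\<close> in \<open>G\<close>. The additional rotation by \<open>h\<close> is
  what the induction needs.
\<close>

lemma avg_displacement:
  assumes G: "subgroup G torus" and gs: "set gs \<subseteq> G" and a: "a \<in> carrier A"
    and c: "\<And>g. g \<in> G \<Longrightarrow> cnorm A (a \<ominus> \<alpha> g a) \<le> c" and h: "h \<in> G"
  shows "cnorm A (a \<ominus> \<alpha> h (avg gs a)) \<le> c"
  using gs h
proof (induction gs arbitrary: h)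
  case (Cons g gs)
  note GD = subgroup_torusD[OF G]
  let ?x = "avg gs a"
  have gh: "g \<in> carrier torus" "h \<in> carrier torus" "set gs \<subseteq> carrier torus"
    using Cons.prems GD(1) by auto
  have x: "?x \<in> carrier A" using gh a by simp
  have "a \<ominus> \<alpha> h (avg (g # gs) a) = (1 / 2) \<odot> (a \<oplus> a) \<ominus> (1 / 2) \<odot> (\<alpha> h ?x \<oplus> \<alpha> (h * g) ?x)"
    using gh x a by (simp add: half_scale_double dual_action_scale dual_action_add dual_action_torus_mult)
  also have "\<dots> = (1 / 2) \<odot> ((a \<ominus> \<alpha> h ?x) \<oplus> (a \<ominus> \<alpha> (h * g) ?x))"
    using gh x a by (simp add: add_diff_add flip: scale_diff)
  finally show ?case
    using Cons.IH[of h] Cons.IH[of "h * g"] Cons.prems GD(3)[of h g] gh x a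
    by (simp add: norm_half_scale_le)
qed (use c in simp)

definition expectation :: "(complex ^ 'd) set \<Rightarrow> 'a \<Rightarrow> 'a"
  where "expectation G a = (SOME b. conv (\<lambda>n. avg (averaging_sequence G n) a) b)"

context
  fixes G :: "(complex ^ 'd) set"
  assumes G: "subgroup G torus"
begin

lemma subgroup_in_torus: "g \<in> G \<Longrightarrow> g \<in> carrier torus"
  using subgroup_torusD(1)[OF G] by blast

lemma averaging_sequence_torus [simp]: "set (averaging_sequence G n) \<subseteq> carrier torus"
  using averaging_sequence(1)[OF G] subgroup_torusD(1)[OF G] by blast

lemma avg_U_conv:
  "conv (\<lambda>n. avg (averaging_sequence G n) (U p)) ((if p \<in> annihilator G then 1 else 0) \<odot> U p)"
proof (rule convI)
  let ?m = "if p \<in> annihilator G then 1 else 0 :: complex"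
  show "(\<lambda>n. cmod (averaging_factor (averaging_sequence G n) p - ?m)) \<longlonglongrightarrow> 0"
    by (intro tendsto_norm_zero LIM_zero averaging_sequence(2)[OF G])
  have "averaging_factor (averaging_sequence G n) p \<odot> U p \<ominus> ?m \<odot> U p
      = (averaging_factor (averaging_sequence G n) p - ?m) \<odot> U p" for n
    by (simp add: minus_conv flip: scale_add_left)
  then show "cnorm A (avg (averaging_sequence G n) (U p) \<ominus> ?m \<odot> U p)
      \<le> cmod (averaging_factor (averaging_sequence G n) p - ?m)" for n
    by (simp add: avg_U cnorm_smult del: scale_zero)
qed simp_all

text \<open>
  The averages converge on each \<open>U p\<close>, and they are contractions, so the set on which they converge
  is closed.
\<close>

lemma expectation_conv:
  assumes "a \<in> carrier A"
  shows "conv (\<lambda>n. avg (averaging_sequence G n) a) (expectation G a)"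
proof -
  let ?T = "\<lambda>n. avg (averaging_sequence G n)"
  have "\<exists>b. conv (\<lambda>n. ?T n a) b"
    using assms
  proof (induction rule: generated_induct)
    case zero
    have "?T n \<zero> = \<zero>" for n
      using avg_scale[of "averaging_sequence G n" \<zero> 0] by simp
    then show ?case using conv_const[of \<zero>] by auto
  next
    case (add a c p)
    have "conv (\<lambda>n. c \<odot> ?T n (U p)) (c \<odot> ((if p \<in> annihilator G then 1 else 0) \<odot> U p))"
      by (intro conv_scale avg_U_conv)
    moreover obtain b where "conv (\<lambda>n. ?T n a) b"
      using add by blast
    ultimately show ?case
      using add(1) conv_add by (fastforce simp: avg_add avg_scale)
  next
    case (limit X a)
    have a: "a \<in> carrier A" using conv_closed[OF limit(2)] by blast
    show ?case
    proof (rule Cauchy_conv)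
      fix e :: real assume "e > 0"
      have "\<forall>\<^sub>F n in sequentially. cnorm A (X n \<ominus> a) < e / 3"
        using limit(2) \<open>e > 0\<close> by (intro order_tendstoD[of _ 0]) (auto simp: conv_def)
      then obtain k where k: "cnorm A (X k \<ominus> a) < e / 3"
        by (auto simp: eventually_sequentially)
      obtain b where "conv (\<lambda>n. ?T n (X k)) b"
        using limit(3) by blast
      then obtain N where N: "\<And>m n. m \<ge> N \<Longrightarrow> n \<ge> N \<Longrightarrow> cnorm A (?T m (X k) \<ominus> ?T n (X k)) < e / 3"
        using conv_Cauchy[of _ b "e / 3"] \<open>e > 0\<close> by fastforce
      have close: "cnorm A (?T n (X k) \<ominus> ?T n a) < e / 3" for n
        using avg_norm_le[of "averaging_sequence G n" "X k \<ominus> a"] k a limit(1) by (simp add: avg_diff)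
      have "cnorm A (?T m a \<ominus> ?T n a) < e" if "m \<ge> N" "n \<ge> N" for m n
        using norm_diff_triangle[of "?T m a" "?T m (X k)" "?T n a"]
          norm_diff_triangle[of "?T m (X k)" "?T n (X k)" "?T n a"]
          norm_diff_commute[of "?T m a" "?T m (X k)"] close[of m] close[of n] N[OF that] a limit(1)
        by simp
      then show "\<exists>N. \<forall>m\<ge>N. \<forall>n\<ge>N. cnorm A (?T m a \<ominus> ?T n a) < e" by blast
    qed (simp add: a)
  qed
  then show ?thesis
    unfolding expectation_def by (rule someI_ex)
qed

lemma expectation_eqI:
  "a \<in> carrier A \<Longrightarrow> conv (\<lambda>n. avg (averaging_sequence G n) a) b \<Longrightarrow> expectation G a = b"
  using conv_unique expectation_conv by blast

lemma expectation_closed [simp]: "a \<in> carrier A \<Longrightarrow> expectation G a \<in> carrier A"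
  using conv_closed expectation_conv by blast

lemma expectation_add:
  "a \<in> carrier A \<Longrightarrow> b \<in> carrier A \<Longrightarrow> expectation G (a \<oplus> b) = expectation G a \<oplus> expectation G b"
  by (rule expectation_eqI) (simp_all add: avg_add conv_add expectation_conv)

lemma expectation_scale:
  "a \<in> carrier A \<Longrightarrow> expectation G (c \<odot> a) = c \<odot> expectation G a"
  by (rule expectation_eqI) (simp_all add: avg_scale conv_scale expectation_conv)

lemma expectation_diff:
  "a \<in> carrier A \<Longrightarrow> b \<in> carrier A \<Longrightarrow> expectation G (a \<ominus> b) = expectation G a \<ominus> expectation G b"
  by (simp add: minus_conv expectation_add expectation_scale)

lemma expectation_star:
  "a \<in> carrier A \<Longrightarrow> expectation G (star A a) = star A (expectation G a)"
  by (rule expectation_eqI) (simp_all add: avg_star conv_star expectation_conv)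

lemma expectation_norm_le: "a \<in> carrier A \<Longrightarrow> cnorm A (expectation G a) \<le> cnorm A a"
  by (rule conv_norm_le[OF expectation_conv]) (simp_all add: avg_norm_le)

lemma conv_expectation:
  assumes "conv X x" shows "conv (\<lambda>n. expectation G (X n)) (expectation G x)"
proof (rule convI)
  show "(\<lambda>n. cnorm A (X n \<ominus> x)) \<longlonglongrightarrow> 0"
    using assms by (simp add: conv_def)
qed (use conv_closed[OF assms] in \<open>simp_all add: expectation_norm_le flip: expectation_diff\<close>)

lemma expectation_dual_action:
  "z \<in> carrier torus \<Longrightarrow> a \<in> carrier A \<Longrightarrow> expectation G (\<alpha> z a) = \<alpha> z (expectation G a)"
  by (rule expectation_eqI) (simp_all add: avg_dual_action dual_action_conv expectation_conv)

lemma expectation_fixed: 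
  assumes "b \<in> carrier A" "\<And>g. g \<in> G \<Longrightarrow> \<alpha> g b = b" shows "expectation G b = b"
proof (rule expectation_eqI)
  have "avg (averaging_sequence G n) b = b" for n
    using averaging_sequence(1)[OF G] assms by (intro avg_fixed) auto
  then show "conv (\<lambda>n. avg (averaging_sequence G n) b) b"
    using assms by (simp add: conv_const)
qed fact

lemma expectation_mult_fixed:
  assumes a: "a \<in> carrier A" and b: "b \<in> carrier A" "\<And>g. g \<in> G \<Longrightarrow> \<alpha> g b = b"
  shows expectation_mult_fixed_right: "expectation G (a \<otimes> b) = expectation G a \<otimes> b"
    and expectation_mult_fixed_left: "expectation G (b \<otimes> a) = b \<otimes> expectation G a"
proof -
  have fixed: "\<forall>g\<in>set (averaging_sequence G n). \<alpha> g b = b" for n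
    using averaging_sequence(1)[OF G] b by auto
  show "expectation G (a \<otimes> b) = expectation G a \<otimes> b"
    using a b fixed
    by (intro expectation_eqI) (simp_all add: avg_mult_fixed_right conv_mult conv_const expectation_conv)
  show "expectation G (b \<otimes> a) = b \<otimes> expectation G a"
    using a b fixed
    by (intro expectation_eqI) (simp_all add: avg_mult_fixed_left conv_mult conv_const expectation_conv)
qed

lemma expectation_U: "expectation G (U p) = (if p \<in> annihilator G then U p else \<zero>)"
  using expectation_eqI[OF _ avg_U_conv, of p] by simp

lemma expectation_zero: "expectation G \<zero> = \<zero>"
  using expectation_scale[of \<zero> 0] by simp

lemma expectation_one: "expectation G \<one> = \<one>"
  by (rule expectation_fixed) (simp_all add: dual_action_one subgroup_in_torus)

lemma expectation_invariant:
  assumes g: "g \<in> G" and a: "a \<in> carrier A" shows "\<alpha> g (expectation G a) = expectation G a"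
  using a
proof (induction rule: generated_induct)
  case zero
  show ?case by (simp add: expectation_zero dual_action_zero subgroup_in_torus[OF g])
next
  case (add a c p)
  have "\<alpha> g (expectation G (U p)) = expectation G (U p)"
    using g subgroup_in_torus[OF g] 
    by (simp add: expectation_U dual_action_zero dual_action_U) (simp add: annihilator_def)
  then show ?case
    using add subgroup_in_torus[OF g]
    by (simp add: expectation_add expectation_scale dual_action_add dual_action_scale)
next
  case (limit X a)
  then have "conv (\<lambda>n. expectation G (X n)) (\<alpha> g (expectation G a))"
    using dual_action_conv[OF subgroup_in_torus[OF g] conv_expectation[OF limit(2)]] by simp
  then show ?case
    using conv_unique conv_expectation[OF limit(2)] by blast
qed

text \<open>
  This estimate is the source of all quantitative bounds: for the torus it bounds the diameter of the
  state space, and for two subgroups it bounds the reach of the bridge.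
\<close>

lemma expectation_displacement:
  assumes a: "a \<in> carrier A" and c: "\<And>g. g \<in> G \<Longrightarrow> cnorm A (a \<ominus> \<alpha> g a) \<le> c"
  shows "cnorm A (a \<ominus> expectation G a) \<le> c"
proof (rule conv_norm_le)
  show "conv (\<lambda>n. a \<ominus> avg (averaging_sequence G n) a) (a \<ominus> expectation G a)"
    using a by (simp add: conv_diff conv_const expectation_conv)
  show "cnorm A (a \<ominus> avg (averaging_sequence G n) a) \<le> c" for n
    using avg_displacement[OF G averaging_sequence(1)[OF G] a c, of 1 n] a
      subgroup_torusD(2)[OF G] by (simp add: dual_action_torus_one)
qed

end

section \<open>The canonical trace\<close>

text \<open>
  No character but the trivial one is constant on the torus, so the expectation annihilates every \<open>U p\<close> with \<open>p \<noteq> 0\<close>.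
\<close>

lemma expectation_torus_scalar:
  assumes "a \<in> carrier A" shows "\<exists>t. expectation (carrier torus) a = t \<odot> \<one>"
  using assms
proof (induction rule: generated_induct)
  case zero
  then show ?case
    using scale_zero[OF one_closed] by (auto simp: expectation_zero[OF subgroup_carrier_torus] intro!: exI[of _ 0])
next
  case (add a c p)
  then obtain t where t: "expectation (carrier torus) a = t \<odot> \<one>" by blast
  have "expectation (carrier torus) (c \<odot> U p \<oplus> a) = (if p = 0 then c + t else t) \<odot> \<one>"
    using add(1) t
    by (simp add: expectation_add expectation_scale expectation_U subgroup_carrier_torus
        annihilator_torus U_zero scale_add_left)
  then show ?case by blast
next
  case (limit X a)
  let ?E = "expectation (carrier torus)"
  have E: "conv (\<lambda>n. ?E (X n)) (?E a)"
    by (rule conv_expectation[OF subgroup_carrier_torus limit(2)])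
  obtain t where t: "\<And>n. ?E (X n) = t n \<odot> \<one>"
    using limit(3) by metis
  have diff: "cmod (x - y) = cnorm A (x \<odot> \<one> \<ominus> y \<odot> \<one>)" for x y
    using cnorm_smult[of \<one> "x - y"] by (simp add: minus_conv flip: scale_add_left)
  have "Cauchy t"
  proof (rule CauchyI)
    fix e :: real assume "0 < e"
    then show "\<exists>M. \<forall>m\<ge>M. \<forall>n\<ge>M. norm (t m - t n) < e"
      using conv_Cauchy[OF E] by (simp add: t diff)
  qed
  then obtain s where s: "t \<longlonglongrightarrow> s"
    using Cauchy_convergent convergent_def by blast
  have "conv (\<lambda>n. ?E (X n)) (s \<odot> \<one>)"
  proof (rule convI)
    show "(\<lambda>n. cmod (t n - s)) \<longlonglongrightarrow> 0"
      using s by (intro tendsto_norm_zero LIM_zero)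
  qed (simp_all add: t diff)
  then show ?case
    using conv_unique[OF E] by blast
qed

definition tau :: "'a \<Rightarrow> complex" (\<open>\<tau>\<close>)
  where "\<tau> a = (THE t. expectation (carrier torus) a = t \<odot> \<one>)"

lemma expectation_torus: 
  assumes "a \<in> carrier A" shows "expectation (carrier torus) a = \<tau> a \<odot> \<one>"
proof -
  have "\<exists>!t. expectation (carrier torus) a = t \<odot> \<one>"
    using expectation_torus_scalar[OF assms] scale_one_inject by metis
  then show ?thesis unfolding tau_def by (rule theI')
qed

lemma norm_tau_le: "a \<in> carrier A \<Longrightarrow> cmod (\<tau> a) \<le> cnorm A a"
  using expectation_norm_le[OF subgroup_carrier_torus, of a] cnorm_smult[of \<one> "\<tau> a"]
  by (simp add: expectation_torus)

section \<open>Extending states from the fixed point algebras\<close>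

abbreviation fixed where "fixed G \<equiv> fixed_point_algebra A U G"

lemma fixed_simps [simp]:
  "mult (fixed G) = mult A" "one (fixed G) = one A" "zero (fixed G) = zero A" "add (fixed G) = add A"
  "smult (fixed G) = smult A" "star (fixed G) = star A" "cnorm (fixed G) = cnorm A"
  by (simp_all add: fixed_point_algebra_def)

lemma carrier_fixed: "carrier (fixed G) = {a \<in> carrier A. \<forall>z\<in>G. \<alpha> z a = a}"
  by (simp add: fixed_point_algebra_def)

lemma fixedD:
  assumes "b \<in> carrier (fixed G)"
  shows "b \<in> carrier A" "g \<in> G \<Longrightarrow> \<alpha> g b = b"
  using assms by (auto simp: carrier_fixed)

context
  fixes G :: "(complex ^ 'd) set"
  assumes G: "subgroup G torus"
begin

lemma fixed_subalgebra: "cstar_subalgebra (carrier (fixed G)) A"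
proof -
  have "closedin (norm_topology A) (carrier (fixed G))"
    unfolding closedin_conv
  proof (intro conjI allI impI)
    fix X x assume X: "range X \<subseteq> carrier (fixed G) \<and> conv X x"
    have "\<alpha> z x = x" if "z \<in> G" for z
    proof -
      have "\<alpha> z (X n) = X n" for n
        using X that by (auto simp: carrier_fixed)
      then have "conv X (\<alpha> z x)"
        using dual_action_conv[OF subgroup_in_torus[OF G that], of X x] X by simp
      then show ?thesis using X conv_unique by blast
    qed
    then show "x \<in> carrier (fixed G)"
      using X conv_closed by (auto simp: carrier_fixed)
  qed (auto simp: carrier_fixed)
  then show ?thesis
    using subgroup_in_torus[OF G]
    by (auto simp: cstar_subalgebra_def carrier_fixed dual_action_one dual_action_add dual_action_mult
        dual_action_scale dual_action_star)
qed

lemma fixed_eq: "fixed G = A\<lparr>carrier := carrier (fixed G)\<rparr>"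
  by (simp add: fixed_point_algebra_def)

lemma fixed_cstar_algebra: "cstar_algebra (fixed G)"
  using subalgebra_cstar_algebra[OF fixed_subalgebra] fixed_eq by simp

lemma fixed_diff:
  assumes "a \<in> carrier (fixed G)" "b \<in> carrier (fixed G)"
  shows "a \<ominus>\<^bsub>fixed G\<^esub> b = a \<ominus> b"
proof -
  interpret B: cstar_algebra "fixed G" by (rule fixed_cstar_algebra)
  show ?thesis
    using subalgebra_diff[OF fixed_subalgebra assms] B.is_abelian_group fixed_eq by simp
qed

lemma fixed_closed:
  "\<one> \<in> carrier (fixed G)" 
  "a \<in> carrier (fixed G) \<Longrightarrow> b \<in> carrier (fixed G) \<Longrightarrow> a \<oplus> b \<in> carrier (fixed G)"
  "a \<in> carrier (fixed G) \<Longrightarrow> b \<in> carrier (fixed G) \<Longrightarrow> a \<otimes> b \<in> carrier (fixed G)"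
  "a \<in> carrier (fixed G) \<Longrightarrow> c \<odot> a \<in> carrier (fixed G)" 
  "a \<in> carrier (fixed G) \<Longrightarrow> star A a \<in> carrier (fixed G)"
  using fixed_subalgebra by (auto simp: cstar_subalgebra_def)

lemma expectation_in_fixed: "a \<in> carrier A \<Longrightarrow> expectation G a \<in> carrier (fixed G)"
  using expectation_invariant[OF G] by (simp add: carrier_fixed G)

lemma expectation_of_fixed: "a \<in> carrier (fixed G) \<Longrightarrow> expectation G a = a"
  by (rule expectation_fixed[OF G]) (auto dest: fixedD)

lemma expectation_bimodule:
  assumes "a \<in> carrier A" "b \<in> carrier (fixed G)"
  shows "expectation G (a \<otimes> b) = expectation G a \<otimes> b" "expectation G (b \<otimes> a) = b \<otimes> expectation G a"
  using expectation_mult_fixed[OF G assms(1) fixedD(1)[OF assms(2)] fixedD(2)[OF assms(2)]] by auto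

lemma star_U_mult: "\<exists>c. star A (U p) \<otimes> U q = c \<odot> U (q - p)"
  by (auto simp: star_U smult_mult_left U_mult)

lemma U_in_fixed: "p \<in> annihilator G \<Longrightarrow> U p \<in> carrier (fixed G)"
  using subgroup_in_torus[OF G] by (simp add: carrier_fixed dual_action_U annihilator_def)

text \<open>
  The product \<open>U p* U q\<close> is a multiple of \<open>U (q - p)\<close>, which the expectation annihilates.
\<close>

lemma expectation_orthogonal:
  assumes b: "b \<in> carrier (fixed G)" and c: "c \<in> carrier (fixed G)" and pq: "q - p \<notin> annihilator G"
  shows "expectation G (star A (U p \<otimes> b) \<otimes> (U q \<otimes> c)) = \<zero>"
proof -
  note carr = fixedD(1)[OF b] fixedD(1)[OF c]
  obtain s where s: "star A (U p) \<otimes> U q = s \<odot> U (q - p)"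
    using star_U_mult by blast
  have "star A (U p \<otimes> b) \<otimes> (U q \<otimes> c) = star A b \<otimes> ((star A (U p) \<otimes> U q) \<otimes> c)"
    using carr by (simp add: star_mult m_assoc)
  also have "expectation G \<dots> = star A b \<otimes> (expectation G (s \<odot> U (q - p)) \<otimes> c)"
    unfolding s using carr b c by (simp add: expectation_bimodule fixed_closed)
  also have "\<dots> = \<zero>"
    using pq carr by (simp add: expectation_scale expectation_U G)
  finally show ?thesis .
qed

text \<open>
  The decomposition of a polynomial into its components for the characters of \<open>G\<close>: a finite sum of terms
  \<open>U p b\<close> with \<open>b\<close> fixed by \<open>G\<close>, where the exponents \<open>p\<close> are pairwise inequivalent modulo the annihilator of \<open>G\<close>, so that distinct terms are orthogonal for
  the expectation.
\<close>

inductive graded_sum :: "(int ^ 'd) set \<Rightarrow> 'a \<Rightarrow> bool" where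
  graded_sum_zero: "graded_sum {} \<zero>"
| graded_sum_term: "graded_sum K a \<Longrightarrow> (\<And>q. q \<in> K \<Longrightarrow> q - p \<notin> annihilator G) \<Longrightarrow>
    b \<in> carrier (fixed G) \<Longrightarrow> graded_sum (insert p K) (U p \<otimes> b \<oplus> a)"

lemma graded_sum_closed: "graded_sum K a \<Longrightarrow> a \<in> carrier A"
  by (induction rule: graded_sum.induct) (auto dest: fixedD)

text \<open>
  If \<open>p\<close> is equivalent to an exponent \<open>q\<close> that occurs already, the new term is absorbed, because
  \<open>U p b = U q (U q* U p b)\<close> and \<open>U q* U p\<close> is fixed by \<open>G\<close>.
\<close>

lemma graded_sum_add_term:
  assumes "graded_sum K a" "b \<in> carrier (fixed G)"
  shows "\<exists>K'. K' \<subseteq> insert p K \<and> graded_sum K' (U p \<otimes> b \<oplus> a)"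
  using assms
proof (induction rule: graded_sum.induct)
  case graded_sum_zero
  then show ?case using graded_sum_term[OF graded_sum.graded_sum_zero, of p b] by auto
next
  case (graded_sum_term K a q b')
  note b = \<open>b \<in> carrier (fixed G)\<close> and b' = \<open>b' \<in> carrier (fixed G)\<close>
  note carr = fixedD(1)[OF b] fixedD(1)[OF b'] graded_sum_closed[OF graded_sum_term.hyps(1)]
  show ?case
  proof (cases "p - q \<in> annihilator G")
    case True
    define b'' where "b'' = (star A (U q) \<otimes> U p) \<otimes> b"
    obtain c where c: "star A (U q) \<otimes> U p = c \<odot> U (p - q)"
      using star_U_mult by blast
    have b'': "b'' \<in> carrier (fixed G)"
      unfolding b''_def c using U_in_fixed[OF True] b by (intro fixed_closed)
    have "U q \<otimes> b'' = (U q \<otimes> star A (U q)) \<otimes> (U p \<otimes> b)"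
      using carr by (simp add: b''_def m_assoc)
    then have "U p \<otimes> b = U q \<otimes> b''"
      using carr by (simp add: U_unitary)
    then have "U p \<otimes> b \<oplus> (U q \<otimes> b' \<oplus> a) = U q \<otimes> (b'' \<oplus> b') \<oplus> a"
      using carr fixedD(1)[OF b''] by (simp add: r_distr a_assoc)
    moreover have "graded_sum (insert q K) (U q \<otimes> (b'' \<oplus> b') \<oplus> a)"
      using graded_sum_term b'' b' by (intro graded_sum.graded_sum_term fixed_closed) auto
    ultimately show ?thesis by auto
  next
    case False
    obtain K' where K': "K' \<subseteq> insert p K" "graded_sum K' (U p \<otimes> b \<oplus> a)"
      using graded_sum_term by blast
    have "graded_sum (insert q K') (U q \<otimes> b' \<oplus> (U p \<otimes> b \<oplus> a))"
      using graded_sum_term K' False by (intro graded_sum.graded_sum_term) auto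
    moreover have "U q \<otimes> b' \<oplus> (U p \<otimes> b \<oplus> a) = U p \<otimes> b \<oplus> (U q \<otimes> b' \<oplus> a)"
      using carr by (simp add: a_ac)
    ultimately show ?thesis using K'(1) by (intro exI[of _ "insert q K'"]) auto
  qed
qed

lemma polynomials_graded_sum: "a \<in> polynomials \<Longrightarrow> \<exists>K. graded_sum K a"
proof (induction rule: polynomials.induct)
  case polynomials_zero
  then show ?case using graded_sum_zero by blast
next
  case (polynomials_term a c p)
  then obtain K where "graded_sum K a" by blast
  from graded_sum_add_term[OF this fixed_closed(4)[OF fixed_closed(1)], of p c]
  show ?case by (auto simp: smult_mult_right)
qed

lemma graded_sum_orthogonal:
  assumes "graded_sum K a" "\<And>q. q \<in> K \<Longrightarrow> q - p \<notin> annihilator G" "b \<in> carrier (fixed G)"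
  shows "expectation G (star A (U p \<otimes> b) \<otimes> a) = \<zero>"
  using assms
proof (induction rule: graded_sum.induct)
  case (graded_sum_term K a q c)
  then show ?case
    using graded_sum_closed[OF graded_sum_term(1)] fixedD(1)
    by (simp add: r_distr expectation_add expectation_orthogonal G)
qed (use fixedD(1) in \<open>simp add: expectation_zero G\<close>)

text \<open>
  By orthogonality the expectation of \<open>a* a\<close> is the sum of the elements \<open>b* b\<close> over the terms \<open>U p b\<close> of \<open>a\<close>, and
  these \<open>b\<close> lie in the fixed point algebra, where \<open>\<phi>\<close> is positive.
\<close>

lemma state_expectation_nonneg:
  assumes \<phi>: "\<phi> \<in> states (fixed G)" and a: "graded_sum K a"
  shows "\<phi> (expectation G (star A a \<otimes> a)) \<in> \<real>\<^sub>\<ge>\<^sub>0"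
  using a
proof (induction rule: graded_sum.induct)
  case graded_sum_zero
  have "\<phi> \<zero> = 0"
    using \<phi> fixed_closed(1) scale_zero[OF one_closed] unfolding states_def by (auto dest!: spec[of _ 0])
  then show ?case by (simp add: expectation_zero G)
next
  case (graded_sum_term K a p b)
  define x where "x = U p \<otimes> b"
  note carr = graded_sum_closed[OF graded_sum_term(1)] fixedD(1)[OF graded_sum_term(3)]
  have x: "x \<in> carrier A" using carr by (simp add: x_def)
  have 1: "expectation G (star A x \<otimes> a) = \<zero>"
    unfolding x_def using graded_sum_term by (intro graded_sum_orthogonal) auto
  moreover have "star A a \<otimes> x = star A (star A x \<otimes> a)"
    using x carr by (simp add: star_mult)
  ultimately have 2: "expectation G (star A a \<otimes> x) = \<zero>"
    using x carr by (simp add: expectation_star G)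
  have "star A x \<otimes> x = star A b \<otimes> ((star A (U p) \<otimes> U p) \<otimes> b)"
    using carr by (simp add: x_def star_mult m_assoc)
  also have "\<dots> = star A b \<otimes> b"
    using carr by (simp add: U_unitary)
  finally have "expectation G (star A x \<otimes> x) = star A b \<otimes> b"
    using graded_sum_term(3) by (simp add: expectation_of_fixed fixed_closed)
  moreover have "star A (x \<oplus> a) \<otimes> (x \<oplus> a) =
      (star A x \<otimes> x \<oplus> star A x \<otimes> a) \<oplus> (star A a \<otimes> x \<oplus> star A a \<otimes> a)"
    using x carr by (simp add: star_add l_distr r_distr a_ac)
  ultimately have "expectation G (star A (x \<oplus> a) \<otimes> (x \<oplus> a)) =
      star A b \<otimes> b \<oplus> expectation G (star A a \<otimes> a)"
    using 1 2 x carr by (simp add: expectation_add G)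
  moreover have "\<phi> (star A b \<otimes> b \<oplus> expectation G (star A a \<otimes> a)) =
      \<phi> (star A b \<otimes> b) + \<phi> (expectation G (star A a \<otimes> a))"
    using \<phi> carr graded_sum_term(3) expectation_in_fixed fixed_closed by (simp add: states_def)
  moreover have "\<phi> (star A b \<otimes> b) \<in> \<real>\<^sub>\<ge>\<^sub>0"
    using \<phi> graded_sum_term(3) by (simp add: states_def)
  ultimately show ?case
    using graded_sum_term unfolding x_def by (simp add: nonneg_Reals_add_I)
qed

lemma state_expectation_contractive:
  assumes \<phi>: "\<phi> \<in> states (fixed G)"
  shows "contractive_functional A (\<lambda>a. \<phi> (expectation G a))"
proof -
  interpret B: cstar_algebra "fixed G" by (rule fixed_cstar_algebra)
  note \<phi>' = contractive_functionalD[OF B.states_contractive[OF \<phi>]]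
  have "cmod (\<phi> (expectation G a)) \<le> cnorm A a" if "a \<in> carrier A" for a
    using \<phi>'(3)[OF expectation_in_fixed[OF that]] expectation_norm_le[OF G that] by simp
  then show ?thesis
    unfolding contractive_functional_def
    using \<phi>'(1,2) expectation_in_fixed by (simp add: expectation_add expectation_scale G)
qed

text \<open>
  Positivity passes from polynomials to all of \<open>A\<close> since \<open>\<phi> \<circ> E\<close> is contractive.
\<close>

lemma state_extension:
  assumes \<phi>: "\<phi> \<in> states (fixed G)"
  shows "restrict (\<lambda>a. \<phi> (expectation G a)) (carrier A) \<in> states A"
proof -
  let ?\<Phi> = "\<lambda>a. \<phi> (expectation G a)"
  note \<Phi> = state_expectation_contractive[OF \<phi>]
  have "?\<Phi> (star A a \<otimes> a) \<in> \<real>\<^sub>\<ge>\<^sub>0" if a: "a \<in> carrier A" for a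
  proof -
    obtain X where X: "range X \<subseteq> polynomials" "conv X a"
      using polynomials_dense[OF a] by blast
    then have "?\<Phi> (star A (X n) \<otimes> X n) \<in> \<real>\<^sub>\<ge>\<^sub>0" for n
      using polynomials_graded_sum[of "X n"] state_expectation_nonneg[OF \<phi>] by auto
    moreover have "(\<lambda>n. ?\<Phi> (star A (X n) \<otimes> X n)) \<longlonglongrightarrow> ?\<Phi> (star A a \<otimes> a)"
      by (intro functional_conv[OF \<Phi>] conv_mult conv_star X)
    ultimately show ?thesis
      by (rule closed_sequentially[OF closed_nonneg_Reals_complex])
  qed
  moreover have "\<phi> \<one> = 1"
    using \<phi> by (simp add: states_def)
  ultimately show ?thesis
    using contractive_functionalD(1,2)[OF \<Phi>] by (simp add: states_def expectation_one G)
qed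

end

text \<open>
  The fixed point algebra of the whole torus consists of the scalars, and the trace is the extension of
  its unique state.
\<close>

lemma tau_state: "restrict \<tau> (carrier A) \<in> states A"
proof -
  have "\<tau> (t \<odot> \<one>) = t" for t
    using expectation_torus[of "t \<odot> \<one>"] scale_one_inject
      expectation_scale[OF subgroup_carrier_torus, of \<one> t] expectation_one[OF subgroup_carrier_torus] by simp
  note tau_scale_one = this
  let ?T = "carrier torus :: (complex ^ 'd) set"
  have in_fixed: "a = \<tau> a \<odot> \<one>" if "a \<in> carrier (fixed ?T)" for a
    using expectation_torus[of a] expectation_of_fixed[OF subgroup_carrier_torus that] fixedD(1)[OF that] by simp
  have add: "\<tau> (a \<oplus> b) = \<tau> a + \<tau> b" if "a \<in> carrier A" "b \<in> carrier A" for a b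
    using that expectation_add[OF subgroup_carrier_torus that] 
    by (intro scale_one_inject) (simp add: expectation_torus[symmetric] scale_add_left)
  have scale: "\<tau> (c \<odot> a) = c * \<tau> a" if "a \<in> carrier A" for a c
    using that expectation_scale[OF subgroup_carrier_torus that, of c] 
    by (intro scale_one_inject) (simp add: expectation_torus)
  have star: "\<tau> (star A a) = cnj (\<tau> a)" if "a \<in> carrier A" for a
    using that expectation_star[OF subgroup_carrier_torus that] 
    by (intro scale_one_inject) (simp add: expectation_torus star_smult)
  have "restrict \<tau> (carrier (fixed ?T)) \<in> states (fixed ?T)"
  proof -
    have "\<tau> (star A a \<otimes> a) \<in> \<real>\<^sub>\<ge>\<^sub>0" if "a \<in> carrier (fixed ?T)" for a
    proof -
      have "\<tau> (star A a \<otimes> a) = \<tau> ((cnj (\<tau> a) * \<tau> a) \<odot> \<one>)"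
        using fixedD(1)[OF that] 
        by (subst (1 2) in_fixed[OF that]) (simp add: star_smult smult_mult_left smult_mult_right mult.commute)
      also have "\<dots> = complex_of_real ((cmod (\<tau> a))\<^sup>2)"
        by (simp only: tau_scale_one complex_norm_square mult.commute)
      finally show ?thesis by simp
    qed
    then show ?thesis
      using fixed_closed[OF subgroup_carrier_torus] tau_scale_one[of 1]
      by (simp add: states_def add scale fixedD(1))
  qed
  from state_extension[OF subgroup_carrier_torus this]
  have "restrict (\<lambda>a. \<tau> (expectation ?T a)) (carrier A) \<in> states A"
    using expectation_in_fixed[OF subgroup_carrier_torus] by (simp cong: restrict_cong)
  then show ?thesis
    by (simp add: expectation_torus tau_scale_one cong: restrict_cong)
qed

end

section \<open>Means of scalar functions and the Fejer kernel\<close>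

text \<open>
  The scalar counterpart of \<open>avg\<close>: the mean of the values of \<open>f\<close> at the products of the sublists of the given list.
\<close>

primrec mean :: "(complex ^ 'd) list \<Rightarrow> (complex ^ 'd \<Rightarrow> 'b) \<Rightarrow> 'b::real_normed_vector" where
  "mean [] f = f 1"
| "mean (g # gs) f = (1 / 2) *\<^sub>R (mean gs f + mean gs (\<lambda>z. f (z * g)))"

lemma mean_cong:
  "set gs \<subseteq> carrier torus \<Longrightarrow> (\<And>z. z \<in> carrier torus \<Longrightarrow> f z = h z) \<Longrightarrow> mean gs f = mean gs h"
proof (induction gs arbitrary: f h)
  case (Cons g gs)
  have "mean gs f = mean gs h" "mean gs (\<lambda>z. f (z * g)) = mean gs (\<lambda>z. h (z * g))"
    using Cons.prems by (auto intro!: Cons.IH)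
  then show ?case by simp
qed simp

lemma mean_const [simp]: "mean gs (\<lambda>_. c) = c"
  by (induction gs) (simp_all flip: scaleR_add_left add: scaleR_add_right)

lemma mean_add: "mean gs (\<lambda>z. f z + h z) = mean gs f + mean gs h"
  by (induction gs arbitrary: f h) (simp_all add: algebra_simps)

lemma mean_linear:
  assumes "linear L" shows "mean gs (\<lambda>z. L (f z)) = L (mean gs f)"
  by (induction gs arbitrary: f) (simp_all add: linear_add[OF assms] linear_scale[OF assms])

lemma mean_cmult: "mean gs (\<lambda>z. c * f z) = (c :: 'b :: real_normed_algebra) * mean gs f"
  by (rule mean_linear) (simp add: linear_iff algebra_simps)

lemma mean_of_real: "mean gs (\<lambda>z. complex_of_real (f z)) = complex_of_real (mean gs f)"
  by (rule mean_linear) (simp add: linear_iff scaleR_conv_of_real)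

lemma mean_sum: "mean gs (\<lambda>z. \<Sum>i\<in>I. f i z) = (\<Sum>i\<in>I. mean gs (f i))"
  by (induction I rule: infinite_finite_induct) (simp_all add: mean_add)

lemma mean_mono:
  fixes f :: "complex ^ 'd \<Rightarrow> real"
  shows "set gs \<subseteq> carrier torus \<Longrightarrow> (\<And>z. z \<in> carrier torus \<Longrightarrow> f z \<le> h z) \<Longrightarrow> mean gs f \<le> mean gs h"
proof (induction gs arbitrary: f h)
  case (Cons g gs)
  have "mean gs f \<le> mean gs h" "mean gs (\<lambda>z. f (z * g)) \<le> mean gs (\<lambda>z. h (z * g))"
    using Cons.prems by (auto intro!: Cons.IH)
  then show ?case by simp
qed simp

lemma norm_mean_le:
  fixes f :: "complex ^ 'd \<Rightarrow> 'b :: real_normed_vector"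
  shows "norm (mean gs f) \<le> mean gs (\<lambda>z. norm (f z))"
proof (induction gs arbitrary: f)
  case (Cons g gs)
  show ?case
    using order_trans[OF norm_triangle_ineq add_mono[OF Cons[of f] Cons[of "\<lambda>z. f (z * g)"]]] by simp
qed simp

lemma mean_character: "mean gs (\<lambda>z. character z p) = averaging_factor gs p"
proof (induction gs)
  case (Cons g gs)
  have "mean gs (\<lambda>z. character (z * g) p) = character g p * averaging_factor gs p"
    unfolding Cons[symmetric] by (simp add: character_mult mult.commute flip: mean_cmult)
  then show ?case by (simp add: Cons scaleR_conv_of_real field_simps)
qed simp

definition cube :: "nat \<Rightarrow> (int ^ 'd) set"
  where "cube N = {p. \<forall>j. 0 \<le> p $ j \<and> p $ j < int N}"

lemma card_vec_product:
  fixes S :: "'n::finite \<Rightarrow> 'b set"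
  assumes "\<And>j. finite (S j)"
  shows "finite {p :: 'b ^ 'n. \<forall>j. p $ j \<in> S j}" "card {p :: 'b ^ 'n. \<forall>j. p $ j \<in> S j} = (\<Prod>j\<in>UNIV. card (S j))"
proof -
  have bij: "bij_betw vec_nth {p :: 'b ^ 'n. \<forall>j. p $ j \<in> S j} (PiE UNIV S)"
    by (rule bij_betw_byWitness[where f' = vec_lambda]) (auto simp: PiE_def)
  show "card {p :: 'b ^ 'n. \<forall>j. p $ j \<in> S j} = (\<Prod>j\<in>UNIV. card (S j))"
    using bij_betw_same_card[OF bij] card_PiE[of UNIV S] by simp
  show "finite {p :: 'b ^ 'n. \<forall>j. p $ j \<in> S j}"
    using bij_betw_finite[OF bij] finite_PiE[of UNIV S] assms by simp
qed

lemma cube_eq: "cube N = {p :: int ^ 'd. \<forall>j. p $ j \<in> {0..<int N}}"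
  by (auto simp: cube_def)

lemma finite_cube [simp]: "finite (cube N)"
  unfolding cube_eq by (rule card_vec_product) simp

lemma card_cube: "card (cube N :: (int ^ 'd) set) = N ^ CARD('d)"
  unfolding cube_eq by (subst card_vec_product) simp_all

lemma card_cube_face:
  fixes j :: "'d::finite"
  shows "N * card {p \<in> cube N. p $ j = c} \<le> card (cube N :: (int ^ 'd) set)"
proof -
  let ?S = "\<lambda>i. if i = j then {0..<int N} \<inter> {c} else {0..<int N}"
  have "{p \<in> cube N. p $ j = c} = {p :: int ^ 'd. \<forall>i. p $ i \<in> ?S i}"
    by (auto simp: cube_def split: if_splits)
  then have "card {p \<in> cube N. p $ j = c} = (\<Prod>i\<in>UNIV. card (?S i))"
    by (simp add: card_vec_product)
  also have "\<dots> = card ({0..<int N} \<inter> {c}) * (\<Prod>i\<in>UNIV - {j}. N)"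
    by (subst prod.remove[of _ j]) (auto intro!: prod.cong arg_cong2[where f = "(*)"])
  also have "\<dots> \<le> 1 * (\<Prod>i\<in>UNIV - {j}. N)"
    using card_mono[of "{c}" "{0..<int N} \<inter> {c}"] by (intro mult_right_mono) auto
  finally have "N * card {p \<in> cube N. p $ j = c} \<le> N * (\<Prod>i\<in>UNIV - {j}. N)"
    by simp
  also have "\<dots> = (\<Prod>i\<in>(UNIV :: 'd set). N)"
    by (subst (2) prod.remove[of _ j]) auto
  also have "\<dots> = card (cube N :: (int ^ 'd) set)"
    by (simp add: card_cube)
  finally show ?thesis .
qed

text \<open>
  The squared Dirichlet kernel of the cube, normalized to have mean 1 over the torus.
\<close>

definition fejer_kernel :: "nat \<Rightarrow> complex ^ 'd \<Rightarrow> real"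
  where "fejer_kernel N z = (cmod (\<Sum>p\<in>cube N. character z p))\<^sup>2 / card (cube N :: (int ^ 'd) set)"

lemma fejer_kernel_nonneg: "0 \<le> fejer_kernel N z"
  by (simp add: fejer_kernel_def)

lemma fejer_kernel_characters:
  fixes z :: "complex ^ 'd"
  assumes "z \<in> carrier torus"
  shows "complex_of_real (fejer_kernel N z) =
    (\<Sum>(p, q)\<in>cube N \<times> cube N. character z (p - q)) / card (cube N :: (int ^ 'd) set)"
proof -
  have "complex_of_real ((cmod (\<Sum>p\<in>cube N. character z p))\<^sup>2) =
      (\<Sum>p\<in>cube N. character z p) * cnj (\<Sum>q\<in>cube N. character z q)"
    by (rule complex_norm_square)
  also have "\<dots> = (\<Sum>p\<in>cube N. character z p) * (\<Sum>q\<in>cube N. character z (- q))"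
    by (simp add: character_minus[OF assms])
  also have "\<dots> = (\<Sum>(p, q)\<in>cube N \<times> cube N. character z (p - q))"
    using character_add[OF assms, of _ "- q" for q] by (simp add: sum_product sum.cartesian_product)
  finally show ?thesis by (simp add: fejer_kernel_def)
qed

definition haar_seq :: "nat \<Rightarrow> (complex ^ 'd) list"
  where "haar_seq = averaging_sequence (carrier torus)"

lemma haar_seq: 
  "set (haar_seq n) \<subseteq> carrier torus"
  "(\<lambda>n. mean (haar_seq n) (\<lambda>z. character z p)) \<longlonglongrightarrow> (if p = 0 then 1 else 0)"
  unfolding haar_seq_def mean_character
  by (rule averaging_sequence(1)[OF subgroup_carrier_torus],
      rule averaging_sequence(2)[OF subgroup_carrier_torus, unfolded annihilator_torus singleton_iff])

text \<open>
  Expanding the square, the mean of a product of characters counts the pairs of points of the cube that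
  differ by \<open>r\<close>.
\<close>

lemma fejer_coefficient:
  fixes r :: "int ^ 'd"
  shows "(\<lambda>n. mean (haar_seq n) (\<lambda>z. complex_of_real (fejer_kernel N z) * character z r))
    \<longlonglongrightarrow> of_nat (card {(p, q) \<in> cube N \<times> cube N. p - q + r = 0}) / of_nat (card (cube N :: (int ^ 'd) set))"
proof -
  let ?c = "of_nat (card (cube N :: (int ^ 'd) set)) :: complex"
  have "mean (haar_seq n) (\<lambda>z. complex_of_real (fejer_kernel N z) * character z r) =
      (1 / ?c) * (\<Sum>x\<in>cube N \<times> cube N. mean (haar_seq n) (\<lambda>z. character z (fst x - snd x + r)))" for n
    unfolding mean_sum[symmetric] mean_cmult[symmetric]
  proof (rule mean_cong[OF haar_seq(1)])
    fix z :: "complex ^ 'd" assume z: "z \<in> carrier torus"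
    show "complex_of_real (fejer_kernel N z) * character z r =
        1 / ?c * (\<Sum>x\<in>cube N \<times> cube N. character z (fst x - snd x + r))"
      unfolding fejer_kernel_characters[OF z] character_add[OF z]
      by (simp add: case_prod_unfold flip: sum_distrib_right)
  qed
  moreover have "(\<lambda>n. (1 / ?c) * (\<Sum>x\<in>cube N \<times> cube N. mean (haar_seq n) (\<lambda>z. character z (fst x - snd x + r))))
      \<longlonglongrightarrow> (1 / ?c) * (\<Sum>x\<in>cube N \<times> cube N. if fst x - snd x + r = 0 then 1 else 0)"
    by (intro tendsto_intros haar_seq(2))
  moreover have "(\<Sum>x\<in>cube N \<times> cube N. if fst x - snd x + r = 0 then 1 else 0 :: complex) =
      of_nat (card {(p, q) \<in> cube N \<times> cube N. p - q + r = 0})"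
    by (subst sum.inter_filter[symmetric]) (auto simp: case_prod_unfold intro!: arg_cong[where f = card])
  ultimately show ?thesis by simp
qed

lemma card_pairs_shift:
  fixes r :: "int ^ 'd"
  shows "card {(p, q) \<in> cube N \<times> cube N. p - q + r = 0} = card {p \<in> cube N. p + r \<in> cube N}"
proof (rule bij_betw_same_card)
  show "bij_betw fst {(p, q) \<in> cube N \<times> cube N. p - q + r = 0} {p \<in> cube N. p + r \<in> cube N}"
    by (rule bij_betw_byWitness[where f' = "\<lambda>p. (p, p + r)"]) (auto simp: algebra_simps)
qed

lemma fejer_mean: 
  assumes "N > 0"
  shows "(\<lambda>n. mean (haar_seq n) (fejer_kernel N :: complex ^ 'd \<Rightarrow> real)) \<longlonglongrightarrow> 1"
proof -
  show ?thesis
    using tendsto_Re[OF fejer_coefficient[of N "0 :: int ^ 'd"]] assms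
    unfolding card_pairs_shift by (simp add: mean_of_real card_cube)
qed

text \<open>
  As \<open>|1 - z\<^sub>j|\<^sup>2 = 2 - z\<^sub>j - cnj z\<^sub>j\<close>, the limit is 2 minus the proportions of points of the cube that stay in it
  under the two unit translations along the \<open>j\<close>-th axis. A unit translation moves out only one face, which is
  the proportion \<open>1 / N\<close>.
\<close>

lemma fejer_second_moment:
  fixes j :: "'d::finite"
  assumes N: "N > 0"
  shows "\<exists>v\<le>2 / N. (\<lambda>n. mean (haar_seq n) (\<lambda>z :: complex ^ 'd. fejer_kernel N z * (cmod (1 - z $ j))\<^sup>2)) \<longlonglongrightarrow> v"
proof -
  let ?c = "real (card (cube N :: (int ^ 'd) set))"
  let ?e = "axis j 1 :: int ^ 'd"
  define \<gamma> where "\<gamma> r = real (card {p \<in> cube N. p + r \<in> cube N}) / ?c" for r :: "int ^ 'd"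
  have c: "?c > 0" using N by (simp add: card_cube)
  have char: "character z ?e = z $ j" for z :: "complex ^ 'd"
  proof -
    have "character z ?e = (\<Prod>i\<in>UNIV. if i = j then z $ j else 1)"
      unfolding character_def by (intro prod.cong) (auto simp: axis_def)
    then show ?thesis by (simp add: prod.delta)
  qed
  have lim: "(\<lambda>n. mean (haar_seq n) (\<lambda>z. complex_of_real (fejer_kernel N z) * character z r))
      \<longlonglongrightarrow> complex_of_real (\<gamma> r)" for r :: "int ^ 'd"
    using fejer_coefficient[of N r] unfolding card_pairs_shift by (simp add: \<gamma>_def)
  have expand: "complex_of_real (fejer_kernel N z * (cmod (1 - z $ j))\<^sup>2) =
      2 * (complex_of_real (fejer_kernel N z) * character z 0)
      + (- 1) * (complex_of_real (fejer_kernel N z) * character z ?e)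
      + (- 1) * (complex_of_real (fejer_kernel N z) * character z (- ?e))" if z: "z \<in> carrier torus" for z
  proof -
    have zz: "z $ j * cnj (z $ j) = 1"
      using z by (intro unit_mult_cnj) (simp add: in_torus)
    have "complex_of_real ((cmod (1 - z $ j))\<^sup>2) = (1 - z $ j) * cnj (1 - z $ j)"
      by (rule complex_norm_square)
    also have "\<dots> = 2 - z $ j - cnj (z $ j)"
      using zz by (simp add: algebra_simps)
    finally show ?thesis
      unfolding of_real_mult by (simp only: character_minus[OF z] char character_zero) (simp add: algebra_simps)
  qed
  have "complex_of_real (mean (haar_seq n) (\<lambda>z. fejer_kernel N z * (cmod (1 - z $ j))\<^sup>2)) =
      2 * mean (haar_seq n) (\<lambda>z :: complex ^ 'd. complex_of_real (fejer_kernel N z) * character z 0)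
      + (- 1) * mean (haar_seq n) (\<lambda>z. complex_of_real (fejer_kernel N z) * character z ?e)
      + (- 1) * mean (haar_seq n) (\<lambda>z. complex_of_real (fejer_kernel N z) * character z (- ?e))" for n
  proof -
    have "mean (haar_seq n) (\<lambda>z. complex_of_real (fejer_kernel N z * (cmod (1 - z $ j))\<^sup>2)) =
        mean (haar_seq n) (\<lambda>z. 2 * (complex_of_real (fejer_kernel N z) * character z 0)
          + (- 1) * (complex_of_real (fejer_kernel N z) * character z ?e)
          + (- 1) * (complex_of_real (fejer_kernel N z) * character z (- ?e)))"
      by (rule mean_cong[OF haar_seq(1)]) (rule expand)
    then show ?thesis by (simp only: mean_of_real mean_add mean_cmult)
  qed
  then have "(\<lambda>n. complex_of_real (mean (haar_seq n) (\<lambda>z. fejer_kernel N z * (cmod (1 - z $ j))\<^sup>2)))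
      \<longlonglongrightarrow> 2 * complex_of_real (\<gamma> 0) + (- 1) * complex_of_real (\<gamma> ?e) + (- 1) * complex_of_real (\<gamma> (- ?e))"
    by (simp only:) (intro tendsto_intros lim)
  from tendsto_Re[OF this]
  have "(\<lambda>n. mean (haar_seq n) (\<lambda>z :: complex ^ 'd. fejer_kernel N z * (cmod (1 - z $ j))\<^sup>2))
      \<longlonglongrightarrow> 2 * \<gamma> 0 - \<gamma> ?e - \<gamma> (- ?e)"
    by simp
  moreover have "\<gamma> 0 = 1"
    using c by (auto simp: \<gamma>_def)
  moreover have "1 - 1 / N \<le> \<gamma> r"
    if r: "\<And>p. p \<in> cube N \<Longrightarrow> p $ j \<noteq> m \<Longrightarrow> p + r \<in> cube N" for r m
  proof -
    have "cube N \<subseteq> {p \<in> cube N. p + r \<in> cube N} \<union> {p \<in> cube N. p $ j = m}"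
      using r by auto
    then have "card (cube N :: (int ^ 'd) set) \<le> card ({p \<in> cube N. p + r \<in> cube N} \<union> {p \<in> cube N. p $ j = m})"
      by (intro card_mono) auto
    also have "\<dots> \<le> card {p \<in> cube N. p + r \<in> cube N} + card {p \<in> cube N. p $ j = m}"
      by (rule card_Un_le)
    finally have "N * card (cube N :: (int ^ 'd) set) \<le> N * card {p \<in> cube N. p + r \<in> cube N} + card (cube N :: (int ^ 'd) set)"
      using card_cube_face[of N j m] by (smt (verit) add_mono distrib_left dual_order.trans le_refl mult_le_mono2)
    then have "real N * ?c \<le> N * real (card {p \<in> cube N. p + r \<in> cube N}) + ?c"
      by (metis (mono_tags) of_nat_add of_nat_le_iff of_nat_mult)
    then show ?thesis
      using c N by (simp add: \<gamma>_def field_simps)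
  qed
  note \<gamma>_ge = this
  have "1 - 1 / N \<le> \<gamma> ?e"
    by (rule \<gamma>_ge[of "int N - 1"]) (auto simp: cube_def axis_def dest!: spec[of _ j])
  moreover have "1 - 1 / N \<le> \<gamma> (- ?e)"
    by (rule \<gamma>_ge[of 0]) (auto simp: cube_def axis_def dest!: spec[of _ j])
  ultimately show ?thesis
    by (intro exI[of _ "2 * \<gamma> 0 - \<gamma> ?e - \<gamma> (- ?e)"]) simp
qed

section \<open>Length functions on the torus\<close>

locale torus_length =
  fixes len :: "complex ^ 'd \<Rightarrow> real"
  assumes length: "length_function torus len" and continuous: "continuous_on (carrier torus) len"
begin

lemma len_nonneg: "z \<in> carrier torus \<Longrightarrow> 0 \<le> len z"
  and len_eq_0: "z \<in> carrier torus \<Longrightarrow> len z = 0 \<longleftrightarrow> z = 1"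
  and len_mult: "z \<in> carrier torus \<Longrightarrow> w \<in> carrier torus \<Longrightarrow> len (z * w) \<le> len z + len w"
  using length by (auto simp: length_function_def)

lemma len_one [simp]: "len 1 = 0"
  by (simp add: len_eq_0)

lemma len_pos: "z \<in> carrier torus \<Longrightarrow> z \<noteq> 1 \<Longrightarrow> 0 < len z"
  using len_nonneg len_eq_0 by fastforce

lemma len_power: "z \<in> carrier torus \<Longrightarrow> z ^ n \<in> carrier torus \<and> len (z ^ n) \<le> n * len z"
proof (induction n)
  case (Suc n)
  then show ?case using len_mult[of z "z ^ n"] by (auto simp: algebra_simps)
qed simp

lemma compact_torus: "compact (carrier torus :: (complex ^ 'd) set)"
proof -
  have "carrier torus = (\<Inter>j. {z :: complex ^ 'd. cmod (z $ j) = 1})"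
    by (auto simp: in_torus)
  moreover have "closed {z :: complex ^ 'd. cmod (z $ j) = 1}" for j
    by (intro closed_Collect_eq continuous_intros)
  ultimately have "closed (carrier torus :: (complex ^ 'd) set)" by auto
  moreover have "norm z \<le> CARD('d)" if "z \<in> carrier torus" for z :: "complex ^ 'd"
    using L2_set_le_sum[of UNIV "\<lambda>i. cmod (z $ i)"] that by (simp add: in_torus norm_vec_def)
  then have "bounded (carrier torus :: (complex ^ 'd) set)"
    by (auto simp: bounded_iff)
  ultimately show ?thesis by (simp add: compact_eq_bounded_closed)
qed

lemma len_bounded: "\<exists>M>0. \<forall>z\<in>carrier torus. len z \<le> M"
proof -
  have "bounded (len ` carrier torus)"
    by (intro compact_imp_bounded compact_continuous_image continuous compact_torus)
  then obtain M where "\<forall>z\<in>carrier torus. \<bar>len z\<bar> \<le> M" by (auto simp: bounded_iff)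
  then show ?thesis by (intro exI[of _ "max M 1"]) fastforce
qed

text \<open>
  Near 1 the length is at most \<open>e\<close> by continuity; elsewhere it is bounded, and the sum of squares is bounded
  below.
\<close>

lemma len_le_squares:
  assumes "e > 0"
  shows "\<exists>C\<ge>0. \<forall>z\<in>carrier torus. len z \<le> e + C * (\<Sum>j\<in>UNIV. (cmod (1 - z $ j))\<^sup>2)"
proof -
  obtain d where d: "d > 0" "\<And>z. z \<in> carrier torus \<Longrightarrow> dist z 1 < d \<Longrightarrow> dist (len z) (len 1) < e"
    using continuous assms torus_one_closed unfolding continuous_on_iff by metis
  obtain M where M: "M > 0" "\<And>z. z \<in> carrier torus \<Longrightarrow> len z \<le> M"
    using len_bounded by blast
  \<comment> \<open>At distance at least \<open>d\<close> from 1 the sum of squares is at least \<open>d\<^sup>2\<close>.\<close>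
  have "len z \<le> e + M / d\<^sup>2 * (\<Sum>j\<in>UNIV. (cmod (1 - z $ j))\<^sup>2)" if z: "z \<in> carrier torus" for z
  proof (cases "dist z 1 < d")
    case True
    have "0 \<le> M / d\<^sup>2 * (\<Sum>j\<in>UNIV. (cmod (1 - z $ j))\<^sup>2)"
      using M(1) by (intro mult_nonneg_nonneg sum_nonneg) auto
    with d(2)[OF z True] show ?thesis by (simp add: dist_real_def)
  next
    case False
    have "(dist z 1)\<^sup>2 = (\<Sum>j\<in>UNIV. (cmod (1 - z $ j))\<^sup>2)"
      by (simp add: dist_vec_def L2_set_def sum_nonneg dist_norm norm_minus_commute)
    moreover have "d\<^sup>2 \<le> (dist z 1)\<^sup>2"
      using False d(1) by (intro power_mono) auto
    ultimately have "M / d\<^sup>2 * d\<^sup>2 \<le> M / d\<^sup>2 * (\<Sum>j\<in>UNIV. (cmod (1 - z $ j))\<^sup>2)"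
      using M(1) by (intro mult_left_mono) auto
    then show ?thesis
      using M(2)[OF z] d(1) assms by simp
  qed
  then show ?thesis using M(1) by (intro exI[of _ "M / d\<^sup>2"]) auto
qed

text \<open>
  Let \<open>w = z\<^sup>p\<close> satisfy \<open>|1 - w| < 1\<close> and \<open>w \<noteq> 1\<close>. As long as the powers of \<open>w\<close> stay within distance 1 of 1, their real parts are at least
  \<open>1 / 2\<close>, so \<open>|1 - w\<^sup>k| \<ge> k |1 - w| / 2\<close>. Therefore the first power \<open>w\<^sup>n\<close> at distance at least 1 satisfies
  \<open>n |1 - w| \<le> 3\<close>. If \<open>c > 0\<close> bounds the length below on the compact set where the character is at distance at
  least 1 from 1, then \<open>c \<le> len (z\<^sup>n) \<le> n len z\<close>.
\<close>

lemma character_le_len: "\<exists>C\<ge>0. \<forall>z\<in>carrier torus. cmod (1 - character z p) \<le> C * len z"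
proof -
  let ?K = "{z \<in> carrier torus. 1 \<le> cmod (1 - character z p)}"
  have "\<exists>c>0. \<forall>z\<in>?K. c \<le> len z"
  proof (cases "?K = {}")
    case False
    have nonzero: "z $ j \<noteq> 0" if "z \<in> carrier torus" for z :: "complex ^ 'd" and j
      using that by (auto simp: in_torus dest!: spec[of _ j])
    have "continuous_on (carrier torus) (\<lambda>z. cmod (1 - character z p))"
      unfolding character_def by (intro continuous_intros) (auto simp: nonzero)
    from continuous_closed_preimage[OF this compact_imp_closed[OF compact_torus], of "{1..}"]
    have "closed (carrier torus \<inter> (\<lambda>z. cmod (1 - character z p)) -` {1..})" by simp
    moreover have "?K = carrier torus \<inter> (carrier torus \<inter> (\<lambda>z. cmod (1 - character z p)) -` {1..})"
      by auto
    ultimately have "compact ?K"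
      using compact_Int_closed[OF compact_torus] by metis
    moreover have "continuous_on ?K len"
      by (rule continuous_on_subset[OF continuous]) auto
    ultimately obtain w where w: "w \<in> ?K" "\<forall>z\<in>?K. len w \<le> len z"
      using continuous_attains_inf[of ?K len] False by blast
    have "w \<noteq> 1" using w(1) by auto
    then show ?thesis using w len_pos[of w] by blast
  qed (auto intro: exI[of _ 1])
  then obtain c where c: "c > 0" "\<And>z. z \<in> carrier torus \<Longrightarrow> 1 \<le> cmod (1 - character z p) \<Longrightarrow> c \<le> len z"
    by blast
  \<comment> \<open>The constant 3 also covers the points at distance at least 1, where the left side is at most 2.\<close>
  have "cmod (1 - character z p) \<le> 3 / c * len z" if z: "z \<in> carrier torus" for z
  proof (cases "1 \<le> cmod (1 - character z p) \<or> character z p = 1")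
    case True
    have "cmod (1 - character z p) \<le> 2"
      using norm_triangle_ineq4[of 1 "character z p"] z by simp
    moreover have "2 \<le> 3 / c * len z" if "character z p \<noteq> 1"
      using c(2)[OF z] True that c(1) by (simp add: field_simps)
    ultimately show ?thesis using len_nonneg[OF z] c(1) by fastforce
  next
    case False
    define w where "w = character z p"
    have w: "cmod (1 - w) < 1" "w \<noteq> 1" using False by (auto simp: w_def)
    have small: "real n * cmod (1 - w) < 2" if "\<forall>k\<le>n. cmod (1 - w ^ k) < 1" for n
    proof -
      have "real n / 2 \<le> Re (\<Sum>k<n. w ^ k)"
      proof -
        have "1 / 2 \<le> Re (w ^ k)" if "k < n" for k
        proof -
          have "cmod w = 1" using z by (simp add: w_def)
          then have "(Re (w ^ k))\<^sup>2 + (Im (w ^ k))\<^sup>2 = 1"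
            using cmod_power2[of "w ^ k"] by (simp add: norm_power)
          moreover have "(1 - Re (w ^ k))\<^sup>2 + (Im (w ^ k))\<^sup>2 < 1"
            using \<open>\<forall>k\<le>n. cmod (1 - w ^ k) < 1\<close>[rule_format, of k] that cmod_power2[of "1 - w ^ k"]
              power_strict_mono[of "cmod (1 - w ^ k)" 1 2] by (simp add: power2_commute)
          ultimately show ?thesis by (simp add: power2_eq_square algebra_simps)
        qed
        then have "(\<Sum>k<n. 1 / 2) \<le> (\<Sum>k<n. Re (w ^ k))"
          by (intro sum_mono) auto
        then show ?thesis by simp
      qed
      also have "\<dots> \<le> cmod (\<Sum>k<n. w ^ k)"
        by (rule complex_Re_le_cmod)
      finally have "real n / 2 * cmod (1 - w) \<le> cmod (\<Sum>k<n. w ^ k) * cmod (1 - w)"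
        by (intro mult_right_mono) auto
      also have "\<dots> = cmod (1 - w ^ n)"
        by (simp add: one_diff_power_eq norm_mult mult.commute)
      also have "\<dots> < 1" using that by simp
      finally show ?thesis by simp
    qed
    have "\<exists>n. 1 \<le> cmod (1 - w ^ n)"
    proof (rule ccontr)
      assume "\<nexists>n. 1 \<le> cmod (1 - w ^ n)"
      then have "real n * cmod (1 - w) < 2" for n
        by (intro small) (auto simp: not_le)
      moreover obtain n where "2 < real n * cmod (1 - w)"
        using ex_less_of_nat_mult[of "cmod (1 - w)" 2] w by auto
      ultimately show False by (smt (verit))
    qed
    then obtain n where n: "1 \<le> cmod (1 - w ^ n)" "\<forall>k<n. \<not> 1 \<le> cmod (1 - w ^ k)"
      using exists_least_iff[of "\<lambda>n. 1 \<le> cmod (1 - w ^ n)"] by blast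
    have "n \<noteq> 0"
    proof
      assume "n = 0" then show False using n(1) by simp
    qed
    then have "k < n" if "k \<le> n - 1" for k
      using that by linarith
    then have "real (n - 1) * cmod (1 - w) < 2"
      using n(2) by (intro small) (simp add: not_le)
    then have n_le: "real n * cmod (1 - w) \<le> 3"
      using w \<open>n \<noteq> 0\<close> by (simp add: of_nat_diff algebra_simps)
    have "character (z ^ n) p = w ^ n"
      by (induction n) (simp_all add: w_def character_mult)
    then have "c \<le> n * len z"
      using c(2)[of "z ^ n"] len_power[OF z, of n] n(1) by simp
    then have "c * cmod (1 - w) \<le> n * len z * cmod (1 - w)"
      by (intro mult_right_mono) auto
    also have "\<dots> \<le> 3 * len z"
      using mult_right_mono[OF n_le len_nonneg[OF z]] by (simp add: mult_ac)
    finally show ?thesis using c(1) by (simp add: w_def field_simps)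
  qed
  then show ?thesis using c(1) by (intro exI[of _ "3 / c"]) auto
qed

end

section \<open>Lipschitz elements\<close>

locale quantum_torus_length = quantum_torus A \<sigma> U + torus_length len
  for A :: "'a cstar" (structure) and \<sigma> :: "int ^ 'd \<Rightarrow> int ^ 'd \<Rightarrow> complex"
    and U :: "int ^ 'd \<Rightarrow> 'a" and len :: "complex ^ 'd \<Rightarrow> real"
begin

abbreviation L where "L \<equiv> lip_seminorm A U len"

text \<open>
  The inequality \<open>L a \<le> r\<close> in a form without a quotient, hence without an exception at the unit of the torus.
\<close>

definition lip :: "real \<Rightarrow> 'a \<Rightarrow> bool"
  where "lip r a \<longleftrightarrow> (\<forall>z\<in>carrier torus. cnorm A (a \<ominus> \<alpha> z a) \<le> r * len z)"

lemma L_le_iff: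
  assumes a: "a \<in> carrier A" and r: "r \<ge> 0"
  shows "L a \<le> ennreal r \<longleftrightarrow> lip r a"
proof -
  have "cnorm A (a \<ominus> \<alpha> 1 a) \<le> r * len 1"
    using a by (simp add: dual_action_torus_one)
  moreover have "cnorm A (a \<ominus> \<alpha> z a) / len z \<le> r \<longleftrightarrow> cnorm A (a \<ominus> \<alpha> z a) \<le> r * len z"
    if "z \<in> carrier torus" "z \<noteq> 1" for z
    using len_pos[OF that] by (simp add: pos_divide_le_eq)
  ultimately show ?thesis
    using r unfolding lip_seminorm_def SUP_le_iff lip_def by (auto simp: ennreal_le_iff)
qed

lemma L_finite_iff:
  assumes a: "a \<in> carrier A" shows "L a < \<infinity> \<longleftrightarrow> (\<exists>r\<ge>0. lip r a)"
proof
  assume "L a < \<infinity>"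
  then have "L a \<le> ennreal (enn2real (L a))" by (simp add: less_top)
  then show "\<exists>r\<ge>0. lip r a" using L_le_iff[OF a] enn2real_nonneg by blast
next
  assume "\<exists>r\<ge>0. lip r a"
  then show "L a < \<infinity>" using L_le_iff[OF a] by (metis ennreal_less_top infinity_ennreal_def le_less_trans)
qed

lemma lip_L:
  assumes a: "a \<in> carrier A" and fin: "L a < \<infinity>" shows "lip (enn2real (L a)) a"
  using fin by (simp add: less_top flip: L_le_iff[OF a enn2real_nonneg])

lemma lip_mono: "lip r a \<Longrightarrow> r \<le> s \<Longrightarrow> lip s a"
  unfolding lip_def using len_nonneg by (meson mult_right_mono order_trans)

lemma lip_zero: "lip 0 \<zero>"
  by (simp add: lip_def dual_action_zero)

lemma lip_add:
  assumes "lip r a" "lip s b" "a \<in> carrier A" "b \<in> carrier A" shows "lip (r + s) (a \<oplus> b)"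
  unfolding lip_def
proof
  fix z :: "complex ^ 'd" assume z: "z \<in> carrier torus"
  have "cnorm A ((a \<oplus> b) \<ominus> \<alpha> z (a \<oplus> b)) \<le> cnorm A (a \<ominus> \<alpha> z a) + cnorm A (b \<ominus> \<alpha> z b)"
    using z assms(3,4) by (simp add: dual_action_add norm_add_diff_add)
  also have "\<dots> \<le> (r + s) * len z"
    using assms(1,2) z unfolding lip_def distrib_right by (intro add_mono) blast+
  finally show "cnorm A ((a \<oplus> b) \<ominus> \<alpha> z (a \<oplus> b)) \<le> (r + s) * len z" .
qed

lemma lip_scale:
  assumes "lip r a" "a \<in> carrier A" shows "lip (cmod c * r) (c \<odot> a)"
  unfolding lip_def
proof
  fix z :: "complex ^ 'd" assume z: "z \<in> carrier torus"
  have "cnorm A (c \<odot> a \<ominus> \<alpha> z (c \<odot> a)) = cmod c * cnorm A (a \<ominus> \<alpha> z a)"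
    using z assms(2) by (simp add: dual_action_scale cnorm_smult flip: scale_diff)
  also have "\<dots> \<le> cmod c * (r * len z)"
    using assms(1) z by (intro mult_left_mono) (auto simp: lip_def)
  finally show "cnorm A (c \<odot> a \<ominus> \<alpha> z (c \<odot> a)) \<le> cmod c * r * len z" by simp
qed

lemma lip_diff:
  assumes "lip r a" "lip s b" "a \<in> carrier A" "b \<in> carrier A" shows "lip (r + s) (a \<ominus> b)"
  using lip_add[OF assms(1) lip_scale[OF assms(2,4), of "- 1"]] assms(3,4) by (simp add: minus_conv)

lemma lip_mult:
  assumes "lip r a" "lip s b" "a \<in> carrier A" "b \<in> carrier A"
  shows "lip (cnorm A a * s + cnorm A b * r) (a \<otimes> b)"
  unfolding lip_def
proof
  fix z :: "complex ^ 'd" assume z: "z \<in> carrier torus"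
  have "cnorm A (a \<otimes> b \<ominus> \<alpha> z (a \<otimes> b))
      \<le> cnorm A a * cnorm A (b \<ominus> \<alpha> z b) + cnorm A (a \<ominus> \<alpha> z a) * cnorm A b"
    using norm_mult_diff_mult[of a b "\<alpha> z a" "\<alpha> z b"] z assms(3,4) by (simp add: dual_action_mult)
  also have "\<dots> \<le> cnorm A a * (s * len z) + (r * len z) * cnorm A b"
    using assms z by (intro add_mono mult_left_mono mult_right_mono) (auto simp: lip_def)
  finally show "cnorm A (a \<otimes> b \<ominus> \<alpha> z (a \<otimes> b)) \<le> (cnorm A a * s + cnorm A b * r) * len z"
    by (simp add: algebra_simps)
qed

lemma lip_expectation:
  assumes G: "subgroup G torus" and "lip r a" "a \<in> carrier A" shows "lip r (expectation G a)"
  unfolding lip_def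
proof
  fix z :: "complex ^ 'd" assume z: "z \<in> carrier torus"
  have "cnorm A (expectation G a \<ominus> \<alpha> z (expectation G a)) = cnorm A (expectation G (a \<ominus> \<alpha> z a))"
    using z assms(3) by (simp add: expectation_diff expectation_dual_action G)
  also have "\<dots> \<le> cnorm A (a \<ominus> \<alpha> z a)"
    using z assms(3) by (intro expectation_norm_le G) simp
  finally show "cnorm A (expectation G a \<ominus> \<alpha> z (expectation G a)) \<le> r * len z"
    using assms(2) z unfolding lip_def by fastforce
qed

lemma lip_conv:
  assumes "\<And>n. lip r (X n)" "conv X x" shows "lip r x"
  unfolding lip_def
proof
  fix z :: "complex ^ 'd" assume z: "z \<in> carrier torus"
  show "cnorm A (x \<ominus> \<alpha> z x) \<le> r * len z"
    by (rule conv_norm_le[OF conv_diff[OF assms(2) dual_action_conv[OF z assms(2)]]])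
      (use assms(1) z in \<open>auto simp: lip_def\<close>)
qed

lemma lip_polynomials: "a \<in> polynomials \<Longrightarrow> \<exists>r\<ge>0. lip r a"
proof (induction rule: polynomials.induct)
  case (polynomials_term a c p)
  then obtain r where r: "r \<ge> 0" "lip r a" by blast
  obtain C where C: "C \<ge> 0" "\<And>z. z \<in> carrier torus \<Longrightarrow> cmod (1 - character z p) \<le> C * len z"
    using character_le_len by blast
  have "cnorm A (U p \<ominus> \<alpha> z (U p)) \<le> C * len z" if z: "z \<in> carrier torus" for z
  proof -
    have "U p \<ominus> \<alpha> z (U p) = (1 - character z p) \<odot> U p"
      using scale_add_left[of "U p" 1 "- character z p"] by (simp add: dual_action_U z minus_conv)
    then show ?thesis using C(2)[OF z] by (simp add: cnorm_smult)
  qed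
  then have "lip C (U p)" by (simp add: lip_def)
  from lip_add[OF lip_scale[OF this, of c] r(2)] polynomials_term(1)
  have "lip (cmod c * C + r) (c \<odot> U p \<oplus> a)" by (simp add: polynomials_closed)
  then show ?case using C(1) r(1) by (intro exI[of _ "cmod c * C + r"]) simp
qed (use lip_zero in blast)

lemma lip_scalar: "lip 0 (c \<odot> \<one>)"
  by (simp add: lip_def dual_action_scale dual_action_one)

text \<open>
  The trace of \<open>a\<close> is the average of \<open>a\<close> over the torus, on which the length is bounded.
\<close>

lemma displacement_bound:
  "\<exists>D>0. \<forall>a\<in>carrier A. \<forall>r\<ge>0. lip r a \<longrightarrow> cnorm A (a \<ominus> \<tau> a \<odot> \<one>) \<le> r * D"
proof -
  obtain M where M: "M > 0" "\<And>z. z \<in> carrier torus \<Longrightarrow> len z \<le> M"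
    using len_bounded by blast
  have "cnorm A (a \<ominus> \<tau> a \<odot> \<one>) \<le> r * M"
    if "a \<in> carrier A" "r \<ge> 0" "lip r a" for a r
    unfolding expectation_torus[OF that(1), symmetric]
    by (rule expectation_displacement[OF subgroup_carrier_torus that(1)])
      (use that M(2) in \<open>auto simp: lip_def intro: order_trans[OF _ mult_left_mono]\<close>)
  then show ?thesis using M(1) by blast
qed

section \<open>Approximation of functionals by Fourier coefficients\<close>

text \<open>
  The value of \<open>\<Phi>\<close> at the convolution of \<open>a\<close> with the Fejer kernel. It depends on \<open>\<Phi>\<close> only through
  finitely many values.
\<close>

definition fejer_functional :: "nat \<Rightarrow> ('a \<Rightarrow> complex) \<Rightarrow> 'a \<Rightarrow> complex"
  where "fejer_functional N \<Phi> a = (\<Sum>(p, q)\<in>cube N \<times> cube N.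
    \<tau> (U (p - q) \<otimes> a) * \<Phi> (star A (U (p - q)))) / of_nat (card (cube N :: (int ^ 'd) set))"

lemma mean_dual_action:
  assumes "contractive_functional A \<Phi>" "a \<in> carrier A" "set gs \<subseteq> carrier torus"
  shows "mean gs (\<lambda>z. \<Phi> (\<alpha> z a)) = \<Phi> (avg gs a)"
  using assms
proof (induction gs arbitrary: \<Phi>)
  case Nil
  then show ?case by (simp add: dual_action_torus_one)
next
  case (Cons g gs)
  have g: "g \<in> carrier torus" using Cons by simp
  note \<Phi> = contractive_functionalD[OF Cons.prems(1)]
  have "contractive_functional A (\<lambda>a. \<Phi> (\<alpha> g a))"
    unfolding contractive_functional_def
    using \<Phi> \<Phi>(3)[OF dual_action_closed[OF g]] by (simp add: dual_action_add dual_action_scale g)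
  then have "mean gs (\<lambda>z. \<Phi> (\<alpha> g (\<alpha> z a))) = \<Phi> (\<alpha> g (avg gs a))"
    using Cons.prems by (intro Cons.IH) auto
  moreover have "mean gs (\<lambda>z. \<Phi> (\<alpha> (z * g) a)) = mean gs (\<lambda>z. \<Phi> (\<alpha> g (\<alpha> z a)))"
    using Cons.prems g by (intro mean_cong) (simp_all add: mult.commute[of _ g] dual_action_torus_mult)
  moreover have "mean gs (\<lambda>z. \<Phi> (\<alpha> z a)) = \<Phi> (avg gs a)"
    using Cons by simp
  ultimately show ?case
    using Cons.prems g by (simp add: \<Phi> scaleR_conv_of_real)
qed

text \<open>
  Since \<open>z\<^sup>r \<alpha> z a = U r* \<alpha> z (U r a)\<close>, the means are values of the functional \<open>\<Phi> (U r* \<cdot>)\<close> at averages of \<open>U r a\<close> over the torus.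
\<close>

lemma mean_fourier_coefficient:
  assumes \<Phi>: "contractive_functional A \<Phi>" and a: "a \<in> carrier A"
  shows "(\<lambda>n. mean (haar_seq n) (\<lambda>z. character z r * \<Phi> (\<alpha> z a)))
    \<longlonglongrightarrow> \<tau> (U r \<otimes> a) * \<Phi> (star A (U r))"
proof -
  let ?\<Psi> = "\<lambda>y. \<Phi> (star A (U r) \<otimes> y)"
  note \<Phi>' = contractive_functionalD[OF \<Phi>]
  have "cmod (?\<Psi> y) \<le> cnorm A y" if "y \<in> carrier A" for y
    using \<Phi>'(3)[of "star A (U r) \<otimes> y"] cnorm_mult[of "star A (U r)" y] that by simp
  then have \<Psi>: "contractive_functional A ?\<Psi>"
    by (simp add: contractive_functional_def r_distr smult_mult_right \<Phi>')
  have Ua: "U r \<otimes> a \<in> carrier A" using a by simp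
  have "character z r * \<Phi> (\<alpha> z a) = ?\<Psi> (\<alpha> z (U r \<otimes> a))" if z: "z \<in> carrier torus" for z
  proof -
    have "star A (U r) \<otimes> \<alpha> z (U r \<otimes> a) = character z r \<odot> ((star A (U r) \<otimes> U r) \<otimes> \<alpha> z a)"
      using z a by (simp add: dual_action_mult dual_action_U smult_mult_left smult_mult_right m_assoc)
    then show ?thesis
      using z a by (simp add: U_unitary \<Phi>')
  qed
  then have "mean (haar_seq n) (\<lambda>z. character z r * \<Phi> (\<alpha> z a)) =
      mean (haar_seq n) (\<lambda>z. ?\<Psi> (\<alpha> z (U r \<otimes> a)))" for n
    by (rule mean_cong[OF haar_seq(1)])
  also have "mean (haar_seq n) (\<lambda>z. ?\<Psi> (\<alpha> z (U r \<otimes> a))) = ?\<Psi> (avg (haar_seq n) (U r \<otimes> a))" for n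
    by (rule mean_dual_action[OF \<Psi> Ua haar_seq(1)])
  finally have "(\<lambda>n. mean (haar_seq n) (\<lambda>z. character z r * \<Phi> (\<alpha> z a)))
      = (\<lambda>n. ?\<Psi> (avg (haar_seq n) (U r \<otimes> a)))" by blast
  moreover have "(\<lambda>n. ?\<Psi> (avg (haar_seq n) (U r \<otimes> a))) \<longlonglongrightarrow> ?\<Psi> (expectation (carrier torus) (U r \<otimes> a))"
    unfolding haar_seq_def
    by (intro functional_conv[OF \<Psi>] expectation_conv[OF subgroup_carrier_torus] Ua)
  moreover have "?\<Psi> (expectation (carrier torus) (U r \<otimes> a)) = \<tau> (U r \<otimes> a) * \<Phi> (star A (U r))"
    by (simp add: expectation_torus[OF Ua] smult_mult_right \<Phi>')
  ultimately show ?thesis by simp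
qed

lemma fejer_functional_limit:
  assumes \<Phi>: "contractive_functional A \<Phi>" and a: "a \<in> carrier A"
  shows "(\<lambda>n. mean (haar_seq n) (\<lambda>z. complex_of_real (fejer_kernel N z) * \<Phi> (\<alpha> z a)))
    \<longlonglongrightarrow> fejer_functional N \<Phi> a"
proof -
  let ?c = "of_nat (card (cube N :: (int ^ 'd) set)) :: complex"
  have "mean (haar_seq n) (\<lambda>z. complex_of_real (fejer_kernel N z) * \<Phi> (\<alpha> z a)) =
      (1 / ?c) * (\<Sum>x\<in>cube N \<times> cube N. mean (haar_seq n) (\<lambda>z. character z (fst x - snd x) * \<Phi> (\<alpha> z a)))" for n
    unfolding mean_sum[symmetric] mean_cmult[symmetric]
  proof (rule mean_cong[OF haar_seq(1)])
    fix z :: "complex ^ 'd" assume z: "z \<in> carrier torus"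
    show "complex_of_real (fejer_kernel N z) * \<Phi> (\<alpha> z a) =
        1 / ?c * (\<Sum>x\<in>cube N \<times> cube N. character z (fst x - snd x) * \<Phi> (\<alpha> z a))"
      unfolding fejer_kernel_characters[OF z] by (simp add: case_prod_unfold flip: sum_distrib_right)
  qed
  moreover have "(\<lambda>n. (1 / ?c) * (\<Sum>x\<in>cube N \<times> cube N. mean (haar_seq n) (\<lambda>z. character z (fst x - snd x) * \<Phi> (\<alpha> z a))))
      \<longlonglongrightarrow> (1 / ?c) * (\<Sum>x\<in>cube N \<times> cube N.
        \<tau> (U (fst x - snd x) \<otimes> a) * \<Phi> (star A (U (fst x - snd x))))"
    by (intro tendsto_intros mean_fourier_coefficient assms)
  ultimately show ?thesis
    by (simp add: fejer_functional_def case_prod_unfold)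
qed

text \<open>
  For a Lipschitz element the error is at most the mean of the kernel times the length. The bound of the
  length by \<open>e / 2 + C \<Sum>\<^sub>j |1 - z\<^sub>j|\<^sup>2\<close> reduces this to the second moments of the kernel.
\<close>

lemma fejer_approximation:
  assumes "e > 0"
  shows "\<exists>N>0. \<forall>\<Phi> a. contractive_functional A \<Phi> \<and> a \<in> carrier A \<and> lip 1 a \<longrightarrow>
    cmod (\<Phi> a - fejer_functional N \<Phi> a) \<le> e"
proof -
  obtain C where C: "C \<ge> 0" "\<And>z. z \<in> carrier torus \<Longrightarrow> len z \<le> e / 2 + C * (\<Sum>j\<in>UNIV. (cmod (1 - z $ j))\<^sup>2)"
    using len_le_squares[of "e / 2"] assms by auto
  obtain N where N: "real N > C * CARD('d) * 4 / e"
    using reals_Archimedean2 by blast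
  moreover have "0 \<le> C * CARD('d) * 4 / e"
    using C(1) assms by simp
  ultimately have "N > 0" by (intro gr0I) simp
  have "\<forall>j. \<exists>v\<le>2 / N. (\<lambda>n. mean (haar_seq n) (\<lambda>z :: complex ^ 'd. fejer_kernel N z * (cmod (1 - z $ j))\<^sup>2)) \<longlonglongrightarrow> v"
    using fejer_second_moment[OF \<open>N > 0\<close>] by blast
  from choice[OF this] obtain v where v: "\<And>j. v j \<le> 2 / N"
    "\<And>j. (\<lambda>n. mean (haar_seq n) (\<lambda>z :: complex ^ 'd. fejer_kernel N z * (cmod (1 - z $ j))\<^sup>2)) \<longlonglongrightarrow> v j"
    by blast
  have "cmod (\<Phi> a - fejer_functional N \<Phi> a) \<le> e"
    if \<Phi>: "contractive_functional A \<Phi>" and a: "a \<in> carrier A" and lip: "lip 1 a" for \<Phi> a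
  proof -
    let ?F = "fejer_kernel N :: complex ^ 'd \<Rightarrow> real"
    let ?m = "\<lambda>n. mean (haar_seq n) :: (complex ^ 'd \<Rightarrow> real) \<Rightarrow> real"
    have le: "cmod (complex_of_real (?m n ?F) * \<Phi> a - mean (haar_seq n) (\<lambda>z. complex_of_real (?F z) * \<Phi> (\<alpha> z a)))
        \<le> e / 2 * ?m n ?F + C * (\<Sum>j\<in>UNIV. ?m n (\<lambda>z. ?F z * (cmod (1 - z $ j))\<^sup>2))" for n
    proof -
      have "complex_of_real (?m n ?F) * \<Phi> a = mean (haar_seq n) (\<lambda>z. \<Phi> a * complex_of_real (?F z))"
        by (simp only: mean_cmult mean_of_real mult.commute)
      moreover have "mean (haar_seq n) (\<lambda>z. \<Phi> a * complex_of_real (?F z)) =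
          mean (haar_seq n) (\<lambda>z. (complex_of_real (?F z) * (\<Phi> a - \<Phi> (\<alpha> z a))) + complex_of_real (?F z) * \<Phi> (\<alpha> z a))"
        by (rule mean_cong[OF haar_seq(1)]) (simp add: algebra_simps)
      ultimately have "cmod (complex_of_real (?m n ?F) * \<Phi> a - mean (haar_seq n) (\<lambda>z. complex_of_real (?F z) * \<Phi> (\<alpha> z a)))
          = cmod (mean (haar_seq n) (\<lambda>z. complex_of_real (?F z) * (\<Phi> a - \<Phi> (\<alpha> z a))))"
        by (simp add: mean_add)
      also have "\<dots> \<le> ?m n (\<lambda>z. cmod (complex_of_real (?F z) * (\<Phi> a - \<Phi> (\<alpha> z a))))"
        by (rule norm_mean_le)
      also have "\<dots> \<le> ?m n (\<lambda>z. e / 2 * ?F z + C * (\<Sum>j\<in>UNIV. ?F z * (cmod (1 - z $ j))\<^sup>2))"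
      proof (rule mean_mono[OF haar_seq(1)])
        fix z :: "complex ^ 'd" assume z: "z \<in> carrier torus"
        have "cmod (\<Phi> a - \<Phi> (\<alpha> z a)) \<le> len z"
          using contractive_functionalD(3)[OF \<Phi>, of "a \<ominus> \<alpha> z a"] functional_diff[OF \<Phi>, of a "\<alpha> z a"] lip z a
          unfolding lip_def by fastforce
        also have "\<dots> \<le> e / 2 + C * (\<Sum>j\<in>UNIV. (cmod (1 - z $ j))\<^sup>2)"
          by (rule C(2)[OF z])
        finally have "?F z * cmod (\<Phi> a - \<Phi> (\<alpha> z a)) \<le> ?F z * (e / 2 + C * (\<Sum>j\<in>UNIV. (cmod (1 - z $ j))\<^sup>2))"
          by (intro mult_left_mono fejer_kernel_nonneg)
        then show "cmod (complex_of_real (?F z) * (\<Phi> a - \<Phi> (\<alpha> z a)))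
            \<le> e / 2 * ?F z + C * (\<Sum>j\<in>UNIV. ?F z * (cmod (1 - z $ j))\<^sup>2)"
          by (simp add: norm_mult fejer_kernel_nonneg distrib_left mult_ac flip: sum_distrib_left)
      qed
      also have "\<dots> = e / 2 * ?m n ?F + C * (\<Sum>j\<in>UNIV. ?m n (\<lambda>z. ?F z * (cmod (1 - z $ j))\<^sup>2))"
        by (simp only: mean_add mean_cmult mean_sum)
      finally show ?thesis .
    qed
    have "cmod (complex_of_real 1 * \<Phi> a - fejer_functional N \<Phi> a) \<le> e / 2 * 1 + C * (\<Sum>j\<in>UNIV. v j)"
    proof (rule LIMSEQ_le)
      show "(\<lambda>n. cmod (complex_of_real (?m n ?F) * \<Phi> a - mean (haar_seq n) (\<lambda>z. complex_of_real (?F z) * \<Phi> (\<alpha> z a))))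
          \<longlonglongrightarrow> cmod (complex_of_real 1 * \<Phi> a - fejer_functional N \<Phi> a)"
        by (intro tendsto_intros fejer_mean[OF \<open>N > 0\<close>] fejer_functional_limit[OF \<Phi> a])
      show "(\<lambda>n. e / 2 * ?m n ?F + C * (\<Sum>j\<in>UNIV. ?m n (\<lambda>z. ?F z * (cmod (1 - z $ j))\<^sup>2)))
          \<longlonglongrightarrow> e / 2 * 1 + C * (\<Sum>j\<in>UNIV. v j)"
        by (intro tendsto_intros fejer_mean[OF \<open>N > 0\<close>] v(2))
    qed (use le in blast)
    also have "C * (\<Sum>j\<in>UNIV. v j) \<le> C * (CARD('d) * (2 / N))"
      using sum_mono[of UNIV v "\<lambda>_. 2 / N"] v(1) C(1) by (intro mult_left_mono) auto
    also have "\<dots> \<le> e / 2"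
      using N \<open>N > 0\<close> assms by (simp add: field_simps)
    finally show ?thesis by simp
  qed
  then show ?thesis using \<open>N > 0\<close> by blast
qed

text \<open>
  Both functionals are replaced by their Fejer approximations. Subtracting from \<open>a\<close> its trace changes neither the
  difference of the functionals nor the Lipschitz condition, but it bounds \<open>a\<close> in norm, and with it
  the coefficients \<open>\<tau> (U r a)\<close>.
\<close>

lemma functional_difference_bound:
  assumes "e > 0"
  shows "\<exists>S B. finite S \<and> B \<ge> 0 \<and> (\<forall>\<Phi> \<Psi> a. contractive_functional A \<Phi> \<and> contractive_functional A \<Psi> \<and>
    \<Phi> \<one> = 1 \<and> \<Psi> \<one> = 1 \<and> a \<in> carrier A \<and> lip 1 a \<longrightarrow>
    cmod (\<Phi> a - \<Psi> a) \<le> e + B * (\<Sum>r\<in>S. cmod (\<Phi> (star A (U r)) - \<Psi> (star A (U r)))))"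
proof -
  obtain D where D: "D > 0" "\<And>a. a \<in> carrier A \<Longrightarrow> lip 1 a \<Longrightarrow> cnorm A (a \<ominus> \<tau> a \<odot> \<one>) \<le> D"
    using displacement_bound by (metis mult_1 zero_le_one)
  obtain N where N: "N > 0" "\<And>\<Phi> a. contractive_functional A \<Phi> \<Longrightarrow> a \<in> carrier A \<Longrightarrow> lip 1 a \<Longrightarrow>
      cmod (\<Phi> a - fejer_functional N \<Phi> a) \<le> e / 2"
    using fejer_approximation[of "e / 2"] assms by auto
  let ?c = "real (card (cube N :: (int ^ 'd) set))"
  define S where "S = (\<lambda>(p, q). p - q) ` (cube N \<times> cube N :: ((int ^ 'd) \<times> (int ^ 'd)) set)"
  define B where "B = D * real (card (cube N \<times> cube N :: ((int ^ 'd) \<times> (int ^ 'd)) set)) / ?c"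
  have "cmod (\<Phi> a - \<Psi> a) \<le> e + B * (\<Sum>r\<in>S. cmod (\<Phi> (star A (U r)) - \<Psi> (star A (U r))))"
    if \<Phi>: "contractive_functional A \<Phi>" and \<Psi>: "contractive_functional A \<Psi>"
      and one: "\<Phi> \<one> = 1" "\<Psi> \<one> = 1" and a: "a \<in> carrier A" and lip: "lip 1 a" for \<Phi> \<Psi> a
  proof -
    define b where "b = a \<ominus> \<tau> a \<odot> \<one>"
    have b: "b \<in> carrier A" "lip 1 b" "cnorm A b \<le> D"
      using a lip_diff[OF lip lip_scalar[of "\<tau> a"]] D(2)[OF a lip] by (simp_all add: b_def)
    have eq: "\<Phi> a - \<Psi> a = \<Phi> b - \<Psi> b"
      using a one by (simp add: b_def functional_diff[OF \<Phi>] functional_diff[OF \<Psi>]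
        contractive_functionalD(2)[OF \<Phi>] contractive_functionalD(2)[OF \<Psi>])
    let ?d = "\<lambda>r. cmod (\<Phi> (star A (U r)) - \<Psi> (star A (U r)))"
    have tr: "cmod (\<tau> (U r \<otimes> b)) \<le> D" for r
      using norm_tau_le[of "U r \<otimes> b"] cnorm_mult[of "U r" b] b by simp
    have "fejer_functional N \<Phi> b - fejer_functional N \<Psi> b = (\<Sum>(p, q)\<in>cube N \<times> cube N.
        \<tau> (U (p - q) \<otimes> b) * (\<Phi> (star A (U (p - q))) - \<Psi> (star A (U (p - q))))) / of_nat (card (cube N :: (int ^ 'd) set))"
      by (simp add: fejer_functional_def case_prod_unfold right_diff_distrib sum_subtractf diff_divide_distrib)
    also have "cmod \<dots> \<le> (\<Sum>(p, q)\<in>cube N \<times> cube N.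
        cmod (\<tau> (U (p - q) \<otimes> b)) * ?d (p - q)) / ?c"
      by (simp add: norm_divide case_prod_unfold divide_right_mono order_trans[OF norm_sum] norm_mult)
    also have "\<dots> \<le> (\<Sum>(p, q)\<in>(cube N \<times> cube N :: ((int ^ 'd) \<times> (int ^ 'd)) set). D * (\<Sum>r\<in>S. ?d r)) / ?c"
    proof -
      have "?d (p - q) \<le> (\<Sum>r\<in>S. ?d r)" if "p \<in> cube N" "q \<in> cube N" for p q
        using that by (intro member_le_sum) (auto simp: S_def)
      then have le: "cmod (\<tau> (U (p - q) \<otimes> b)) * ?d (p - q) \<le> D * (\<Sum>r\<in>S. ?d r)"
        if "p \<in> cube N" "q \<in> cube N" for p q
        using that tr D(1) by (intro mult_mono) auto
      show ?thesis
        by (rule divide_right_mono, rule sum_mono) (use le in \<open>auto simp del: sum_constant\<close>)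
    qed
    also have "\<dots> = B * (\<Sum>r\<in>S. ?d r)"
      by (simp add: B_def case_prod_unfold)
    finally have "cmod (fejer_functional N \<Phi> b - fejer_functional N \<Psi> b) \<le> B * (\<Sum>r\<in>S. ?d r)" .
    moreover have "cmod (\<Phi> b - \<Psi> b) \<le> cmod (\<Phi> b - fejer_functional N \<Phi> b)
        + cmod (\<Psi> b - fejer_functional N \<Psi> b) + cmod (fejer_functional N \<Phi> b - fejer_functional N \<Psi> b)"
      using norm_triangle_ineq[of "(\<Phi> b - fejer_functional N \<Phi> b) - (\<Psi> b - fejer_functional N \<Psi> b)"
          "fejer_functional N \<Phi> b - fejer_functional N \<Psi> b"]
        norm_triangle_ineq4[of "\<Phi> b - fejer_functional N \<Phi> b" "\<Psi> b - fejer_functional N \<Psi> b"]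
      by simp
    ultimately show ?thesis
      using N(2)[OF \<Phi> b(1,2)] N(2)[OF \<Psi> b(1,2)] unfolding eq by linarith
  qed
  moreover have "finite S" "B \<ge> 0"
    using D(1) by (simp_all add: S_def B_def)
  ultimately show ?thesis by blast
qed

end

section \<open>The seminorm on a fixed point algebra\<close>

locale fixed_point_length = quantum_torus_length A \<sigma> U len
  for A :: "'a cstar" (structure) and \<sigma> :: "int ^ 'd \<Rightarrow> int ^ 'd \<Rightarrow> complex"
    and U :: "int ^ 'd \<Rightarrow> 'a" and len :: "complex ^ 'd \<Rightarrow> real" +
  fixes G :: "(complex ^ 'd) set"
  assumes G: "subgroup G torus"
begin

sublocale B: cstar_algebra "fixed G"
  by (rule fixed_cstar_algebra[OF G])

lemma fixed_conv_iff: "B.conv X x \<longleftrightarrow> range X \<subseteq> carrier (fixed G) \<and> x \<in> carrier (fixed G) \<and> conv X x"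
proof -
  have "cnorm (fixed G) (X n \<ominus>\<^bsub>fixed G\<^esub> x) = cnorm A (X n \<ominus> x)"
    if "range X \<subseteq> carrier (fixed G)" "x \<in> carrier (fixed G)" for n
    using that(2) fixed_diff[OF G subsetD[OF that(1) rangeI] that(2)] by simp
  then show ?thesis
    unfolding B.conv_def conv_def by (auto dest: fixedD)
qed

lemma sa_fixed: "sa (fixed G) = {a \<in> carrier (fixed G). star A a = a}"
  by (simp add: sa_def)

lemma lip_dom_iff: "a \<in> lip_dom (fixed G) L \<longleftrightarrow> a \<in> sa (fixed G) \<and> (\<exists>r\<ge>0. lip r a)"
  using L_finite_iff fixedD(1) by (auto simp: lip_dom_def sa_fixed)

lemma lip_ball_iff: "a \<in> lip_ball (fixed G) L \<longleftrightarrow> a \<in> sa (fixed G) \<and> lip 1 a"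
  using L_le_iff[of a 1] fixedD(1) by (auto simp: lip_ball_def sa_fixed)

lemma sa_fixedD: "a \<in> sa (fixed G) \<Longrightarrow> a \<in> carrier (fixed G)" "a \<in> sa (fixed G) \<Longrightarrow> a \<in> carrier A"
  "a \<in> sa (fixed G) \<Longrightarrow> a \<in> sa A"
  using fixedD(1) by (auto simp: sa_fixed sa_def)

text \<open>
  Approximate by a polynomial, take its self-adjoint part and average this over \<open>G\<close>. The last two steps do not increase
  the distance to a self-adjoint element that is fixed by \<open>G\<close>, and they keep the Lipschitz property of polynomials.
\<close>

lemma lip_dom_dense:
  assumes a: "a \<in> sa (fixed G)" and e: "e > 0"
  shows "\<exists>b\<in>lip_dom (fixed G) L. cnorm A (a \<ominus> b) < e"
proof -
  note aA = sa_fixedD(2)[OF a]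
  obtain X where X: "range X \<subseteq> polynomials" "conv X a"
    using polynomials_dense[OF aA] by blast
  have "\<forall>\<^sub>F n in sequentially. cnorm A (X n \<ominus> a) < e"
    using X(2) e by (intro order_tendstoD[of _ 0]) (auto simp: conv_def)
  then obtain n where n: "cnorm A (X n \<ominus> a) < e"
    by (auto simp: eventually_sequentially)
  define x where "x = X n"
  have x: "x \<in> polynomials" "x \<in> carrier A"
    using X(1) polynomials_closed by (auto simp: x_def)
  have x_close: "cnorm A (a \<ominus> x) < e"
    using n norm_diff_commute[OF aA x(2)] by (simp add: x_def)
  define y where "y = (1 / 2) \<odot> (x \<oplus> star A x)"
  have y: "y \<in> carrier A" "star A y = y" "y \<in> polynomials"
    using x by (simp_all add: y_def star_smult star_add a_comm polynomials_star polynomials_add polynomials_scale)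
  have star_a: "star A a = a" using a by (simp add: sa_fixed)
  have "a \<ominus> y = (1 / 2) \<odot> ((a \<ominus> x) \<oplus> star A (a \<ominus> x))"
  proof -
    have "a \<ominus> y = (1 / 2) \<odot> (a \<oplus> a) \<ominus> (1 / 2) \<odot> (x \<oplus> star A x)"
      using aA by (simp add: half_scale_double y_def)
    then show ?thesis
      using aA x star_a by (simp add: star_diff add_diff_add flip: scale_diff)
  qed
  then have "cnorm A (a \<ominus> y) \<le> cnorm A (a \<ominus> x)"
    using aA x by (simp add: norm_half_scale_le)
  moreover have "a \<ominus> expectation G y = expectation G (a \<ominus> y)"
    using expectation_of_fixed[OF G sa_fixedD(1)[OF a]] aA y by (simp add: expectation_diff G)
  ultimately have "cnorm A (a \<ominus> expectation G y) < e"
    using expectation_norm_le[OF G, of "a \<ominus> y"] aA y x_close by simp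
  moreover have "expectation G y \<in> lip_dom (fixed G) L"
    using lip_polynomials[OF y(3)] lip_expectation[OF G _ y(1)] expectation_in_fixed[OF G y(1)]
      expectation_star[OF G y(1)] y(2) by (auto simp: lip_dom_iff sa_fixed)
  ultimately show ?thesis by blast
qed

text \<open>
  An element that no rotation moves is equal to its trace.
\<close>

lemma L_eq_0_iff:
  "{a \<in> lip_dom (fixed G) L. L a = 0} = range (\<lambda>t::real. complex_of_real t \<odot> \<one>)" (is "?K = ?R")
proof
  show "?K \<subseteq> ?R"
  proof
    fix a assume a: "a \<in> ?K"
    then have aA: "a \<in> carrier A" and star_a: "star A a = a"
      by (auto simp: lip_dom_iff sa_fixed dest: fixedD)
    have "L a \<le> ennreal 0" using a by simp
    then have "lip 0 a" using L_le_iff[OF aA, of 0] by simp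
    then obtain D where "cnorm A (a \<ominus> \<tau> a \<odot> \<one>) \<le> 0 * D"
      using displacement_bound aA by blast
    then have eq: "a = \<tau> a \<odot> \<one>"
      using eq_diff_iff[of a "\<tau> a \<odot> \<one>"] cnorm_nonneg[of "a \<ominus> \<tau> a \<odot> \<one>"] aA
      by (metis diff_closed mult_zero_left one_closed order_antisym scale_closed)
    then have "cnj (\<tau> a) \<odot> \<one> = \<tau> a \<odot> \<one>"
      using star_a star_smult[of \<one> "\<tau> a"] by simp
    then have "cnj (\<tau> a) = \<tau> a"
      by (rule scale_one_inject)
    then have "\<tau> a \<in> \<real>"
      by (simp add: Reals_cnj_iff)
    then obtain t where "\<tau> a = complex_of_real t"
      by (auto elim: Reals_cases)
    with eq show "a \<in> ?R" by auto
  qed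
  show "?R \<subseteq> ?K"
  proof
    fix a assume "a \<in> ?R"
    then obtain t where a: "a = complex_of_real t \<odot> \<one>" by blast
    have l: "lip 0 a" unfolding a by (rule lip_scalar)
    have "L a \<le> ennreal 0"
      using L_le_iff[of a 0] l by (simp add: a)
    moreover have "a \<in> lip_dom (fixed G) L"
      using l fixed_closed[OF G] by (auto simp: lip_dom_iff sa_fixed a star_smult)
    ultimately show "a \<in> ?K" by simp
  qed
qed

lemma L_real:
  assumes "a \<in> lip_dom (fixed G) L"
  obtains r where "r \<ge> 0" "L a = ennreal r" "lip r a" "a \<in> carrier A"
proof -
  have a: "a \<in> carrier A" "L a < \<infinity>"
    using assms by (auto simp: lip_dom_def sa_fixed dest: fixedD)
  show ?thesis
    using that[of "enn2real (L a)"] lip_L[OF a] a by (simp add: less_top)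
qed

lemma L_scale_le:
  assumes a: "a \<in> lip_dom (fixed G) L"
  shows "L (c \<odot> a) \<le> ennreal (cmod c) * L a"
proof -
  obtain r where r: "r \<ge> 0" "L a = ennreal r" "lip r a" "a \<in> carrier A"
    using L_real[OF a] .
  then show ?thesis
    using L_le_iff[of "c \<odot> a" "cmod c * r"] lip_scale[OF r(3,4), of c] by (simp add: ennreal_mult)
qed

lemma lip_dom_add:
  assumes a: "a \<in> lip_dom (fixed G) L" and b: "b \<in> lip_dom (fixed G) L"
  shows "a \<oplus> b \<in> lip_dom (fixed G) L" "L (a \<oplus> b) \<le> L a + L b"
proof -
  obtain r where r: "r \<ge> 0" "L a = ennreal r" "lip r a" "a \<in> carrier A"
    using L_real[OF a] .
  obtain s where s: "s \<ge> 0" "L b = ennreal s" "lip s b" "b \<in> carrier A"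
    using L_real[OF b] .
  have l: "lip (r + s) (a \<oplus> b)" using r s by (intro lip_add)
  show "a \<oplus> b \<in> lip_dom (fixed G) L"
    using a b l r s fixed_closed[OF G] by (auto simp: lip_dom_iff sa_fixed star_add intro!: exI[of _ "r + s"])
  show "L (a \<oplus> b) \<le> L a + L b"
    using L_le_iff[of "a \<oplus> b" "r + s"] l r s by simp
qed

lemma lip_dom_scale:
  assumes a: "a \<in> lip_dom (fixed G) L"
  shows "complex_of_real t \<odot> a \<in> lip_dom (fixed G) L"
    "L (complex_of_real t \<odot> a) = ennreal \<bar>t\<bar> * L a"
proof -
  have in_dom: "complex_of_real t \<odot> a \<in> lip_dom (fixed G) L" for t
  proof -
    obtain r where r: "r \<ge> 0" "L a = ennreal r" "lip r a" "a \<in> carrier A"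
      using L_real[OF a] .
    then show ?thesis
      using a lip_scale[OF r(3,4), of t] fixed_closed[OF G]
      by (auto simp: lip_dom_iff sa_fixed star_smult intro!: exI[of _ "\<bar>t\<bar> * r"])
  qed
  then show "complex_of_real t \<odot> a \<in> lip_dom (fixed G) L" .
  show "L (complex_of_real t \<odot> a) = ennreal \<bar>t\<bar> * L a"
  proof (rule antisym)
    show "L (complex_of_real t \<odot> a) \<le> ennreal \<bar>t\<bar> * L a"
      using L_scale_le[OF a, of t] by simp
    show "ennreal \<bar>t\<bar> * L a \<le> L (complex_of_real t \<odot> a)"
    proof (cases "t = 0")
      case False
      have aA: "a \<in> carrier A" using a by (auto simp: lip_dom_iff sa_fixed dest: fixedD)
      have "complex_of_real (1 / t) \<odot> (complex_of_real t \<odot> a) = a"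
        using False aA by simp
      then have "L a \<le> ennreal \<bar>1 / t\<bar> * L (complex_of_real t \<odot> a)"
        using L_scale_le[OF in_dom, of "complex_of_real (1 / t)" t] by (simp only: norm_of_real)
      then have "ennreal \<bar>t\<bar> * L a \<le> ennreal \<bar>t\<bar> * (ennreal \<bar>1 / t\<bar> * L (complex_of_real t \<odot> a))"
        by (rule mult_left_mono) simp
      also have "\<dots> = L (complex_of_real t \<odot> a)"
        using False by (simp add: mult.assoc[symmetric] ennreal_mult[symmetric] abs_mult[symmetric] del: abs_divide)
      finally show ?thesis .
    qed simp
  qed
qed

lemma lip_half_sum:
  assumes "lip r a" "lip r b" "a \<in> carrier A" "b \<in> carrier A" "cmod c = 1 / 2"
  shows "lip r (c \<odot> (a \<oplus> b))" "lip r (c \<odot> (a \<ominus> b))"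
  using lip_scale[OF lip_add[OF assms(1-4)], of c] lip_scale[OF lip_diff[OF assms(1-4)], of c] assms
  by simp_all

lemma jordan_lie:
  assumes a: "a \<in> lip_dom (fixed G) L" and b: "b \<in> lip_dom (fixed G) L"
  shows "jordan_product (fixed G) a b \<in> lip_dom (fixed G) L" (is ?j)
    "lie_product (fixed G) a b \<in> lip_dom (fixed G) L" (is ?l)
    "max (L (jordan_product (fixed G) a b)) (L (lie_product (fixed G) a b)) \<le>
      ennreal (leibniz_fun 1 0 (cnorm A a) (cnorm A b) (enn2real (L a)) (enn2real (L b)))" (is ?m)
proof -
  obtain r where r: "r \<ge> 0" "L a = ennreal r" "lip r a" "a \<in> carrier A"
    using L_real[OF a] .
  obtain s where s: "s \<ge> 0" "L b = ennreal s" "lip s b" "b \<in> carrier A"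
    using L_real[OF b] .
  let ?k = "cnorm A a * s + cnorm A b * r"
  have k: "?k \<ge> 0" using r s by simp
  have ab: "a \<in> carrier (fixed G)" "b \<in> carrier (fixed G)" "star A a = a" "star A b = b"
    using a b by (auto simp: lip_dom_iff sa_fixed)
  have J: "jordan_product (fixed G) a b = (1 / 2) \<odot> (a \<otimes> b \<oplus> b \<otimes> a)"
    by (simp add: jordan_product_def)
  have M: "lie_product (fixed G) a b = (1 / (2 * \<i>)) \<odot> (a \<otimes> b \<ominus> b \<otimes> a)"
    using ab fixed_closed[OF G] by (simp add: lie_product_def fixed_diff[OF G])
  have 1: "lip ?k (a \<otimes> b)" using lip_mult[OF r(3) s(3) r(4) s(4)] .
  have 2: "lip ?k (b \<otimes> a)" using lip_mult[OF s(3) r(3) s(4) r(4)] by (simp add: add.commute)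
  have lipJ: "lip ?k (jordan_product (fixed G) a b)"
    unfolding J using r s by (intro lip_half_sum 1 2) auto
  have lipM: "lip ?k (lie_product (fixed G) a b)"
    unfolding M using r s by (intro lip_half_sum 1 2) (auto simp: norm_divide norm_mult)
  have carr: "jordan_product (fixed G) a b \<in> carrier (fixed G)"
    "lie_product (fixed G) a b \<in> carrier (fixed G)"
    unfolding J M using ab fixed_closed[OF G] fixed_diff[OF G, symmetric, of "a \<otimes> b" "b \<otimes> a"]
      B.diff_closed[of "a \<otimes> b" "b \<otimes> a"] by simp_all
  have starJ: "star A (jordan_product (fixed G) a b) = jordan_product (fixed G) a b"
    unfolding J using ab r s by (simp add: star_smult star_add star_mult a_comm)
  have starM: "star A (lie_product (fixed G) a b) = lie_product (fixed G) a b"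
  proof -
    have "star A (lie_product (fixed G) a b) = (- (1 / (2 * \<i>))) \<odot> (b \<otimes> a \<ominus> a \<otimes> b)"
      unfolding M using ab r s by (simp add: star_smult star_diff star_mult)
    also have "\<dots> = (1 / (2 * \<i>)) \<odot> (a \<otimes> b \<ominus> b \<otimes> a)"
      using r s by (simp add: minus_conv scale_add_right a_comm)
    finally show ?thesis unfolding M .
  qed
  show ?j ?l
    using carr starJ starM lipJ lipM k by (auto simp: lip_dom_iff sa_fixed)
  have "L (jordan_product (fixed G) a b) \<le> ennreal ?k" "L (lie_product (fixed G) a b) \<le> ennreal ?k"
    using L_le_iff[OF fixedD(1)[OF carr(1)] k] L_le_iff[OF fixedD(1)[OF carr(2)] k] lipJ lipM by auto
  then show ?m
    using r s by (simp add: leibniz_fun_def)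
qed

lemma L_lower_semicontinuous:
  assumes "r \<ge> 0" shows "closedin (norm_topology (fixed G)) {a \<in> sa (fixed G). L a \<le> ennreal r}"
  unfolding B.closedin_conv
proof (intro conjI allI impI)
  fix X x assume X: "range X \<subseteq> {a \<in> sa (fixed G). L a \<le> ennreal r} \<and> B.conv X x"
  then have x: "conv X x" "x \<in> carrier (fixed G)" by (auto simp: fixed_conv_iff)
  have "lip r (X n)" for n
    using X L_le_iff[of "X n" r] assms sa_fixedD(2) by auto
  then have "lip r x" using lip_conv x(1) by blast
  moreover have "x \<in> sa (fixed G)"
    using X B.sa_conv[of X x] by auto
  ultimately show "x \<in> {a \<in> sa (fixed G). L a \<le> ennreal r}"
    using L_le_iff[of x r] assms sa_fixedD(2) by auto
qed (auto simp: sa_fixed)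

section \<open>The Monge-Kantorovich metric\<close>

abbreviation mkL where "mkL \<phi> \<psi> \<equiv> enn2real (mk (fixed G) L \<phi> \<psi>)"

lemma mk_le: 
  "(\<And>a. a \<in> sa (fixed G) \<Longrightarrow> lip 1 a \<Longrightarrow> cmod (\<phi> a - \<psi> a) \<le> r) \<Longrightarrow> mk (fixed G) L \<phi> \<psi> \<le> ennreal r"
  unfolding mk_def by (rule SUP_least) (auto simp: lip_ball_iff intro: ennreal_leI)

lemma state_functional: "\<phi> \<in> states (fixed G) \<Longrightarrow> contractive_functional (fixed G) \<phi>"
  by (rule B.states_contractive)

lemma mk_finite:
  assumes "\<phi> \<in> states (fixed G)" "\<psi> \<in> states (fixed G)"
  shows "mk (fixed G) L \<phi> \<psi> < \<infinity>"
proof -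
  obtain D where D: "D > 0" "\<And>a. a \<in> carrier A \<Longrightarrow> lip 1 a \<Longrightarrow> cnorm A (a \<ominus> \<tau> a \<odot> \<one>) \<le> D"
    using displacement_bound by (metis mult_1 zero_le_one)
  have "cmod (\<phi> a - \<psi> a) \<le> 2 * D" if a: "a \<in> sa (fixed G)" "lip 1 a" for a
  proof -
    let ?b = "a \<ominus>\<^bsub>fixed G\<^esub> \<tau> a \<odot> \<one>"
    have carr: "a \<in> carrier (fixed G)" "\<tau> a \<odot> \<one> \<in> carrier (fixed G)"
      using a sa_fixedD fixed_closed[OF G] by auto
    then have b: "?b \<in> carrier (fixed G)" "cnorm A ?b \<le> D"
      using B.diff_closed[of a "\<tau> a \<odot> \<one>"] D(2)[of a] a fixedD(1) by (auto simp: fixed_diff[OF G])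
    have 1: "\<omega> ?b = \<omega> a - \<tau> a" "cmod (\<omega> ?b) \<le> D" if \<omega>: "\<omega> \<in> states (fixed G)" for \<omega>
    proof -
      have "\<omega> (\<tau> a \<odot> \<one>) = \<tau> a"
        using \<omega> fixed_closed[OF G] by (simp add: states_def)
      then show "\<omega> ?b = \<omega> a - \<tau> a"
        using B.functional_diff[OF state_functional[OF \<omega>] carr] by simp
      show "cmod (\<omega> ?b) \<le> D"
        using contractive_functionalD(3)[OF state_functional[OF \<omega>] b(1)] b(2) by simp
    qed
    have "\<phi> a - \<psi> a = \<phi> ?b - \<psi> ?b"
      using 1(1)[OF assms(1)] 1(1)[OF assms(2)] by simp
    then show ?thesis
      using norm_triangle_ineq4[of "\<phi> ?b" "\<psi> ?b"] 1(2)[OF assms(1)] 1(2)[OF assms(2)] by simp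
  qed
  then have "mk (fixed G) L \<phi> \<psi> \<le> ennreal (2 * D)" by (rule mk_le)
  then show ?thesis by (simp add: le_less_trans)
qed

lemma mkL_le:
  assumes "\<And>a. a \<in> sa (fixed G) \<Longrightarrow> lip 1 a \<Longrightarrow> cmod (\<phi> a - \<psi> a) \<le> r" "r \<ge> 0"
  shows "mkL \<phi> \<psi> \<le> r"
  using enn2real_mono[OF mk_le[OF assms(1)]] assms(2) by simp

lemma mkL_ge:
  assumes "\<phi> \<in> states (fixed G)" "\<psi> \<in> states (fixed G)" "a \<in> sa (fixed G)" "lip 1 a"
  shows "cmod (\<phi> a - \<psi> a) \<le> mkL \<phi> \<psi>"
proof -
  have "ennreal (cmod (\<phi> a - \<psi> a)) \<le> mk (fixed G) L \<phi> \<psi>"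
    unfolding mk_def using assms by (intro SUP_upper) (simp add: lip_ball_iff)
  then show ?thesis
    using enn2real_mono[of "ennreal (cmod (\<phi> a - \<psi> a))" "mk (fixed G) L \<phi> \<psi>"] mk_finite[OF assms(1,2)] by simp
qed

text \<open>
  Lipschitz elements are dense, so evaluation at \<open>b\<close> is uniformly continuous for the Monge-Kantorovich metric.
\<close>

lemma state_difference_sa:
  assumes b: "b \<in> sa (fixed G)" and e: "e > 0"
  shows "\<exists>C>0. \<forall>\<phi>\<in>states (fixed G). \<forall>\<psi>\<in>states (fixed G). cmod (\<phi> b - \<psi> b) \<le> e + C * mkL \<phi> \<psi>"
proof -
  obtain x where x: "x \<in> lip_dom (fixed G) L" "cnorm A (b \<ominus> x) < e / 2"
    using lip_dom_dense[OF b, of "e / 2"] e by auto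
  then obtain r0 where r0: "r0 \<ge> 0" "lip r0 x" "x \<in> sa (fixed G)"
    by (auto simp: lip_dom_iff)
  \<comment> \<open>Adding 1 makes the Lipschitz constant positive, so that one can divide by it.\<close>
  define r where "r = r0 + 1"
  have r: "r > 0" "lip r x" using r0 lip_mono[OF r0(2), of r] by (auto simp: r_def)
  define y where "y = complex_of_real (1 / r) \<odot> x"
  have carr: "x \<in> carrier (fixed G)" "b \<in> carrier (fixed G)" "x \<in> carrier A" "b \<in> carrier A"
    using r0(3) b sa_fixedD by auto
  have y: "y \<in> sa (fixed G)" "lip 1 y"
    using B.sa_scale[OF r0(3), of "1 / r"] lip_scale[OF r(2) carr(3), of "complex_of_real (1 / r)"] r(1)
    by (simp_all add: y_def norm_divide del: of_real_divide)
  have "cmod (\<phi> b - \<psi> b) \<le> e + r * mkL \<phi> \<psi>"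
    if \<phi>: "\<phi> \<in> states (fixed G)" and \<psi>: "\<psi> \<in> states (fixed G)" for \<phi> \<psi>
  proof -
    have close: "cmod (\<omega> b - \<omega> x) \<le> e / 2" if \<omega>: "\<omega> \<in> states (fixed G)" for \<omega>
    proof -
      have "b \<ominus>\<^bsub>fixed G\<^esub> x \<in> carrier (fixed G)"
        using carr by (intro B.diff_closed)
      from contractive_functionalD(3)[OF state_functional[OF \<omega>] this]
      have "cmod (\<omega> b - \<omega> x) \<le> cnorm A (b \<ominus> x)"
        using B.functional_diff[OF state_functional[OF \<omega>] carr(2,1)] fixed_diff[OF G carr(2,1)] by simp
      then show ?thesis using x(2) by simp
    qed
    have scale: "\<omega> x = complex_of_real r * \<omega> y" if \<omega>: "\<omega> \<in> states (fixed G)" for \<omega>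
      using contractive_functionalD(2)[OF state_functional[OF \<omega>] carr(1), of "complex_of_real (1 / r)"] r(1)
      by (simp add: y_def)
    have "\<phi> x - \<psi> x = complex_of_real r * (\<phi> y - \<psi> y)"
      by (simp add: scale[OF \<phi>] scale[OF \<psi>] right_diff_distrib)
    then have "cmod (\<phi> x - \<psi> x) = r * cmod (\<phi> y - \<psi> y)"
      using r(1) by (simp add: norm_mult)
    also have "\<dots> \<le> r * mkL \<phi> \<psi>"
      using mkL_ge[OF \<phi> \<psi> y] r(1) by simp
    finally have "cmod (\<phi> x - \<psi> x) \<le> r * mkL \<phi> \<psi>" .
    moreover have "cmod (\<phi> b - \<psi> b) \<le> cmod (\<phi> b - \<phi> x) + cmod (\<phi> x - \<psi> x) + cmod (\<psi> b - \<psi> x)"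
      using norm_triangle_ineq[of "(\<phi> b - \<phi> x) + (\<phi> x - \<psi> x)" "\<psi> x - \<psi> b"]
        norm_triangle_ineq[of "\<phi> b - \<phi> x" "\<phi> x - \<psi> x"] norm_minus_commute[of "\<psi> x" "\<psi> b"] by simp
    ultimately show ?thesis
      using close[OF \<phi>] close[OF \<psi>] by linarith
  qed
  then show ?thesis using r(1) by blast
qed

lemma state_difference:
  assumes b: "b \<in> carrier (fixed G)" and e: "e > 0"
  shows "\<exists>C>0. \<forall>\<phi>\<in>states (fixed G). \<forall>\<psi>\<in>states (fixed G). cmod (\<phi> b - \<psi> b) \<le> e + C * mkL \<phi> \<psi>"
proof -
  note bA = fixedD(1)[OF b]
  define x where "x = (1 / 2) \<odot> (b \<oplus> star A b)"
  define y where "y = (1 / (2 * \<i>)) \<odot> (b \<ominus>\<^bsub>fixed G\<^esub> star A b)"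
  have y_eq: "y = (1 / (2 * \<i>)) \<odot> (b \<ominus> star A b)"
    using b fixed_closed[OF G] by (simp add: y_def fixed_diff[OF G])
  have carr: "x \<in> carrier (fixed G)" "y \<in> carrier (fixed G)"
    using b fixed_closed[OF G] B.diff_closed[of b "star A b"] by (simp_all add: x_def y_def)
  have "star A x = x"
    using bA by (simp add: x_def star_smult star_add a_comm)
  moreover have "star A y = y"
    using bA by (simp add: y_eq star_smult star_diff) (simp add: minus_conv scale_add_right a_comm)
  ultimately have sa: "x \<in> sa (fixed G)" "y \<in> sa (fixed G)"
    using carr by (simp_all add: sa_fixed)
  have "x \<oplus> \<i> \<odot> y = (1 / 2) \<odot> ((b \<oplus> star A b) \<oplus> (b \<ominus> star A b))"
    using bA by (simp add: x_def y_eq scale_add_right)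
  also have "(b \<oplus> star A b) \<oplus> (b \<ominus> star A b) = b \<oplus> b"
    using bA by (simp add: minus_eq a_ac r_neg)
  also have "(1 / 2) \<odot> (b \<oplus> b) = b"
    using bA by (rule half_scale_double)
  finally have b_eq: "b = x \<oplus> \<i> \<odot> y" by simp
  obtain C1 where C1: "C1 > 0" "\<forall>\<phi>\<in>states (fixed G). \<forall>\<psi>\<in>states (fixed G). cmod (\<phi> x - \<psi> x) \<le> e / 2 + C1 * mkL \<phi> \<psi>"
    using state_difference_sa[OF sa(1), of "e / 2"] e by auto
  obtain C2 where C2: "C2 > 0" "\<forall>\<phi>\<in>states (fixed G). \<forall>\<psi>\<in>states (fixed G). cmod (\<phi> y - \<psi> y) \<le> e / 2 + C2 * mkL \<phi> \<psi>"
    using state_difference_sa[OF sa(2), of "e / 2"] e by auto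
  have "cmod (\<phi> b - \<psi> b) \<le> e + (C1 + C2) * mkL \<phi> \<psi>"
    if \<phi>: "\<phi> \<in> states (fixed G)" and \<psi>: "\<psi> \<in> states (fixed G)" for \<phi> \<psi>
  proof -
    have split: "\<omega> b = \<omega> x + \<i> * \<omega> y" if \<omega>: "\<omega> \<in> states (fixed G)" for \<omega>
      unfolding b_eq using contractive_functionalD(1,2)[OF state_functional[OF \<omega>]] carr fixed_closed[OF G] by simp
    have "\<phi> b - \<psi> b = (\<phi> x - \<psi> x) + \<i> * (\<phi> y - \<psi> y)"
      by (simp add: split[OF \<phi>] split[OF \<psi>] algebra_simps)
    then have "cmod (\<phi> b - \<psi> b) \<le> cmod (\<phi> x - \<psi> x) + cmod (\<phi> y - \<psi> y)"
      using norm_triangle_ineq[of "\<phi> x - \<psi> x" "\<i> * (\<phi> y - \<psi> y)"] by (simp add: norm_mult)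
    also have "\<dots> \<le> (e / 2 + C1 * mkL \<phi> \<psi>) + (e / 2 + C2 * mkL \<phi> \<psi>)"
      using C1(2) C2(2) \<phi> \<psi> by (intro add_mono) blast+
    finally show ?thesis by (simp add: distrib_right)
  qed
  then show ?thesis using C1(1) C2(1) by (intro exI[of _ "C1 + C2"]) simp
qed

lemma mk_Metric_space: "Metric_space (states (fixed G)) mkL"
proof
  fix \<phi> \<psi>
  show "0 \<le> mkL \<phi> \<psi>" by simp
  show "mkL \<phi> \<psi> = mkL \<psi> \<phi>"
    by (simp add: mk_def norm_minus_commute)
  assume \<phi>: "\<phi> \<in> states (fixed G)" and \<psi>: "\<psi> \<in> states (fixed G)"
  show "mkL \<phi> \<psi> = 0 \<longleftrightarrow> \<phi> = \<psi>"
  proof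
    assume 0: "mkL \<phi> \<psi> = 0"
    have "\<phi> b = \<psi> b" if b: "b \<in> carrier (fixed G)" for b
    proof -
      have "cmod (\<phi> b - \<psi> b) \<le> 0 + e" if e: "e > 0" for e
      proof -
        obtain C where "cmod (\<phi> b - \<psi> b) \<le> e + C * mkL \<phi> \<psi>"
          using state_difference[OF b e] \<phi> \<psi> by blast
        then show ?thesis using 0 by simp
      qed
      then have "cmod (\<phi> b - \<psi> b) \<le> 0" by (rule field_le_epsilon)
      then show ?thesis by simp
    qed
    then show "\<phi> = \<psi>"
      using \<phi> \<psi> by (intro extensionalityI[of _ "carrier (fixed G)"]) (auto simp: states_def)
  next
    assume "\<phi> = \<psi>"
    have "mkL \<phi> \<psi> \<le> 0" unfolding \<open>\<phi> = \<psi>\<close> by (rule mkL_le) auto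
    then show "mkL \<phi> \<psi> = 0" using enn2real_nonneg[of "mk (fixed G) L \<phi> \<psi>"] by linarith
  qed
  fix \<omega> assume \<omega>: "\<omega> \<in> states (fixed G)"
  show "mkL \<phi> \<omega> \<le> mkL \<phi> \<psi> + mkL \<psi> \<omega>"
  proof (rule mkL_le)
    fix a assume a: "a \<in> sa (fixed G)" "lip 1 a"
    show "cmod (\<phi> a - \<omega> a) \<le> mkL \<phi> \<psi> + mkL \<psi> \<omega>"
      using norm_triangle_ineq[of "\<phi> a - \<psi> a" "\<psi> a - \<omega> a"] mkL_ge[OF \<phi> \<psi> a] mkL_ge[OF \<psi> \<omega> a] by simp
  qed simp
qed

interpretation MK: Metric_space "states (fixed G)" mkL
  by (rule mk_Metric_space)

lemma topspace_weak_star: "topspace (weak_star_topology (fixed G)) = states (fixed G)"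
  by (auto simp: weak_star_topology_def states_def PiE_def)

lemma evaluation_continuous:
  assumes b: "b \<in> carrier (fixed G)"
  shows "continuous_map MK.mtopology euclidean (\<lambda>\<phi>. \<phi> b)"
  unfolding continuous_map_def
proof (intro conjI allI impI)
  fix V :: "complex set" assume "openin euclidean V"
  then have V: "open V" by simp
  show "openin MK.mtopology {\<phi> \<in> topspace MK.mtopology. \<phi> b \<in> V}"
    unfolding MK.openin_mtopology
  proof (intro conjI allI impI)
    fix \<phi> assume "\<phi> \<in> {\<phi> \<in> topspace MK.mtopology. \<phi> b \<in> V}"
    then have \<phi>: "\<phi> \<in> states (fixed G)" "\<phi> b \<in> V" by auto
    obtain e where e: "e > 0" "\<And>w. dist w (\<phi> b) < e \<Longrightarrow> w \<in> V"
      using V \<phi>(2) by (auto simp: open_dist)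
    obtain C where C: "C > 0" "\<forall>\<phi>\<in>states (fixed G). \<forall>\<psi>\<in>states (fixed G). cmod (\<phi> b - \<psi> b) \<le> e / 2 + C * mkL \<phi> \<psi>"
      using state_difference[OF b, of "e / 2"] e(1) by auto
    have "\<psi> b \<in> V" if \<psi>: "\<psi> \<in> states (fixed G)" "mkL \<phi> \<psi> < e / (2 * C)" for \<psi>
    proof (rule e(2))
      have "C * mkL \<phi> \<psi> < e / 2" using \<psi>(2) C(1) by (simp add: field_simps)
      moreover have "cmod (\<phi> b - \<psi> b) \<le> e / 2 + C * mkL \<phi> \<psi>"
        using C(2) \<phi>(1) \<psi>(1) by blast
      ultimately show "dist (\<psi> b) (\<phi> b) < e"
        unfolding dist_norm norm_minus_commute[of "\<psi> b"] by linarith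
    qed
    then show "\<exists>r>0. MK.mball \<phi> r \<subseteq> {\<phi> \<in> topspace MK.mtopology. \<phi> b \<in> V}"
      using e(1) C(1) by (intro exI[of _ "e / (2 * C)"]) auto
  qed auto
qed simp

text \<open>
  Evaluations are continuous for the metric, which is one inclusion. For the other one, compose states with the
  expectation: \<open>functional_difference_bound\<close> says that every ball contains the states that are close to its centre at
  finitely many of the elements \<open>E (U s*)\<close>.
\<close>

lemma mk_topology: "MK.mtopology = weak_star_topology (fixed G)"
  unfolding topology_eq
proof (intro allI iffI)
  fix W assume W: "openin (weak_star_topology (fixed G)) W"
  have ext: "states (fixed G) \<subseteq> extensional (carrier (fixed G))"
    by (auto simp: states_def)
  have "continuous_map MK.mtopology (weak_star_topology (fixed G)) (\<lambda>\<phi>. \<phi>)"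
    unfolding weak_star_topology_def continuous_map_in_subtopology continuous_map_componentwise
    using evaluation_continuous ext by auto
  from openin_continuous_map_preimage[OF this W]
  have "openin MK.mtopology {\<phi> \<in> states (fixed G). \<phi> \<in> W}" by simp
  moreover have "{\<phi> \<in> states (fixed G). \<phi> \<in> W} = W"
    using openin_subset[OF W] topspace_weak_star by auto
  ultimately show "openin MK.mtopology W" by simp
next
  fix W assume W: "openin MK.mtopology W"
  show "openin (weak_star_topology (fixed G)) W"
    unfolding openin_subopen[of _ W]
  proof
    fix \<phi> assume \<phi>W: "\<phi> \<in> W"
    then obtain r where r: "r > 0" "MK.mball \<phi> r \<subseteq> W" and \<phi>: "\<phi> \<in> states (fixed G)"
      using W unfolding MK.openin_mtopology by blast
    let ?E = "\<lambda>s. expectation G (star A (U s))"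
    obtain S K where SK: "finite S" "K \<ge> 0"
      "\<And>\<Phi> \<Psi> a. contractive_functional A \<Phi> \<Longrightarrow> contractive_functional A \<Psi> \<Longrightarrow> \<Phi> \<one> = 1 \<Longrightarrow> \<Psi> \<one> = 1 \<Longrightarrow>
        a \<in> carrier A \<Longrightarrow> lip 1 a \<Longrightarrow>
        cmod (\<Phi> a - \<Psi> a) \<le> r / 3 + K * (\<Sum>s\<in>S. cmod (\<Phi> (star A (U s)) - \<Psi> (star A (U s))))"
      using functional_difference_bound[of "r / 3"] r(1) by auto
    define f where "f \<psi> = (\<Sum>s\<in>S. cmod (\<phi> (?E s) - \<psi> (?E s)))" for \<psi> :: "'a \<Rightarrow> complex"
    have E: "?E s \<in> carrier (fixed G)" for s
      by (intro expectation_in_fixed G) simp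
    have "continuous_map (weak_star_topology (fixed G)) euclideanreal f"
      unfolding f_def weak_star_topology_def using SK(1) E
      by (intro continuous_map_sum continuous_map_norm continuous_map_diff continuous_map_from_subtopology
          continuous_map_product_projection) auto
    from openin_continuous_map_preimage[OF this, of "{..<r / (3 * (K + 1))}"]
    have "openin (weak_star_topology (fixed G)) {\<psi> \<in> states (fixed G). f \<psi> < r / (3 * (K + 1))}"
      by (simp add: topspace_weak_star)
    moreover have "\<phi> \<in> {\<psi> \<in> states (fixed G). f \<psi> < r / (3 * (K + 1))}"
      using \<phi> r(1) SK(2) by (simp add: f_def)
    moreover have "{\<psi> \<in> states (fixed G). f \<psi> < r / (3 * (K + 1))} \<subseteq> W"
    proof safe
      fix \<psi> assume \<psi>: "\<psi> \<in> states (fixed G)" "f \<psi> < r / (3 * (K + 1))"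
      have "0 \<le> f \<psi>" by (simp add: f_def sum_nonneg)
      then have "K * f \<psi> \<le> (K + 1) * f \<psi>" by (simp add: distrib_right)
      also have "\<dots> < r / 3" using \<psi>(2) SK(2) by (simp add: field_simps)
      finally have small: "K * f \<psi> < r / 3" .
      have "mkL \<phi> \<psi> \<le> r / 3 + r / 3"
      proof (rule mkL_le)
        fix a assume a: "a \<in> sa (fixed G)" "lip 1 a"
        have one: "\<omega> (expectation G \<one>) = 1" if "\<omega> \<in> states (fixed G)" for \<omega>
          using that by (simp add: states_def expectation_one G)
        have "cmod (\<phi> (expectation G a) - \<psi> (expectation G a)) \<le> r / 3 + K * f \<psi>"
          unfolding f_def
          by (rule SK(3)[OF state_expectation_contractive[OF G \<phi>] state_expectation_contractive[OF G \<psi>(1)]])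
            (use one \<phi> \<psi>(1) a sa_fixedD in auto)
        then show "cmod (\<phi> a - \<psi> a) \<le> r / 3 + r / 3"
          using small expectation_of_fixed[OF G sa_fixedD(1)[OF a(1)]] by simp
      qed (use r(1) in simp)
      then have "\<psi> \<in> MK.mball \<phi> r"
        using \<phi> \<psi>(1) r(1) by simp
      then show "\<psi> \<in> W" using r(2) by blast
    qed
    ultimately show "\<exists>T. openin (weak_star_topology (fixed G)) T \<and> \<phi> \<in> T \<and> T \<subseteq> W" by blast
  qed
qed

theorem fixed_quasi_leibniz_qcms: "quasi_leibniz_qcms (leibniz_fun 1 0) (fixed G) L"
proof -
  have "weakly_increasing (leibniz_fun 1 0)"
    unfolding weakly_increasing_def leibniz_fun_def by (auto intro!: add_mono mult_mono)
  moreover have "\<zero> \<in> lip_dom (fixed G) L"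
    using lip_zero B.zero_closed by (auto simp: lip_dom_iff sa_fixed)
  moreover have "sa (fixed G) \<subseteq> norm_topology (fixed G) closure_of lip_dom (fixed G) L"
  proof
    fix a assume a: "a \<in> sa (fixed G)"
    have sub: "lip_dom (fixed G) L \<subseteq> carrier (fixed G)"
      by (auto simp: lip_dom_iff sa_fixed)
    have "\<exists>b\<in>lip_dom (fixed G) L. cnorm A (a \<ominus>\<^bsub>fixed G\<^esub> b) < e" if e: "e > 0" for e
    proof -
      obtain b where b: "b \<in> lip_dom (fixed G) L" "cnorm A (a \<ominus> b) < e"
        using lip_dom_dense[OF a e] by blast
      then show ?thesis
        using fixed_diff[OF G sa_fixedD(1)[OF a] subsetD[OF sub b(1)]] by (intro bexI[of _ b]) simp_all
    qed
    then show "a \<in> norm_topology (fixed G) closure_of lip_dom (fixed G) L"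
      using B.in_closure_iff[OF sub, of a] sa_fixedD(1)[OF a] by simp
  qed
  ultimately show ?thesis
    unfolding quasi_leibniz_qcms_def fixed_simps
    by (intro conjI ballI allI impI)
      (rule lip_dom_add lip_dom_scale jordan_lie L_eq_0_iff mk_finite mk_Metric_space mk_topology
        L_lower_semicontinuous B.cstar_algebra_axioms | assumption)+
qed

end

section \<open>The bridge and the convergence\<close>

context quantum_torus_length
begin

lemma fixed_point_length: "subgroup G torus \<Longrightarrow> fixed_point_length A \<sigma> U len G"
  by (intro fixed_point_length.intro quantum_torus_length_axioms fixed_point_length_axioms.intro)

lemmas quasi_leibniz = fixed_point_length.fixed_quasi_leibniz_qcms[OF fixed_point_length]

lemma lip_ball_fixed:
  "subgroup G torus \<Longrightarrow> a \<in> lip_ball (fixed G) L \<longleftrightarrow> a \<in> carrier (fixed G) \<and> star A a = a \<and> lip 1 a"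
  using fixed_point_length.lip_ball_iff[OF fixed_point_length] by (simp add: sa_def)

text \<open>
  As the pivot is the unit, all states of \<open>A\<close> are level states.
\<close>

definition trivial_bridge :: "'a bridge"
  where "trivial_bridge = \<lparr>bridge_alg = A, left_map = (\<lambda>a. a), right_map = (\<lambda>a. a), pivot = \<one>\<rparr>"

lemma level_states_one: "level_states A \<one> = states A"
  by (auto simp: level_states_def)

lemma inclusion_star_hom: "(\<lambda>a. a) \<in> star_hom (fixed G) A"
  using fixedD(1) by (auto simp: star_hom_def ring_hom_def)

lemma is_bridge_trivial: "is_bridge (fixed G) (fixed H) trivial_bridge"
  using tau_state cstar_algebra_axioms inclusion_star_hom
  by (auto simp: is_bridge_def trivial_bridge_def level_states_one)

text \<open>
  Every state of a fixed point algebra extends to \<open>A\<close>, so the height of the bridge vanishes.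
\<close>

lemma pulled_back_states_fixed:
  assumes G: "subgroup G torus"
  shows "pulled_back_states (fixed G) (\<lambda>a. a) trivial_bridge = states (fixed G)"
proof -
  have sub: "a \<in> carrier A" if "a \<in> carrier (fixed G)" for a
    using that by (rule fixedD)
  have "restrict \<phi> (carrier (fixed G)) \<in> states (fixed G)" if "\<phi> \<in> states A" for \<phi>
    using that fixed_closed[OF G] by (simp add: states_def sub)
  moreover have "\<exists>\<Phi>\<in>states A. \<phi> = restrict \<Phi> (carrier (fixed G))" if \<phi>: "\<phi> \<in> states (fixed G)" for \<phi>
  proof (rule bexI[OF _ state_extension[OF G \<phi>]], rule ext)
    fix a
    show "\<phi> a = restrict (restrict (\<lambda>a. \<phi> (expectation G a)) (carrier A)) (carrier (fixed G)) a"
      using expectation_of_fixed[OF G, of a] fixedD(1)[of a G] \<phi>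
      by (cases "a \<in> carrier (fixed G)") (auto simp: states_def extensional_def)
  qed
  ultimately show ?thesis
    by (auto simp: pulled_back_states_def trivial_bridge_def level_states_one comp_def)
qed

lemma mk_refl: "mk B M \<phi> \<phi> = 0"
  by (auto simp: mk_def intro: SUP_least antisym)

lemma hausdorff_distance_refl: "(\<And>x. d x x = 0) \<Longrightarrow> hausdorff_distance d X X = 0"
proof -
  assume d: "\<And>x. d x x = 0"
  have "(INF y\<in>X. d x y) \<le> 0" "(INF y\<in>X. d y x) \<le> 0" if "x \<in> X" for x
    using INF_lower[OF that, of "d x"] INF_lower[OF that, of "\<lambda>y. d y x"] d by simp_all
  then show ?thesis
    unfolding hausdorff_distance_def by (intro antisym max.boundedI SUP_least) auto
qed

lemma bridge_height_zero:
  assumes "subgroup G torus" "subgroup H torus"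
  shows "bridge_height trivial_bridge (fixed G) L (fixed H) L = 0"
  using pulled_back_states_fixed[OF assms(1)] pulled_back_states_fixed[OF assms(2)]
  by (simp add: bridge_height_def trivial_bridge_def hausdorff_distance_refl mk_refl)

lemma lip_orbit:
  assumes a: "a \<in> carrier A" "lip 1 a" and x: "x \<in> carrier torus" and y: "y \<in> carrier torus"
  shows "cnorm A (\<alpha> x a \<ominus> \<alpha> y a) \<le> len (inv\<^bsub>torus\<^esub> x * y)"
proof -
  note T = subgroup_torusD[OF subgroup_carrier_torus]
  let ?w = "inv\<^bsub>torus\<^esub> x * y"
  have w: "?w \<in> carrier torus" using T(4)[OF x] y by simp
  have "x * ?w = y" using T(6)[OF x] by (simp add: mult.assoc[symmetric])
  then have "\<alpha> y a = \<alpha> x (\<alpha> ?w a)"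
    using dual_action_torus_mult[OF x w a(1)] by simp
  then have "cnorm A (\<alpha> x a \<ominus> \<alpha> y a) = cnorm A (a \<ominus> \<alpha> ?w a)"
    using a x w by (simp flip: dual_action_diff)
  then show ?thesis using a(2) w by (simp add: lip_def)
qed

text \<open>
  As \<open>a\<close> is fixed by \<open>x\<close>, its displacement by \<open>y\<close> is its displacement by \<open>x\<^sup>-\<^sup>1 y\<close>.
\<close>

lemma expectation_distance:
  assumes H: "subgroup H torus" and G: "G \<subseteq> carrier torus"
    and close: "\<And>y. y \<in> H \<Longrightarrow> \<exists>x\<in>G. len (inv\<^bsub>torus\<^esub> x * y) < h \<or> len (inv\<^bsub>torus\<^esub> y * x) < h"
    and a: "a \<in> carrier (fixed G)" "lip 1 a"
  shows "cnorm A (a \<ominus> expectation H a) \<le> h"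
proof (rule expectation_displacement[OF H])
  show aA: "a \<in> carrier A" using a by (auto dest: fixedD)
  fix y assume y: "y \<in> H"
  then obtain x where x: "x \<in> G" "len (inv\<^bsub>torus\<^esub> x * y) < h \<or> len (inv\<^bsub>torus\<^esub> y * x) < h"
    using close by blast
  have xy: "x \<in> carrier torus" "y \<in> carrier torus"
    using x y G subgroup_torusD(1)[OF H] by auto
  have "cnorm A (\<alpha> x a \<ominus> \<alpha> y a) \<le> h"
    using lip_orbit[OF aA a(2) xy] lip_orbit[OF aA a(2) xy(2,1)] x(2)
      norm_diff_commute[of "\<alpha> x a" "\<alpha> y a"] xy aA by auto
  then show "cnorm A (a \<ominus> \<alpha> y a) \<le> h"
    using fixedD(2)[OF a(1) x(1)] by simp
qed

lemma bridge_reach_le: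
  assumes G: "subgroup G torus" and H: "subgroup H torus"
    and GH: "\<And>x. x \<in> G \<Longrightarrow> \<exists>y\<in>H. len (inv\<^bsub>torus\<^esub> x * y) < h"
    and HG: "\<And>y. y \<in> H \<Longrightarrow> \<exists>x\<in>G. len (inv\<^bsub>torus\<^esub> x * y) < h"
  shows "bridge_reach trivial_bridge (fixed G) L (fixed H) L \<le> ennreal h"
proof -
  have seminorm: "bridge_seminorm trivial_bridge a b = cnorm A (a \<ominus> b)"
    if "a \<in> carrier A" "b \<in> carrier A" for a b
    using that by (simp add: bridge_seminorm_def trivial_bridge_def)
  have ball: "a \<in> carrier (fixed K)" "a \<in> carrier A" "lip 1 a"
      "subgroup K' torus \<Longrightarrow> expectation K' a \<in> lip_ball (fixed K') L"
    if K: "subgroup K torus" and a: "a \<in> lip_ball (fixed K) L" for K K' a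
  proof -
    show 1: "a \<in> carrier (fixed K)" "lip 1 a"
      using a by (simp_all add: lip_ball_fixed K)
    show 2: "a \<in> carrier A" using 1(1) by (rule fixedD)
    show "expectation K' a \<in> lip_ball (fixed K') L" if K': "subgroup K' torus"
      using lip_expectation[OF K' 1(2) 2] expectation_in_fixed[OF K' 2] expectation_star[OF K' 2] a
      by (simp add: lip_ball_fixed K K')
  qed
  have "(INF b\<in>lip_ball (fixed H) L. ennreal (bridge_seminorm trivial_bridge a b)) \<le> ennreal h"
    if a: "a \<in> lip_ball (fixed G) L" for a
  proof (rule INF_lower2[OF ball(4)[OF G a H]])
    have "cnorm A (a \<ominus> expectation H a) \<le> h"
      using HG ball(1,3)[OF G a] subgroup_torusD(1)[OF G] by (intro expectation_distance[OF H, of G]) auto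
    then show "ennreal (bridge_seminorm trivial_bridge a (expectation H a)) \<le> ennreal h"
      using ball(2)[OF G a] by (simp add: seminorm H ennreal_leI)
  qed
  moreover have "(INF a\<in>lip_ball (fixed G) L. ennreal (bridge_seminorm trivial_bridge a b)) \<le> ennreal h"
    if b: "b \<in> lip_ball (fixed H) L" for b
  proof (rule INF_lower2[OF ball(4)[OF H b G]])
    have "cnorm A (b \<ominus> expectation G b) \<le> h"
      using GH ball(1,3)[OF H b] subgroup_torusD(1)[OF H] by (intro expectation_distance[OF G, of H]) auto
    then show "ennreal (bridge_seminorm trivial_bridge (expectation G b) b) \<le> ennreal h"
      using ball(2)[OF H b] norm_diff_commute[of b "expectation G b"] by (simp add: seminorm G ennreal_leI)
  qed
  ultimately show ?thesis
    unfolding bridge_reach_def by (intro max.boundedI SUP_least) auto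
qed

lemma propinquity_le:
  assumes G: "subgroup G torus" and H: "subgroup H torus"
    and less: "hausdorff_distance (length_metric torus len) G H < ennreal h"
  shows "propinquity (leibniz_fun 1 0) (fixed G, L) (fixed H, L) \<le> ennreal h"
proof -
  have metric: "length_metric torus len x y < ennreal h \<longleftrightarrow> len (inv\<^bsub>torus\<^esub> x * y) < h"
    if "x \<in> G" "y \<in> H" for x y
  proof -
    have "inv\<^bsub>torus\<^esub> x * y \<in> carrier torus"
      using subsetD[OF subgroup_torusD(1)[OF G] subgroup_torusD(4)[OF G that(1)]]
        subsetD[OF subgroup_torusD(1)[OF H] that(2)] by simp
    then show ?thesis
      using len_nonneg by (simp add: length_metric_def ennreal_less_iff)
  qed
  have GH: "\<exists>y\<in>H. len (inv\<^bsub>torus\<^esub> x * y) < h" if "x \<in> G" for x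
  proof -
    have "(INF y\<in>H. length_metric torus len x y) < ennreal h"
      using less SUP_upper[OF that, of "\<lambda>x. INF y\<in>H. length_metric torus len x y"]
      by (auto simp: hausdorff_distance_def intro: le_less_trans)
    then show ?thesis using metric[OF that] by (auto simp: INF_less_iff)
  qed
  have HG: "\<exists>x\<in>G. len (inv\<^bsub>torus\<^esub> x * y) < h" if "y \<in> H" for y
  proof -
    have "(INF x\<in>G. length_metric torus len x y) < ennreal h"
      using less SUP_upper[OF that, of "\<lambda>y. INF x\<in>G. length_metric torus len x y"]
      by (auto simp: hausdorff_distance_def intro: le_less_trans)
    then show ?thesis using metric[OF _ that] by (auto simp: INF_less_iff)
  qed
  have "is_trek (leibniz_fun 1 0) (fixed G, L) (fixed H, L) [(fixed G, L), (fixed H, L)] [trivial_bridge]"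
    using quasi_leibniz[OF G] quasi_leibniz[OF H] is_bridge_trivial
    by (simp add: is_trek_def)
  then have "propinquity (leibniz_fun 1 0) (fixed G, L) (fixed H, L)
      \<le> bridge_length trivial_bridge (fixed G, L) (fixed H, L)"
    unfolding propinquity_def by (intro INF_lower2) auto
  also have "\<dots> \<le> ennreal h"
    using bridge_reach_le[OF G H GH HG] by (simp add: bridge_length_def bridge_height_zero G H)
  finally show ?thesis .
qed

end

theorem corollary3p2:
  fixes \<sigma> :: "int ^ 'd \<Rightarrow> int ^ 'd \<Rightarrow> complex"
    and \<AA> :: "'a cstar" and U :: "int ^ 'd \<Rightarrow> 'a"
    and len :: "complex ^ 'd \<Rightarrow> real"
    and G :: "nat \<Rightarrow> (complex ^ 'd) set" and G_inf :: "(complex ^ 'd) set"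
  assumes "CARD('d) \<ge> 2"
    and "multiplier \<sigma>"
    and "twisted_group_cstar_algebra \<sigma> \<AA> U"
    and "length_function torus len" and "continuous_on (carrier torus) len"
    and "\<And>n. subgroup (G n) torus" and "\<And>n. closed (G n)"
    and "subgroup G_inf torus" and "closed G_inf"
    and "(\<lambda>n. hausdorff_distance (length_metric torus len) (G n) G_inf) \<longlonglongrightarrow> 0"
  shows "(\<forall>n. quasi_leibniz_qcms (leibniz_fun 1 0)
        (fixed_point_algebra \<AA> U (G n)) (lip_seminorm \<AA> U len)) \<and>
    quasi_leibniz_qcms (leibniz_fun 1 0)
        (fixed_point_algebra \<AA> U G_inf) (lip_seminorm \<AA> U len) \<and>
    (\<lambda>n. propinquity (leibniz_fun 1 0)
        (fixed_point_algebra \<AA> U (G n), lip_seminorm \<AA> U len)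
        (fixed_point_algebra \<AA> U G_inf, lip_seminorm \<AA> U len)) \<longlonglongrightarrow> 0"
proof -
  interpret cstar_algebra \<AA>
    using assms(3) by (simp add: twisted_group_cstar_algebra_def)
  interpret quantum_torus_length \<AA> \<sigma> U len
    by unfold_locales (use assms in auto)
  have "(\<lambda>n. propinquity (leibniz_fun 1 0) (fixed (G n), L) (fixed G_inf, L)) \<longlonglongrightarrow> 0"
  proof (rule order_tendstoI)
    fix e :: ennreal assume "0 < e"
    then obtain z where z: "0 < z" "z < e"
      using dense by blast
    then obtain h where h: "z = ennreal h"
      by (cases z) auto
    have "\<forall>\<^sub>F n in sequentially. hausdorff_distance (length_metric torus len) (G n) G_inf < z"
      using assms(10) z(1) by (rule order_tendstoD)
    then show "\<forall>\<^sub>F n in sequentially. propinquity (leibniz_fun 1 0) (fixed (G n), L) (fixed G_inf, L) < e"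
    proof eventually_elim
      case (elim n)
      then have "propinquity (leibniz_fun 1 0) (fixed (G n), L) (fixed G_inf, L) \<le> ennreal h"
        unfolding h using assms(6,8) by (intro propinquity_le)
      with z(2) h show ?case by simp
    qed
  qed simp
  then show ?thesis
    using quasi_leibniz assms(6,8) by simp
qed

end
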